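(* For every fixed $k$, regex $k$-UCQs can be evaluated with polynomial delay: there is an algorithm that, given a regex $k$-UCQ $q$ and a string $\mathbf{s}\in\Sigma^*$, enumerates $[\![q]\!](\mathbf{s})$, each tuple exactly once, such that the time between every two consecutive answers produced is polynomial in the size of the input $(q,\mathbf{s})$.
   Context: Strings and spans. $\Sigma$ is a finite alphabet with $|\Sigma|\ge 2$. A span of $\mathbf{s}=\sigma_1\cdots\sigma_\ell\in\Sigma^*$ is an expression $[i,j\rangle$ with $1\le i\le j\le \ell+1$. $\mathsf{Vars}$ is an infinite set of variables, disjoint from $\Sigma$. For finite $V\subset\mathsf{Vars}$, a $(V,\mathbf{s})$-tuple is a function from $V$ to the spans of $\mathbf{s}$. Ref-words. For finite $V\subset\mathsf{Vars}$ let $\Gamma_V=\{x{\vdash},\ {\dashv}x \mid x\in V\}$, disjoint from $\Sigma$. A word $\mathbf{r}\in(\Sigma\cup\Gamma_V)^*$ is valid for $V$ if for each $x\in V$ it contains exactly one $x{\vdash}$ and exactly one ${\dashv}x$, the former to the left of the latter. $\mathsf{clr}$ is the morphism erasing $\Gamma_V$ and fixing $\Sigma$. A valid $\mathbf{r}$ with $\mathsf{clr}(\mathbf{r})=\mathbf{s}$ defines the $(V,\mathbf{s})$-tuple $\mu^{\mathbf{r}}$: writing $\mathbf{r}=\mathbf{r}'_x\, x{\vdash}\,\mathbf{r}_x\,{\dashv}x\,\mathbf{r}''_x$, $\mu^{\mathbf{r}}(x)=[i,j\rangle$ with $i=|\mathsf{clr}(\mathbf{r}'_x)|+1$, $j=i+|\mathsf{clr}(\mathbf{r}_x)|$.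 Regex formulas. Syntax: $\alpha ::= \emptyset\mid\epsilon\mid\sigma\mid(\alpha\vee\alpha)\mid(\alpha\cdot\alpha)\mid\alpha^*\mid x\{\alpha\}$ with $\sigma\in\Sigma$, $x\in\mathsf{Vars}$. $\mathsf{Vars}(\alpha)$ is the set of variables occurring in $\alpha$. $\mathcal{R}(\alpha)$ is defined as the language of a regular expression, with $\mathcal{R}(x\{\beta\})=x{\vdash}\,\mathcal{R}(\beta)\,{\dashv}x$. $[\![\alpha]\!](\mathbf{s})=\{\mu^{\mathbf{r}}\mid \mathbf{r}\in\mathcal{R}(\alpha)\text{ valid for }\mathsf{Vars}(\alpha),\ \mathsf{clr}(\mathbf{r})=\mathbf{s}\}$. Regex formulas are assumed functional: every word in $\mathcal{R}(\alpha)$ is valid for $\mathsf{Vars}(\alpha)$. Queries. A regex CQ is $q=\pi_Y(\alpha_1\bowtie\cdots\bowtie\alpha_l)$ with $l\ge1$, regex formulas $\alpha_i$ (its atoms), $Y\subseteq\bigcup_i\mathsf{Vars}(\alpha_i)$; $[\![q]\!](\mathbf{s})$ is the set of restrictions to $Y$ of those $(\bigcup_i\mathsf{Vars}(\alpha_i),\mathbf{s})$-tuples $\mu$ with $\mu|_{\mathsf{Vars}(\alpha_i)}\in[\![\alpha_i]\!](\mathbf{s})$ for all $i$. A regex $k$-CQ is a regex CQ with at most $k$ atoms. A regex $k$-UCQ is a union (with any number of disjuncts) of regex $k$-CQs all having the same set of output variables; its semantics is the union of the semantics of its disjuncts. *)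

theory Defs
  imports "HOL-Computational_Algebra.Polynomial" "HOL-Library.Cardinality"
begin

section \<open>Spans and ref-words\<close>

text \<open>
  The alphabet is a finite type \<open>'a\<close>. A span \<open>[i, j\<rangle>\<close> is the pair \<open>(i, j)\<close>. Tuples are partial
  functions whose domain is the intended set of variables.
\<close>

type_synonym var = nat
type_synonym span = "nat \<times> nat"
type_synonym span_tuple = "var \<rightharpoonup> span"

definition spans :: "'a list \<Rightarrow> span set" where
  "spans s = {(i, j). 1 \<le> i \<and> i \<le> j \<and> j \<le> length s + 1}"

definition is_tuple :: "var set \<Rightarrow> 'a list \<Rightarrow> span_tuple \<Rightarrow> bool" where
  "is_tuple V s \<mu> \<longleftrightarrow> dom \<mu> = V \<and> ran \<mu> \<subseteq> spans s"

datatype 'a ref_symbol = Letter 'a | Open var | Close var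

type_synonym 'a ref_word = "'a ref_symbol list"

fun clr :: "'a ref_word \<Rightarrow> 'a list" where
  "clr [] = []"
| "clr (Letter a # r) = a # clr r"
| "clr (Open x # r) = clr r"
| "clr (Close x # r) = clr r"

definition valid :: "var set \<Rightarrow> 'a ref_word \<Rightarrow> bool" where
  "valid V r \<longleftrightarrow>
     set r \<subseteq> range Letter \<union> Open ` V \<union> Close ` V \<and>
     (\<forall>x\<in>V. count_list r (Open x) = 1 \<and> count_list r (Close x) = 1 \<and>
        (\<exists>u v w. r = u @ Open x # v @ Close x # w))"

text \<open>If \<open>r = u @ Open x # v @ Close x # w\<close> is valid, then \<open>before_open x r = u\<close> and
  \<open>captured x r = v\<close>.\<close>

definition before_open :: "var \<Rightarrow> 'a ref_word \<Rightarrow> 'a ref_word" where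
  "before_open x r = takeWhile (\<lambda>c. c \<noteq> Open x) r"

definition captured :: "var \<Rightarrow> 'a ref_word \<Rightarrow> 'a ref_word" where
  "captured x r = takeWhile (\<lambda>c. c \<noteq> Close x) (tl (dropWhile (\<lambda>c. c \<noteq> Open x) r))"

definition span_of :: "'a ref_word \<Rightarrow> var \<Rightarrow> span" where
  "span_of r x =
     (let i = length (clr (before_open x r)) + 1
      in (i, i + length (clr (captured x r))))"

definition tuple_of :: "var set \<Rightarrow> 'a ref_word \<Rightarrow> span_tuple" where
  "tuple_of V r = (\<lambda>x. if x \<in> V then Some (span_of r x) else None)"


section \<open>Regex formulas\<close>

datatype 'a regex =
    Empty
  | Eps
  | Sym 'a
  | Or "'a regex" "'a regex"
  | Cat "'a regex" "'a regex"
  | Star "'a regex"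
  | Capture var "'a regex"

fun vars :: "'a regex \<Rightarrow> var set" where
  "vars Empty = {}"
| "vars Eps = {}"
| "vars (Sym a) = {}"
| "vars (Or \<alpha> \<beta>) = vars \<alpha> \<union> vars \<beta>"
| "vars (Cat \<alpha> \<beta>) = vars \<alpha> \<union> vars \<beta>"
| "vars (Star \<alpha>) = vars \<alpha>"
| "vars (Capture x \<alpha>) = insert x (vars \<alpha>)"

fun ref_lang :: "'a regex \<Rightarrow> 'a ref_word set" where
  "ref_lang Empty = {}"
| "ref_lang Eps = {[]}"
| "ref_lang (Sym a) = {[Letter a]}"
| "ref_lang (Or \<alpha> \<beta>) = ref_lang \<alpha> \<union> ref_lang \<beta>"
| "ref_lang (Cat \<alpha> \<beta>) = {u @ v | u v. u \<in> ref_lang \<alpha> \<and> v \<in> ref_lang \<beta>}"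
| "ref_lang (Star \<alpha>) = {concat ws | ws. set ws \<subseteq> ref_lang \<alpha>}"
| "ref_lang (Capture x \<alpha>) = {Open x # u @ [Close x] | u. u \<in> ref_lang \<alpha>}"

definition functional :: "'a regex \<Rightarrow> bool" where
  "functional \<alpha> \<longleftrightarrow> (\<forall>r\<in>ref_lang \<alpha>. valid (vars \<alpha>) r)"

definition regex_sem :: "'a regex \<Rightarrow> 'a list \<Rightarrow> span_tuple set" where
  "regex_sem \<alpha> s =
     {tuple_of (vars \<alpha>) r | r. r \<in> ref_lang \<alpha> \<and> valid (vars \<alpha>) r \<and> clr r = s}"


section \<open>Regex CQs and regex UCQs\<close>

text \<open>The projection \<open>\<pi>\<^sub>Y\<close> is written with a list of variables; only its set of elements matters.\<close>

datatype 'a regex_cq = CQ (out_list: "var list") (atoms: "'a regex list")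

type_synonym 'a regex_ucq = "'a regex_cq list"

definition cq_out :: "'a regex_cq \<Rightarrow> var set" where
  "cq_out q = set (out_list q)"

definition cq_vars :: "'a regex_cq \<Rightarrow> var set" where
  "cq_vars q = (\<Union>\<alpha>\<in>set (atoms q). vars \<alpha>)"

definition is_regex_cq :: "'a regex_cq \<Rightarrow> bool" where
  "is_regex_cq q \<longleftrightarrow>
     1 \<le> length (atoms q) \<and> (\<forall>\<alpha>\<in>set (atoms q). functional \<alpha>) \<and> cq_out q \<subseteq> cq_vars q"

definition is_regex_k_cq :: "nat \<Rightarrow> 'a regex_cq \<Rightarrow> bool" where
  "is_regex_k_cq k q \<longleftrightarrow> is_regex_cq q \<and> length (atoms q) \<le> k"

definition is_regex_k_ucq :: "nat \<Rightarrow> 'a regex_ucq \<Rightarrow> bool" where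
  "is_regex_k_ucq k Q \<longleftrightarrow>
     (\<forall>q\<in>set Q. is_regex_k_cq k q) \<and> (\<forall>q\<in>set Q. \<forall>q'\<in>set Q. cq_out q = cq_out q')"

definition cq_sem :: "'a regex_cq \<Rightarrow> 'a list \<Rightarrow> span_tuple set" where
  "cq_sem q s =
     {\<mu> |` cq_out q | \<mu>.
        is_tuple (cq_vars q) s \<mu> \<and> (\<forall>\<alpha>\<in>set (atoms q). \<mu> |` vars \<alpha> \<in> regex_sem \<alpha> s)}"

definition ucq_sem :: "'a regex_ucq \<Rightarrow> 'a list \<Rightarrow> span_tuple set" where
  "ucq_sem Q s = (\<Union>q\<in>set Q. cq_sem q s)"


section \<open>The model of computation\<close>

text \<open>
  Algorithms are programs of a first-order, call-by-value Lisp: a finite list of (mutually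
  recursive) function definitions over binary trees whose leaves are either blank or labelled with
  a letter of the finite alphabet \<open>'a\<close>. Trees are accessed only through constant-time operations
  (building a cell, taking a component, testing for the blank leaf, comparing two letters), so that
  on a machine that stores trees as shared linked cells every tick below is a constant
  amount of work. In particular there is no unit-cost comparison of trees and no unit-cost
  arithmetic, and up to polynomials time is Turing machine time.

  An evaluation yields a value and a trace, recording the elapsed time units and the outputs
  in chronological order. An output additionally costs one tick for every node of the tree written.
\<close>

datatype 'a tree = Leaf | Atom 'a | Cell "'a tree" "'a tree"

fun nodes :: "'a tree \<Rightarrow> nat" where
  "nodes Leaf = 1"
| "nodes (Atom a) = 1"
| "nodes (Cell t u) = 1 + nodes t + nodes u"

datatype 'a expr =
    EVar nat
  | EConst "'a tree"
  | ECell "'a expr" "'a expr"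
  | EFst "'a expr"
  | ESnd "'a expr"
  | ESame "'a expr" "'a expr"
  | EIf "'a expr" "'a expr" "'a expr"
  | ELet "'a expr" "'a expr"
  | ECall nat "'a expr list"
  | EEmit "'a expr" "'a expr"

type_synonym 'a program = "'a expr list"

fun fst_tree :: "'a tree \<Rightarrow> 'a tree" where
  "fst_tree (Cell t u) = t"
| "fst_tree Leaf = Leaf"
| "fst_tree (Atom a) = Leaf"

fun snd_tree :: "'a tree \<Rightarrow> 'a tree" where
  "snd_tree (Cell t u) = u"
| "snd_tree Leaf = Leaf"
| "snd_tree (Atom a) = Leaf"

text \<open>Truth values: \<open>Leaf\<close> is false, everything else is true.\<close>

definition bool_tree :: "bool \<Rightarrow> 'a tree" where
  "bool_tree b = (if b then Cell Leaf Leaf else Leaf)"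

definition same_letter :: "'a tree \<Rightarrow> 'a tree \<Rightarrow> bool" where
  "same_letter t u \<longleftrightarrow> (\<exists>a. t = Atom a \<and> u = Atom a)"

datatype 'a event = Tick | Out "'a tree"

text \<open>
  \<open>eval P env e t tr\<close>: in program \<open>P\<close> with local variables \<open>env\<close> (de Bruijn indices), \<open>e\<close> terminates
  with value \<open>t\<close> and trace \<open>tr\<close>. Divergence, and access to an undefined variable or function, is
  the absence of a derivation.
\<close>

inductive eval :: "'a program \<Rightarrow> 'a tree list \<Rightarrow> 'a expr \<Rightarrow> 'a tree \<Rightarrow> 'a event list \<Rightarrow> bool"
  and evals :: "'a program \<Rightarrow> 'a tree list \<Rightarrow> 'a expr list \<Rightarrow> 'a tree list \<Rightarrow> 'a event list \<Rightarrow> bool"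
  for P :: "'a program"
where
  eval_var: "i < length env \<Longrightarrow> eval P env (EVar i) (env ! i) [Tick]"
| eval_const: "eval P env (EConst t) t [Tick]"
| eval_cell: "eval P env e t tr \<Longrightarrow> eval P env e' t' tr' \<Longrightarrow>
    eval P env (ECell e e') (Cell t t') (tr @ tr' @ [Tick])"
| eval_fst: "eval P env e t tr \<Longrightarrow> eval P env (EFst e) (fst_tree t) (tr @ [Tick])"
| eval_snd: "eval P env e t tr \<Longrightarrow> eval P env (ESnd e) (snd_tree t) (tr @ [Tick])"
| eval_same: "eval P env e t tr \<Longrightarrow> eval P env e' t' tr' \<Longrightarrow>
    eval P env (ESame e e') (bool_tree (same_letter t t')) (tr @ tr' @ [Tick])"
| eval_if_true: "eval P env e t tr \<Longrightarrow> t \<noteq> Leaf \<Longrightarrow> eval P env e1 t' tr' \<Longrightarrow>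
    eval P env (EIf e e1 e2) t' (tr @ [Tick] @ tr')"
| eval_if_false: "eval P env e Leaf tr \<Longrightarrow> eval P env e2 t' tr' \<Longrightarrow>
    eval P env (EIf e e1 e2) t' (tr @ [Tick] @ tr')"
| eval_let: "eval P env e t tr \<Longrightarrow> eval P (t # env) e' t' tr' \<Longrightarrow>
    eval P env (ELet e e') t' (tr @ [Tick] @ tr')"
| eval_call: "evals P env es ts tr \<Longrightarrow> f < length P \<Longrightarrow> eval P ts (P ! f) t tr' \<Longrightarrow>
    eval P env (ECall f es) t (tr @ [Tick] @ tr')"
| eval_emit: "eval P env e t tr \<Longrightarrow> eval P env e' t' tr' \<Longrightarrow>
    eval P env (EEmit e e') t' (tr @ replicate (nodes t) Tick @ [Out t] @ tr')"
| evals_nil: "evals P env [] [] []"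
| evals_cons: "eval P env e t tr \<Longrightarrow> evals P env es ts tr' \<Longrightarrow>
    evals P env (e # es) (t # ts) (tr @ [Tick] @ tr')"

text \<open>Function \<open>0\<close> is the main function; its result is discarded, only the outputs count.\<close>

definition run :: "'a program \<Rightarrow> 'a tree \<Rightarrow> 'a event list \<Rightarrow> bool" where
  "run P input tr \<longleftrightarrow> P \<noteq> [] \<and> (\<exists>t. eval P [input] (P ! 0) t tr)"

lemma eval_deterministic:
  "eval P env e t tr \<Longrightarrow> eval P env e t' tr' \<Longrightarrow> t' = t \<and> tr' = tr"
  "evals P env es ts tr \<Longrightarrow> evals P env es ts' tr' \<Longrightarrow> ts' = ts \<and> tr' = tr"
proof (induction arbitrary: t' tr' and ts' tr' rule: eval_evals.inducts)
  case eval_var from eval_var.prems show ?case by cases auto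
next
  case eval_const from eval_const.prems show ?case by cases auto
next
  case eval_cell from eval_cell.prems show ?case by cases (use eval_cell.IH in blast)
next
  case eval_fst from eval_fst.prems show ?case by cases (use eval_fst.IH in blast)
next
  case eval_snd from eval_snd.prems show ?case by cases (use eval_snd.IH in blast)
next
  case eval_same from eval_same.prems show ?case by cases (use eval_same.IH in blast)
next
  case eval_if_true
  from eval_if_true.prems show ?case by cases (use eval_if_true.IH eval_if_true.hyps in blast)+
next
  case eval_if_false
  from eval_if_false.prems show ?case by cases (use eval_if_false.IH in blast)+
next
  case eval_let from eval_let.prems show ?case by cases (use eval_let.IH in blast)
next
  case eval_call from eval_call.prems show ?case by cases (use eval_call.IH in blast)
next
  case eval_emit from eval_emit.prems show ?case by cases (use eval_emit.IH in blast)
next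
  case evals_nil from evals_nil.prems show ?case by cases auto
next
  case evals_cons from evals_cons.prems show ?case by cases (use evals_cons.IH in blast)
qed

corollary run_deterministic: "run P input tr \<Longrightarrow> run P input tr' \<Longrightarrow> tr' = tr"
  unfolding run_def using eval_deterministic(1) by blast

fun outputs :: "'a event list \<Rightarrow> 'a tree list" where
  "outputs [] = []"
| "outputs (Tick # tr) = outputs tr"
| "outputs (Out t # tr) = t # outputs tr"

text \<open>
  Every uninterrupted stretch of computation is bounded: the time up to the first output (or up to
  termination, if there is none), between two consecutive outputs, and from the last output to
  termination.
\<close>

definition delay_at_most :: "nat \<Rightarrow> 'a event list \<Rightarrow> bool" where
  "delay_at_most b tr \<longleftrightarrow> (\<forall>u n w. tr = u @ replicate n Tick @ w \<longrightarrow> n \<le> b)"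

text \<open>
  \<open>I\<close> is the set of instances, \<open>enc\<close> their encoding as inputs, \<open>sol\<close> maps an instance to its
  set of answers, and \<open>repr t y\<close> says that the output \<open>t\<close> represents the answer \<open>y\<close>.
\<close>

definition enumerates_with_polynomial_delay ::
    "'a program \<Rightarrow> 'i set \<Rightarrow> ('i \<Rightarrow> 'a tree) \<Rightarrow> ('i \<Rightarrow> 'y set) \<Rightarrow> ('a tree \<Rightarrow> 'y \<Rightarrow> bool) \<Rightarrow> bool" where
  "enumerates_with_polynomial_delay P I enc sol repr \<longleftrightarrow>
     (\<exists>p :: nat poly. \<forall>x\<in>I. \<exists>tr.
        run P (enc x) tr \<and>
        (\<exists>ys. list_all2 repr (outputs tr) ys \<and> distinct ys \<and> set ys = sol x) \<and>
        delay_at_most (poly p (nodes (enc x))) tr)"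


section \<open>Encoding of inputs and answers\<close>

fun enc_list :: "'a tree list \<Rightarrow> 'a tree" where
  "enc_list [] = Leaf"
| "enc_list (t # ts) = Cell t (enc_list ts)"

text \<open>Numbers are written in binary, least significant bit first.\<close>

fun bits :: "nat \<Rightarrow> bool list" where
  "bits n = (if n = 0 then [] else odd n # bits (n div 2))"

declare bits.simps [simp del]

definition enc_nat :: "nat \<Rightarrow> 'a tree" where
  "enc_nat n = enc_list (map bool_tree (bits n))"

fun enc_regex :: "'a regex \<Rightarrow> 'a tree" where
  "enc_regex Empty = enc_list [enc_nat 0]"
| "enc_regex Eps = enc_list [enc_nat 1]"
| "enc_regex (Sym a) = enc_list [enc_nat 2, Atom a]"
| "enc_regex (Or \<alpha> \<beta>) = enc_list [enc_nat 3, enc_regex \<alpha>, enc_regex \<beta>]"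
| "enc_regex (Cat \<alpha> \<beta>) = enc_list [enc_nat 4, enc_regex \<alpha>, enc_regex \<beta>]"
| "enc_regex (Star \<alpha>) = enc_list [enc_nat 5, enc_regex \<alpha>]"
| "enc_regex (Capture x \<alpha>) = enc_list [enc_nat 6, enc_nat x, enc_regex \<alpha>]"

definition enc_cq :: "'a regex_cq \<Rightarrow> 'a tree" where
  "enc_cq q = Cell (enc_list (map enc_nat (out_list q))) (enc_list (map enc_regex (atoms q)))"

definition enc_ucq :: "'a regex_ucq \<Rightarrow> 'a tree" where
  "enc_ucq Q = enc_list (map enc_cq Q)"

definition enc_string :: "'a list \<Rightarrow> 'a tree" where
  "enc_string s = enc_list (map Atom s)"

definition enc_input :: "'a regex_ucq \<times> 'a list \<Rightarrow> 'a tree" where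
  "enc_input = (\<lambda>(Q, s). Cell (enc_ucq Q) (enc_string s))"

text \<open>An answer is output as a list of its bindings, in any order.\<close>

definition enc_binding :: "var \<times> span \<Rightarrow> 'a tree" where
  "enc_binding = (\<lambda>(x, i, j). Cell (enc_nat x) (Cell (enc_nat i) (enc_nat j)))"

definition represents_tuple :: "'a tree \<Rightarrow> span_tuple \<Rightarrow> bool" where
  "represents_tuple t \<mu> \<longleftrightarrow>
     (\<exists>bs. t = enc_list (map enc_binding bs) \<and> distinct (map fst bs) \<and> map_of bs = \<mu>)"

end

theory Submission
  imports Defs
begin

text \<open>
  The answers are enumerated by a flashlight search: the output variables are assigned spans one
  after the other, and a partial assignment is pursued only if some disjunct has an answer that
  extends it. Thus every branch that is entered leads to an output, and the delay is polynomial as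
  soon as extendability is decidable in polynomial time.

  A regex formula is matched by a machine whose state is the stack of what remains to be matched; it
  has linearly many reachable states. A conjunctive query with \<open>k\<close> atoms is a walk of \<open>k\<close> such
  machines that read the letters of the string in lockstep but perform their variable operations
  independently. As the formulas are functional, the future of a stack determines which variables
  are yet to be opened or closed. The chosen ref-words define compatible tuples if and only if these
  statuses agree before each letter, among the machines and with the partial assignment, and the
  number of joint states is polynomial for fixed \<open>k\<close>.
\<close>

section \<open>Cost calculus and program text\<close>

section \<open>A weakest-precondition calculus for silent evaluation\<close>

text \<open>Extendability is tested for the union as a whole: a partial assignment survives if any
  disjunct can complete it. Hence an answer shared by several disjuncts is met only once, and no
  record of past answers has to be kept. Machines synchronise only at letters because ref-words of
  the same tuple may order the operations between two letters differently; just before a letter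
  those operations are all done, and the statuses there determine every span, even one that ends
  behind the last letter. The empty string has no boundary to check, and its only span is
  \<open>[1, 1>\<close>. The exponent \<open>k\<close> enters only through the product of the stack
  sets, so one program serves all \<open>k\<close> and only the polynomial varies. Silent
  computations have a number as their cost, bounded function by function; the functions that may
  emit need whole traces. The obstacle there is that a gap can start in one recursive call and end
  in another, so bounding the gaps inside each call is not enough: the time before the first and
  after the last output is tracked as well.\<close>

definition wp :: "'a program \<Rightarrow> 'a tree list \<Rightarrow> 'a expr \<Rightarrow> ('a tree \<Rightarrow> nat \<Rightarrow> bool) \<Rightarrow> bool" where
  "wp P env e Q \<longleftrightarrow> (\<exists>t tr. eval P env e t tr \<and> set tr \<subseteq> {Tick} \<and> Q t (length tr))"

definition wps :: "'a program \<Rightarrow> 'a tree list \<Rightarrow> 'a expr list \<Rightarrow> ('a tree list \<Rightarrow> nat \<Rightarrow> bool) \<Rightarrow> bool" where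
  "wps P env es Q \<longleftrightarrow> (\<exists>ts tr. evals P env es ts tr \<and> set tr \<subseteq> {Tick} \<and> Q ts (length tr))"

inductive_cases eval_elims:
  "eval P env (EVar i) t tr" "eval P env (EConst c) t tr" "eval P env (ECell e e') t tr"
  "eval P env (EFst e) t tr" "eval P env (ESnd e) t tr" "eval P env (ESame e e') t tr"
  "eval P env (EIf e e1 e2) t tr" "eval P env (ELet e e') t tr" "eval P env (ECall f es) t tr"
  "evals P env [] ts tr" "evals P env (e # es) ts tr"

lemma eval_iffs:
  "eval P env (EVar i) t tr \<longleftrightarrow> i < length env \<and> t = env ! i \<and> tr = [Tick]"
  "eval P env (EConst c) t tr \<longleftrightarrow> t = c \<and> tr = [Tick]"
  "eval P env (ECell e e') t tr \<longleftrightarrow> (\<exists>t1 tr1 t2 tr2. eval P env e t1 tr1 \<and> eval P env e' t2 tr2 \<and>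
    t = Cell t1 t2 \<and> tr = tr1 @ tr2 @ [Tick])"
  "eval P env (EFst e) t tr \<longleftrightarrow> (\<exists>t1 tr1. eval P env e t1 tr1 \<and> t = fst_tree t1 \<and> tr = tr1 @ [Tick])"
  "eval P env (ESnd e) t tr \<longleftrightarrow> (\<exists>t1 tr1. eval P env e t1 tr1 \<and> t = snd_tree t1 \<and> tr = tr1 @ [Tick])"
  "eval P env (ESame e e') t tr \<longleftrightarrow> (\<exists>t1 tr1 t2 tr2. eval P env e t1 tr1 \<and> eval P env e' t2 tr2 \<and>
    t = bool_tree (same_letter t1 t2) \<and> tr = tr1 @ tr2 @ [Tick])"
  "eval P env (ELet e e') t tr \<longleftrightarrow> (\<exists>t1 tr1 tr2. eval P env e t1 tr1 \<and> eval P (t1 # env) e' t tr2 \<and>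
    tr = tr1 @ [Tick] @ tr2)"
  "eval P env (ECall f es) t tr \<longleftrightarrow> (\<exists>ts tr1 tr2. evals P env es ts tr1 \<and> f < length P \<and>
    eval P ts (P ! f) t tr2 \<and> tr = tr1 @ [Tick] @ tr2)"
  "evals P env [] ts tr \<longleftrightarrow> ts = [] \<and> tr = []"
  "evals P env (e # es) ts tr \<longleftrightarrow> (\<exists>t1 tr1 ts2 tr2. eval P env e t1 tr1 \<and> evals P env es ts2 tr2 \<and>
    ts = t1 # ts2 \<and> tr = tr1 @ [Tick] @ tr2)"
  by (rule iffI, elim eval_elims, (intro exI conjI, (assumption | simp)+; fail),
    elim exE conjE, simp only: eval_evals.intros)+

text \<open>Merging the two rules for conditionals into one equation, with the branch chosen in the
  logic, lets rewriting pass a condition whose value is not yet known.\<close>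

lemma eval_if_iff:
  "eval P env (EIf e e1 e2) t tr \<longleftrightarrow> (\<exists>t1 tr1 tr2. eval P env e t1 tr1 \<and>
    eval P env (if t1 = Leaf then e2 else e1) t tr2 \<and> tr = tr1 @ [Tick] @ tr2)"
  (is "?l \<longleftrightarrow> ?r")
proof
  assume "eval P env (EIf e e1 e2) t tr"
  then show ?r
  proof (rule eval_elims)
    fix t1 tr1 tr2
    assume "tr = tr1 @ Tick # tr2" "eval P env e t1 tr1" "t1 \<noteq> Leaf" "eval P env e1 t tr2"
    then show ?r by (intro exI[of _ t1] exI[of _ tr1] exI[of _ tr2]) simp
  next
    fix tr1 tr2
    assume "tr = tr1 @ Tick # tr2" "eval P env e Leaf tr1" "eval P env e2 t tr2"
    then show ?r by (intro exI[of _ Leaf] exI[of _ tr1] exI[of _ tr2]) simp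
  qed
next
  assume "\<exists>t1 tr1 tr2. eval P env e t1 tr1 \<and>
    eval P env (if t1 = Leaf then e2 else e1) t tr2 \<and> tr = tr1 @ [Tick] @ tr2"
  then obtain t1 tr1 tr2 where *: "eval P env e t1 tr1"
    "eval P env (if t1 = Leaf then e2 else e1) t tr2" "tr = tr1 @ [Tick] @ tr2"
    by (elim exE conjE)
  show "eval P env (EIf e e1 e2) t tr"
  proof (cases "t1 = Leaf")
    case True
    with * show ?thesis by (simp only: if_True simp_thms eval_if_false)
  next
    case False
    with * show ?thesis by (simp only: if_False simp_thms eval_if_true)
  qed
qed

text \<open>Equations instead of implications, so that simplification executes a function body
  symbolically and leaves arithmetic about ticks. Calls are left out, since unfolding recursive
  functions would not terminate.\<close>

lemma wp_simps [simp]: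
  "i < length env \<Longrightarrow> wp P env (EVar i) Q \<longleftrightarrow> Q (env ! i) 1"
  "wp P env (EConst t) Q \<longleftrightarrow> Q t 1"
  "wp P env (ECell e e') Q \<longleftrightarrow>
    wp P env e (\<lambda>t n. wp P env e' (\<lambda>t' n'. Q (Cell t t') (n + n' + 1)))"
  "wp P env (EFst e) Q \<longleftrightarrow> wp P env e (\<lambda>t n. Q (fst_tree t) (n + 1))"
  "wp P env (ESnd e) Q \<longleftrightarrow> wp P env e (\<lambda>t n. Q (snd_tree t) (n + 1))"
  "wp P env (ESame e e') Q \<longleftrightarrow>
    wp P env e (\<lambda>t n. wp P env e' (\<lambda>t' n'. Q (bool_tree (same_letter t t')) (n + n' + 1)))"
  "wp P env (EIf e e1 e2) Q \<longleftrightarrow>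
    wp P env e (\<lambda>t n. wp P env (if t = Leaf then e2 else e1) (\<lambda>t' n'. Q t' (n + n' + 1)))"
  "wp P env (ELet e e') Q \<longleftrightarrow>
    wp P env e (\<lambda>t n. wp P (t # env) e' (\<lambda>t' n'. Q t' (n + n' + 1)))"
  "wps P env [] Qs \<longleftrightarrow> Qs [] 0"
  "wps P env (e # es) Qs \<longleftrightarrow>
    wp P env e (\<lambda>t n. wps P env es (\<lambda>ts n'. Qs (t # ts) (n + n' + 1)))"
  unfolding wp_def wps_def eval_iffs eval_if_iff
          apply (simp; fail)
         apply (simp; fail)
  by ((rule iffI, ((elim exE conjE, (simp only: set_append length_append Un_subset_iff)?, intro exI conjI,
    (assumption | rule refl)+, simp_all add: ac_simps; fail)+)) | (simp; fail))+

lemma wp_call: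
  "f < length P \<Longrightarrow> wp P env (ECall f es) Q \<longleftrightarrow>
    wps P env es (\<lambda>ts n. wp P ts (P ! f) (\<lambda>t n'. Q t (n + n' + 1)))"
  unfolding wp_def wps_def eval_iffs
  apply (rule iffI)
   apply (elim exE conjE)
   apply (simp only: set_append length_append Un_subset_iff)
   apply (intro exI conjI; (assumption | simp add: ac_simps))
  apply (elim exE conjE)
  subgoal for ts tr1 t tr2
    by (intro exI[of _ t] exI[of _ "tr1 @ [Tick] @ tr2"] conjI exI[of _ ts] exI[of _ tr1] exI[of _ tr2])
      (simp_all add: ac_simps)
  done

lemma wp_mono: "wp P env e Q \<Longrightarrow> (\<And>t n. Q t n \<Longrightarrow> Q' t n) \<Longrightarrow> wp P env e Q'"
  unfolding wp_def by blast

section \<open>The program\<close>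

datatype fname = Main | Eq | App | Mem | Find | Wit | Wits | Leq | AsgStat | Agree | Ok | IStep
  | ConsR | ConsL | ISucc | LStep | AllEmpty | Succ | Search | Als | Ext | Inc | Posl | Spl
  | Enum | Loop

primrec idx :: "fname \<Rightarrow> nat" where
  "idx Main = 0" | "idx Eq = 1" | "idx App = 2" | "idx Mem = 3" | "idx Find = 4" | "idx Wit = 5"
| "idx Wits = 6" | "idx Leq = 7" | "idx AsgStat = 8" | "idx Agree = 9" | "idx Ok = 10"
| "idx IStep = 11" | "idx ConsR = 12" | "idx ConsL = 13" | "idx ISucc = 14" | "idx LStep = 15"
| "idx AllEmpty = 16" | "idx Succ = 17" | "idx Search = 18" | "idx Als = 19" | "idx Ext = 20"
| "idx Inc = 21" | "idx Posl = 22" | "idx Spl = 23" | "idx Enum = 24" | "idx Loop = 25"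

abbreviation (input) call :: "fname \<Rightarrow> 'a expr list \<Rightarrow> 'a expr" where
  "call f es \<equiv> ECall (idx f) es"

text \<open>The status of a variable at a position of the string: \<open>stW\<close> (waiting) before its span, \<open>stO\<close>
  (open) inside, and \<open>Leaf\<close> behind it. The same trees label the operations in a list of operations:
  the status is the label of the next operation on the variable.\<close>

definition stW :: "'a tree" where "stW = Cell Leaf Leaf"
definition stO :: "'a tree" where "stO = Cell (Cell Leaf Leaf) Leaf"

abbreviation (input) "NIL \<equiv> EConst Leaf"
abbreviation (input) "T \<equiv> EConst (bool_tree True)"
abbreviation (input) "v \<equiv> EVar"

text \<open>Only the first bits of the numeral \<open>g\<close> are inspected, so that it must not exceed \<open>7\<close>.\<close>

definition dispatch :: "'a expr \<Rightarrow> 'a expr \<Rightarrow> 'a expr \<Rightarrow> 'a expr \<Rightarrow> 'a expr \<Rightarrow> 'a expr \<Rightarrow> 'a expr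
    \<Rightarrow> 'a expr \<Rightarrow> 'a expr \<Rightarrow> 'a expr" where
  "dispatch g e0 e1 e2 e3 e4 e5 e6 e7 =
    EIf g
      (EIf (EFst g)
        (EIf (ESnd g) (EIf (EFst (ESnd g)) (EIf (ESnd (ESnd g)) e7 e3) e5) e1)
        (EIf (EFst (ESnd g)) (EIf (ESnd (ESnd g)) e6 e2) e4))
      e0"


text \<open>Conventions hidden by the de Bruijn indices: \<open>Search\<close> receives the states
  to be visited, the visited ones, the witnesses of the atoms, the operations of all atoms and the
  assignment. \<open>Enum\<close> receives the remaining variables, the assignment with suffixes,
  the answer built so far, the query, all spans and the string; \<open>Loop\<close> has the spans
  still to be tried in front of these. A result that may be absent is \<open>Leaf\<close> or else
  wrapped as \<open>Cell Leaf r\<close>, because \<open>Leaf\<close> is also a legitimate list or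
  status.\<close>

primrec body :: "fname \<Rightarrow> 'a expr" where
  "body Main =
    ELet (call Spl [call Posl [ESnd (v 0), EConst (enc_nat 1)]])
      (call Enum [EFst (EFst (EFst (v 1))), NIL, NIL, EFst (v 1), v 0, ESnd (v 1)])"
\<comment> \<open>On a nonblank tree, \<open>ESame\<close> of the tree with itself succeeds exactly
  for a letter; this tells \<open>Atom\<close> from \<open>Cell\<close>.\<close>
| "body Eq =
    EIf (v 0)
      (EIf (ESame (v 0) (v 0)) (ESame (v 0) (v 1))
        (EIf (v 1)
          (EIf (ESame (v 1) (v 1)) NIL
            (EIf (call Eq [EFst (v 0), EFst (v 1)]) (call Eq [ESnd (v 0), ESnd (v 1)]) NIL))
          NIL))
      (EIf (v 1) NIL T)"
| "body App = EIf (v 0) (ECell (EFst (v 0)) (call App [ESnd (v 0), v 1])) (v 1)"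
| "body Mem = EIf (v 1) (EIf (call Eq [v 0, EFst (v 1)]) T (call Mem [v 0, ESnd (v 1)])) NIL"
| "body Find =
    EIf (v 1)
      (EIf (call Eq [v 0, ESnd (EFst (v 1))]) (EFst (EFst (v 1))) (call Find [v 0, ESnd (v 1)]))
      NIL"
| "body Wit =
    dispatch (EFst (v 0))
      NIL
      (ECell NIL (v 1))
      (ECell NIL (v 1))
      (ELet (call Wit [EFst (ESnd (v 0)), v 1])
        (EIf (v 0) (v 0) (call Wit [EFst (ESnd (ESnd (v 1))), v 2])))
      (ELet (call Wit [EFst (ESnd (ESnd (v 0))), v 1])
        (EIf (v 0) (call Wit [EFst (ESnd (v 1)), ESnd (v 0)]) NIL))
      (ECell NIL (v 1))
      (ELet (call Wit [EFst (ESnd (ESnd (v 0))), ECell (ECell (EConst stO) (EFst (ESnd (v 0)))) (v 1)])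
        (EIf (v 0) (ECell NIL (ECell (ECell (EConst stW) (EFst (ESnd (v 1)))) (ESnd (v 0)))) NIL))
      (ECell NIL (ECell (ECell (EConst stO) (EFst (ESnd (v 0)))) (v 1)))"
| "body Wits =
    EIf (v 0)
      (ELet (call Wits [ESnd (v 0)]) (EIf (v 0) (call Wit [EFst (v 1), ESnd (v 0)]) NIL))
      (ECell NIL NIL)"
| "body Leq = EIf (v 0) (EIf (v 1) (call Leq [ESnd (v 0), ESnd (v 1)]) NIL) T"
| "body AsgStat =
    EIf (v 1)
      (EIf (call Eq [v 0, EFst (EFst (v 1))])
        (ECell NIL
          (EIf (call Leq [v 2, ESnd (ESnd (ESnd (EFst (v 1))))]) NIL
            (EIf (call Leq [v 2, ESnd (EFst (ESnd (EFst (v 1))))]) (EConst stO) (EConst stW))))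
        (call AsgStat [v 0, ESnd (v 1), v 2]))
      NIL"
| "body Agree =
    EIf (v 2)
      (EIf (call Find [v 0, EFst (v 1)])
        (ELet (ECell NIL (call Find [v 0, ESnd (call Wits [EFst (v 2)])]))
          (EIf (v 4)
            (EIf (call Eq [v 0, v 4]) (call Agree [v 1, ESnd (v 2), ESnd (v 3), v 4]) NIL)
            (call Agree [v 1, ESnd (v 2), ESnd (v 3), v 0])))
        (call Agree [v 0, ESnd (v 1), ESnd (v 2), v 3]))
      T"
| "body Ok =
    EIf (v 0)
      (EIf (call Agree [ESnd (EFst (v 0)), v 1, v 2, call AsgStat [ESnd (EFst (v 0)), v 3, v 4]])
        (call Ok [ESnd (v 0), v 1, v 2, v 3, v 4])
        NIL)
      T"
| "body IStep =
    EIf (v 0)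
      (dispatch (EFst (EFst (v 0)))
        NIL
        (ECell (ESnd (v 0)) NIL)
        NIL
        (ECell (ECell (EFst (ESnd (EFst (v 0)))) (ESnd (v 0)))
          (ECell (ECell (EFst (ESnd (ESnd (EFst (v 0))))) (ESnd (v 0))) NIL))
        (ECell (ECell (EFst (ESnd (EFst (v 0)))) (ECell (EFst (ESnd (ESnd (EFst (v 0))))) (ESnd (v 0)))) NIL)
        (ECell (ESnd (v 0)) (ECell (ECell (EFst (ESnd (EFst (v 0)))) (v 0)) NIL))
        (ECell
          (ECell (EFst (ESnd (ESnd (EFst (v 0)))))
            (ECell (ECell (EConst (enc_nat 7)) (ECell (EFst (ESnd (EFst (v 0)))) NIL)) (ESnd (v 0))))
          NIL)
        (ECell (ESnd (v 0)) NIL))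
      NIL"
| "body ConsR = EIf (v 0) (ECell (ECell (EFst (v 0)) (v 1)) (call ConsR [ESnd (v 0), v 1])) NIL"
| "body ConsL = EIf (v 1) (ECell (ECell (v 0) (EFst (v 1))) (call ConsL [v 0, ESnd (v 1)])) NIL"
| "body ISucc =
    EIf (v 0)
      (call App [call ConsR [call IStep [EFst (v 0)], ESnd (v 0)],
        call ConsL [EFst (v 0), call ISucc [ESnd (v 0)]]])
      NIL"
| "body LStep =
    EIf (v 0)
      (EIf (ESame (EFst (ESnd (EFst (EFst (v 0))))) (v 1))
        (ELet (call LStep [ESnd (v 0), v 1])
          (EIf (v 0) (ECell NIL (ECell (ESnd (EFst (v 1))) (ESnd (v 0)))) NIL))
        NIL)
      (ECell NIL NIL)"
| "body AllEmpty = EIf (v 0) (EIf (EFst (v 0)) NIL (call AllEmpty [ESnd (v 0)])) T"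
| "body Succ =
    call App [call ConsL [EFst (v 0), call ISucc [ESnd (v 0)]],
      EIf (EFst (v 0))
        (ELet (call LStep [ESnd (v 0), EFst (EFst (v 0))])
          (EIf (v 0)
            (EIf (call Ok [v 3, v 2, ESnd (v 1), v 4, EFst (v 1)])
              (ECell (ECell (ESnd (EFst (v 1))) (ESnd (v 0))) NIL)
              NIL)
            NIL))
        NIL]"
| "body Search =
    EIf (v 0)
      (EIf (call Mem [EFst (v 0), v 1])
        (call Search [ESnd (v 0), v 1, v 2, v 3, v 4])
        (EIf (EIf (EFst (EFst (v 0))) NIL (call AllEmpty [ESnd (EFst (v 0))]))
          T
          (call Search [call App [call Succ [EFst (v 0), v 2, v 3, v 4], ESnd (v 0)],
            ECell (EFst (v 0)) (v 1), v 2, v 3, v 4])))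
      NIL"
| "body Als = EIf (v 0) (ECell (ESnd (call Wit [EFst (v 0), NIL])) (call Als [ESnd (v 0)])) NIL"
| "body Ext =
    EIf (v 0)
      (EIf (call Search [ECell (ECell (v 1) (call ConsR [ESnd (EFst (v 0)), NIL])) NIL, NIL,
            call Als [ESnd (EFst (v 0))], ESnd (call Wits [ESnd (EFst (v 0))]), v 2])
        T
        (call Ext [ESnd (v 0), v 1, v 2]))
      NIL"
| "body Inc =
    EIf (v 0) (EIf (EFst (v 0)) (ECell NIL (call Inc [ESnd (v 0)])) (ECell T (ESnd (v 0)))) (ECell T NIL)"
| "body Posl = ECell (ECell (v 1) (v 0)) (EIf (v 0) (call Posl [ESnd (v 0), call Inc [v 1]]) NIL)"
| "body Spl = EIf (v 0) (call App [call ConsL [EFst (v 0), v 0], call Spl [ESnd (v 0)]]) NIL"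
\<comment> \<open>The output list may repeat variables. \<open>AsgStat\<close> serves here as a
  lookup: its wrapped result is \<open>Leaf\<close> exactly for an unassigned variable.\<close>
| "body Enum =
    EIf (call Ext [v 3, v 5, v 1])
      (EIf (v 0)
        (EIf (call AsgStat [EFst (v 0), v 1, v 5])
          (call Enum [ESnd (v 0), v 1, v 2, v 3, v 4, v 5])
          (call Loop [v 4, v 0, v 1, v 2, v 3, v 4, v 5]))
        (EEmit (v 2) NIL))
      NIL"
| "body Loop =
    EIf (v 0)
      (ELet
        (call Enum [ESnd (v 1), ECell (ECell (EFst (v 1)) (EFst (v 0))) (v 2),
          ECell (ECell (EFst (v 1)) (ECell (EFst (EFst (EFst (v 0)))) (EFst (ESnd (EFst (v 0)))))) (v 3),
          v 4, v 5, v 6])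
        (call Loop [ESnd (v 1), v 2, v 3, v 4, v 5, v 6, v 7]))
      NIL"

definition prog :: "'a program" where
  "prog = map body [Main, Eq, App, Mem, Find, Wit, Wits, Leq, AsgStat, Agree, Ok, IStep, ConsR,
     ConsL, ISucc, LStep, AllEmpty, Succ, Search, Als, Ext, Inc, Posl, Spl, Enum, Loop]"

lemma prog_idx: "idx f < length prog" "prog ! idx f = body f"
  by (cases f; simp add: prog_def)+

text \<open>A folded \<open>wp\<close> at which simplification stops, so that a call is resolved by
  the specification of its function, through \<open>callsI\<close>, and not by its body.\<close>

definition calls :: "fname \<Rightarrow> 'a tree list \<Rightarrow> ('a tree \<Rightarrow> nat \<Rightarrow> bool) \<Rightarrow> bool" where
  "calls f ts Q \<longleftrightarrow> wp prog ts (body f) Q"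

declare idx.simps [simp del] body.simps [simp del]

lemma wp_call_idx [simp]:
  "wp prog env (call f es) Q \<longleftrightarrow> wps prog env es (\<lambda>ts n. calls f ts (\<lambda>t n'. Q t (n + n' + 1)))"
  by (simp add: wp_call prog_idx calls_def)

lemma bool_tree_simps [simp]: "bool_tree b = Leaf \<longleftrightarrow> \<not> b" "Leaf = bool_tree b \<longleftrightarrow> \<not> b" "bool_tree False = Leaf"
  by (auto simp: bool_tree_def)

lemma nodes_pos [simp]: "0 < nodes t" "Suc 0 \<le> nodes t"
  by (cases t; simp)+

lemma enc_nat_numerals [simp]:
  "enc_nat 0 = Leaf"
  "enc_nat (Suc 0) = Cell (Cell Leaf Leaf) Leaf"
  "enc_nat 2 = Cell Leaf (Cell (Cell Leaf Leaf) Leaf)"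
  "enc_nat 3 = Cell (Cell Leaf Leaf) (Cell (Cell Leaf Leaf) Leaf)"
  "enc_nat 4 = Cell Leaf (Cell Leaf (Cell (Cell Leaf Leaf) Leaf))"
  "enc_nat 5 = Cell (Cell Leaf Leaf) (Cell Leaf (Cell (Cell Leaf Leaf) Leaf))"
  "enc_nat 6 = Cell Leaf (Cell (Cell Leaf Leaf) (Cell (Cell Leaf Leaf) Leaf))"
  "enc_nat 7 = Cell (Cell Leaf Leaf) (Cell (Cell Leaf Leaf) (Cell (Cell Leaf Leaf) Leaf))"
  by (simp_all add: enc_nat_def bits.simps bool_tree_def)


definition computes :: "fname \<Rightarrow> 'a tree list \<Rightarrow> 'a tree \<Rightarrow> nat \<Rightarrow> bool" where
  "computes f ts r b \<longleftrightarrow> calls f ts (\<lambda>t n. t = r \<and> n \<le> b)"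

lemma computesI:
  "wp prog ts (body f) (\<lambda>t n. t = r \<and> n \<le> b) \<Longrightarrow> computes f ts r b"
  by (simp add: computes_def calls_def)

lemma callsI: "computes f ts r b \<Longrightarrow> (\<And>n. n \<le> b \<Longrightarrow> Q r n) \<Longrightarrow> calls f ts Q"
  unfolding computes_def calls_def by (erule wp_mono) blast

lemma computes_weaken: "computes f ts r b \<Longrightarrow> b \<le> b' \<Longrightarrow> computes f ts r b'"
  unfolding computes_def by (erule callsI[unfolded computes_def]) auto

text \<open>The comparison descends both trees in parallel, so the first one alone bounds the time.
  Lookups therefore cost an amount that does not depend on the size of the entries they
  pass.\<close>

lemma computes_eq: "computes Eq [t, u] (bool_tree (t = u)) (40 * nodes t)"
proof (induction t arbitrary: u)
  case Leaf then show ?case by (cases u) (auto simp: body.simps intro!: computesI)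
next
  case (Atom a) then show ?case
    by (cases u) (auto simp: body.simps same_letter_def intro!: computesI)
next
  case (Cell t1 t2)
  show ?case
    by (cases u; rule computesI)
      (auto simp: body.simps same_letter_def intro!: callsI[OF Cell.IH(1)] callsI[OF Cell.IH(2)])
qed

section \<open>Correctness and running time of the subroutines\<close>

section \<open>Lists\<close>

primrec tlen :: "'a tree \<Rightarrow> nat" where
  "tlen Leaf = 0"
| "tlen (Atom a) = 1"
| "tlen (Cell t l) = Suc (tlen l)"

lemma tlen_enc_list [simp]: "tlen (enc_list xs) = length xs"
  by (induction xs) auto

text \<open>The clause for \<open>Atom\<close> reproduces what the program does on trees that encode
  no list; thus the specification of \<open>App\<close> holds for all trees and carries no side
  condition.\<close>

primrec append_tree :: "'a tree \<Rightarrow> 'a tree \<Rightarrow> 'a tree" where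
  "append_tree Leaf u = u"
| "append_tree (Atom a) u = Cell Leaf u"
| "append_tree (Cell t l) u = Cell t (append_tree l u)"

lemma append_tree_enc_list [simp]: "append_tree (enc_list xs) (enc_list ys) = enc_list (xs @ ys)"
  by (induction xs) auto

lemma computes_app: "computes App [t, u] (append_tree t u) (20 * tlen t + 10)"
proof (induction t)
  case (Atom a)
  have "computes App [Leaf, u] u 10"
    by (auto simp: body.simps intro!: computesI)
  then show ?case
    by (auto simp: body.simps intro!: computesI elim!: callsI)
qed (auto simp: body.simps intro!: computesI elim!: callsI)

primrec cons_right :: "'a tree \<Rightarrow> 'a tree \<Rightarrow> 'a tree" where
  "cons_right Leaf u = Leaf"
| "cons_right (Atom a) u = Cell (Cell Leaf u) Leaf"
| "cons_right (Cell t l) u = Cell (Cell t u) (cons_right l u)"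

lemma cons_right_enc_list [simp]:
  "cons_right (enc_list xs) u = enc_list (map (\<lambda>x. Cell x u) xs)"
  by (induction xs) auto

lemma computes_consR: "computes ConsR [t, u] (cons_right t u) (20 * tlen t + 10)"
proof (induction t)
  case (Atom a)
  have "computes ConsR [Leaf, u] Leaf 10"
    by (auto simp: body.simps intro!: computesI)
  then show ?case
    by (auto simp: body.simps intro!: computesI elim!: callsI)
qed (auto simp: body.simps intro!: computesI elim!: callsI)

primrec cons_left :: "'a tree \<Rightarrow> 'a tree \<Rightarrow> 'a tree" where
  "cons_left u Leaf = Leaf"
| "cons_left u (Atom a) = Cell (Cell u Leaf) Leaf"
| "cons_left u (Cell t l) = Cell (Cell u t) (cons_left u l)"

lemma cons_left_enc_list [simp]: "cons_left u (enc_list xs) = enc_list (map (Cell u) xs)"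
  by (induction xs) auto

lemma computes_consL: "computes ConsL [u, t] (cons_left u t) (20 * tlen t + 10)"
proof (induction t)
  case (Atom a)
  have "computes ConsL [u, Leaf] Leaf 10"
    by (auto simp: body.simps intro!: computesI)
  then show ?case
    by (auto simp: body.simps intro!: computesI elim!: callsI)
qed (auto simp: body.simps intro!: computesI elim!: callsI)

lemma computes_mem:
  "computes Mem [x, enc_list ys] (bool_tree (x \<in> set ys)) ((length ys + 1) * (40 * nodes x + 30))"
proof (induction ys)
  case Nil show ?case by (auto simp: body.simps intro!: computesI)
next
  case (Cons y ys)
  from Cons show ?case
    by (auto simp: body.simps intro!: computesI callsI[OF computes_eq] elim!: callsI)
qed

section \<open>Binary numbers and variable operations\<close>

lemma bits_inj: "bits m = bits n \<Longrightarrow> m = n"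
proof (induction m arbitrary: n rule: bits.induct)
  case (1 m)
  show ?case
  proof (cases "m = 0 \<or> n = 0")
    case True
    then show ?thesis using "1.prems" by (auto simp: bits.simps[of m] bits.simps[of n] split: if_splits)
  next
    case False
    then have *: "odd m = odd n" "bits (m div 2) = bits (n div 2)"
      using "1.prems" by (auto simp: bits.simps[of m] bits.simps[of n])
    then have "m div 2 = n div 2" using "1.IH" False by blast
    with * show ?thesis
      by (metis bit_eq_rec even_iff_mod_2_eq_zero odd_iff_mod_2_eq_one div_mult_mod_eq)
  qed
qed

lemma enc_list_inj [simp]: "enc_list xs = enc_list ys \<longleftrightarrow> xs = ys"
proof (induction xs arbitrary: ys)
  case Nil then show ?case by (cases ys) auto
next
  case (Cons x xs) then show ?case by (cases ys) auto
qed

lemma bool_tree_inj [simp]: "bool_tree a = bool_tree b \<longleftrightarrow> a = b"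
  by (auto simp: bool_tree_def)

text \<open>Variables are compared through their numerals, so \<open>Eq\<close> decides their
  equality only because binary notation is unique.\<close>

lemma enc_nat_inj [simp]: "enc_nat m = enc_nat n \<longleftrightarrow> m = n"
proof
  assume "enc_nat m = enc_nat n"
  then have "bits m = bits n"
    by (auto simp: enc_nat_def inj_map_eq_map inj_def)
  then show "m = n" by (rule bits_inj)
qed simp

text \<open>Letters are dropped, as a status depends only on the next operation on the variable.
  Each label is the status just before its operation, so the first entry found for \<open>x\<close>
  already holds the status of \<open>x\<close>.\<close>

fun enc_ops :: "'a ref_word \<Rightarrow> 'a tree" where
  "enc_ops [] = Leaf"
| "enc_ops (Letter a # w) = enc_ops w"
| "enc_ops (Open x # w) = Cell (Cell stW (enc_nat x)) (enc_ops w)"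
| "enc_ops (Close x # w) = Cell (Cell stO (enc_nat x)) (enc_ops w)"

fun status :: "var \<Rightarrow> 'a ref_word \<Rightarrow> 'a tree" where
  "status x [] = Leaf"
| "status x (Letter a # w) = status x w"
| "status x (Open y # w) = (if x = y then stW else status x w)"
| "status x (Close y # w) = (if x = y then stO else status x w)"

lemma st_simps [simp]: "stW \<noteq> Leaf" "stO \<noteq> Leaf" "stW \<noteq> stO" "stO \<noteq> stW" "Leaf \<noteq> stO" "Leaf \<noteq> stW"
  "nodes stW = 3" "nodes stO = 5"
  by (auto simp: stW_def stO_def)

lemma nodes_status: "nodes (status x w) \<le> 5"
  by (induction x w rule: status.induct) auto

lemma nodes_eq_Suc: "\<exists>m. nodes t = Suc m"
  by (cases t) auto

lemma computes_find:
  fixes w :: "'a ref_word"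
  shows "computes Find [enc_nat x, enc_ops w] (status x w) (60 * nodes (enc_nat x :: 'a tree) * nodes (enc_ops w))"
proof -
  obtain m where m: "nodes (enc_nat x :: 'a tree) = Suc m"
    using nodes_eq_Suc by blast
  show ?thesis
  proof (induction w rule: enc_ops.induct)
    case 1 show ?case by (auto simp: body.simps m intro!: computesI)
  next
    case (2 a w) then show ?case by simp
  qed (auto simp: body.simps algebra_simps m intro!: computesI callsI[OF computes_eq] elim!: callsI)
qed

section \<open>The stack machine of a regex formula\<close>

text \<open>A stack stands for the concatenation of its items; \<open>Cl x\<close> is the pending end of a capture
  of \<open>x\<close>.\<close>

datatype 'a item = Rx "'a regex" | Cl var

fun enc_item :: "'a item \<Rightarrow> 'a tree" where
  "enc_item (Rx \<alpha>) = enc_regex \<alpha>"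
| "enc_item (Cl x) = enc_list [enc_nat 7, enc_nat x]"

definition enc_stack :: "'a item list \<Rightarrow> 'a tree" where
  "enc_stack K = enc_list (map enc_item K)"

lemma enc_stack_simps [simp]:
  "enc_stack [] = Leaf" "enc_stack (i # K) = Cell (enc_item i) (enc_stack K)"
  by (auto simp: enc_stack_def)

text \<open>In a functional formula, all ways to complete a partial match perform the same operations, so
  that the statuses can be read off a single witness. Parts with an empty language have to be
  avoided, as functionality says nothing about them.\<close>

fun wit :: "'a regex \<Rightarrow> 'a ref_word option" where
  "wit Empty = None"
| "wit Eps = Some []"
| "wit (Sym a) = Some [Letter a]"
| "wit (Or \<alpha> \<beta>) = (case wit \<alpha> of None \<Rightarrow> wit \<beta> | Some u \<Rightarrow> Some u)"
| "wit (Cat \<alpha> \<beta>) =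
    (case wit \<alpha> of None \<Rightarrow> None | Some u \<Rightarrow> (case wit \<beta> of None \<Rightarrow> None | Some w \<Rightarrow> Some (u @ w)))"
| "wit (Star \<alpha>) = Some []"
| "wit (Capture x \<alpha>) = (case wit \<alpha> of None \<Rightarrow> None | Some u \<Rightarrow> Some (Open x # u @ [Close x]))"

fun wit_item :: "'a item \<Rightarrow> 'a ref_word option" where
  "wit_item (Rx \<alpha>) = wit \<alpha>"
| "wit_item (Cl x) = Some [Close x]"

fun wits :: "'a item list \<Rightarrow> 'a ref_word option" where
  "wits [] = Some []"
| "wits (i # K) =
    (case wit_item i of None \<Rightarrow> None | Some u \<Rightarrow> (case wits K of None \<Rightarrow> None | Some w \<Rightarrow> Some (u @ w)))"

text \<open>The default concerns stacks with an empty language. No accepting state is reachable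
  through them, as an accepting walk spells a word of every stack.\<close>

definition ops_of :: "'a item list \<Rightarrow> 'a ref_word" where
  "ops_of K = (case wits K of None \<Rightarrow> [] | Some w \<Rightarrow> w)"

definition enc_wit :: "'a ref_word option \<Rightarrow> 'a ref_word \<Rightarrow> 'a tree" where
  "enc_wit u acc = (case u of None \<Rightarrow> Leaf | Some w \<Rightarrow> Cell Leaf (enc_ops (w @ acc)))"

lemma enc_wit_simps [simp]:
  "enc_wit None acc = Leaf" "enc_wit (Some w) acc = Cell Leaf (enc_ops (w @ acc))"
  by (auto simp: enc_wit_def)

lemma enc_ops_close: "Cell (Cell stO (enc_nat x)) (enc_ops acc) = enc_ops (Close x # acc)"
  by simp

text \<open>The accumulator holds the operations that come later, so \<open>Cat\<close> treats its
  right factor first and nothing is ever concatenated; this keeps the cost linear.\<close>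

lemma computes_wit_regex:
  "computes Wit [enc_regex \<alpha>, enc_ops acc] (enc_wit (wit \<alpha>) acc) (60 * nodes (enc_regex \<alpha>))"
proof (induction \<alpha> arbitrary: acc)
  case (Or \<alpha> \<beta>)
  show ?case
    by (cases "wit \<alpha>") (auto simp: body.simps dispatch_def intro!: computesI callsI[OF Or.IH(1)] callsI[OF Or.IH(2)])
next
  case (Cat \<alpha> \<beta>)
  show ?case
    by (cases "wit \<beta>"; cases "wit \<alpha>")
      (auto simp: body.simps dispatch_def intro!: computesI callsI[OF Cat.IH(1)] callsI[OF Cat.IH(2)])
next
  case (Capture x \<alpha>)
  show ?case
    by (cases "wit \<alpha>")
      (auto simp: body.simps dispatch_def enc_ops_close simp del: enc_ops.simps(4)
        intro!: computesI callsI[OF Capture.IH])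
qed (auto simp: body.simps dispatch_def intro!: computesI)

lemma computes_wit:
  "computes Wit [enc_item i, enc_ops acc] (enc_wit (wit_item i) acc) (60 * nodes (enc_item i))"
  by (cases i) (auto simp: body.simps dispatch_def intro!: computes_wit_regex computesI)

lemma computes_wits: "computes Wits [enc_stack K] (enc_wit (wits K) []) (80 * nodes (enc_stack K))"
proof (induction K)
  case (Cons i K)
  show ?case
    by (cases "wits K"; cases "wit_item i")
      (auto simp: body.simps intro!: computesI callsI[OF Cons.IH] callsI[OF computes_wit])
qed (auto simp: body.simps intro!: computesI)

lemma snd_enc_wit [simp]: "snd_tree (enc_wit (wits K) []) = enc_ops (ops_of K)"
  by (auto simp: ops_of_def split: option.splits)

lemma computes_leq:
  "computes Leq [enc_string u, enc_string w] (bool_tree (length u \<le> length w)) (20 * length w + 20)"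
proof (induction u arbitrary: w)
  case Nil then show ?case by (auto simp: enc_string_def body.simps intro!: computesI)
next
  case (Cons a u)
  show ?case
    by (cases w) (auto simp: enc_string_def body.simps
      intro!: computesI callsI[OF Cons.IH[unfolded enc_string_def]])
qed

lemma computes_leq_drop:
  "computes Leq [enc_string u, enc_string (drop k s)] (bool_tree (length u \<le> length s - k))
    (20 * length s + 20)"
  using computes_leq[of u "drop k s"] by (auto elim: computes_weaken)

text \<open>The status that the span \<open>[i, j\<rangle>\<close> prescribes at the boundary before the \<open>p\<close>-th letter.\<close>

fun span_status :: "nat \<Rightarrow> span \<Rightarrow> 'a tree" where
  "span_status p (i, j) = (if j \<le> p then Leaf else if i \<le> p then stO else stW)"

text \<open>Besides the numbers, the program keeps the suffixes of the input that start at the end points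
  of a span, because lengths of suffixes are easier to compare.\<close>

definition enc_pos :: "'a list \<Rightarrow> nat \<Rightarrow> 'a tree" where
  "enc_pos s i = Cell (enc_nat i) (enc_string (drop (i - 1) s))"

definition enc_asg :: "'a list \<Rightarrow> (var \<times> span) list \<Rightarrow> 'a tree" where
  "enc_asg s asg = enc_list (map (\<lambda>(x, i, j). Cell (enc_nat x) (Cell (enc_pos s i) (enc_pos s j))) asg)"

lemma enc_asg_simps [simp]:
  "enc_asg s [] = Leaf"
  "enc_asg s ((x, i, j) # asg) =
    Cell (Cell (enc_nat x) (Cell (enc_pos s i) (enc_pos s j))) (enc_asg s asg)"
  by (auto simp: enc_asg_def)

definition enc_opt :: "'a tree option \<Rightarrow> 'a tree" where
  "enc_opt c = (case c of None \<Rightarrow> Leaf | Some t \<Rightarrow> Cell Leaf t)"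

lemma enc_opt_simps [simp]: "enc_opt None = Leaf" "enc_opt (Some t) = Cell Leaf t" "enc_opt c = Leaf \<longleftrightarrow> c = None"
  by (auto simp: enc_opt_def split: option.splits)

definition asg_status :: "var \<Rightarrow> (var \<times> span) list \<Rightarrow> nat \<Rightarrow> 'a tree option" where
  "asg_status x asg p = map_option (span_status p) (map_of asg x)"

lemma computes_asgstat:
  assumes "length suf \<le> length s" "snd ` set asg \<subseteq> spans s"
  shows "computes AsgStat [enc_nat x, enc_asg s asg, enc_string suf]
    (enc_opt (asg_status x asg (length s + 1 - length suf)))
    ((length asg + 1) * (60 * nodes (enc_nat x :: 'a tree) + 100) + 40 * length (s :: 'a list))"
  using assms
proof (induction asg)
  case Nil then show ?case by (auto simp: body.simps asg_status_def intro!: computesI)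
next
  case (Cons b asg)
  obtain y i j where b: "b = (y, i, j)" by (cases b) auto
  then have ij: "1 \<le> i" "i \<le> j" "j \<le> length s + 1" using Cons.prems by (auto simp: spans_def)
  \<comment> \<open>The position of a suffix is \<open>length s + 1 - length suf\<close>, so having
    reached position \<open>k\<close> amounts to being at most as long as the suffix that starts at
    \<open>k\<close>.\<close>
  have *: "length suf \<le> Suc (length s) - k \<longleftrightarrow> k \<le> Suc (length s) - length suf" if "k \<le> length s + 1" for k
    using that Cons.prems(1) by auto
  show ?case
    using Cons.IH Cons.prems ij unfolding b
    by (auto simp: body.simps asg_status_def enc_pos_def * algebra_simps
      intro!: computesI callsI[OF computes_eq] callsI[OF computes_leq_drop] elim!: callsI)
qed

lemma computes_find_le:
  fixes w :: "'a ref_word"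
  assumes "nodes (enc_nat x :: 'a tree) \<le> B" "nodes (enc_ops w) \<le> B'"
  shows "computes Find [enc_nat x, enc_ops w] (status x w) (60 * (B * B'))"
  using mult_le_mono[OF assms] by (auto intro: computes_weaken[OF computes_find])

lemma nodes_enc_ops_append: "nodes (enc_ops (u @ w)) + 1 = nodes (enc_ops u) + nodes (enc_ops w)"
  by (induction u rule: enc_ops.induct) auto

text \<open>A witness enters each subformula at most once, because a star contributes the empty
  word; so it has at most two operations for each capture.\<close>

lemma nodes_wit: "wit \<alpha> = Some w \<Longrightarrow> nodes (enc_ops w) \<le> 10 * nodes (enc_regex \<alpha>)"
proof (induction \<alpha> arbitrary: w)
  case (Or \<alpha> \<beta>)
  show ?case
    using Or.IH Or.prems by (fastforce split: option.splits)
next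
  case (Cat \<alpha> \<beta>)
  then obtain u u' where "wit \<alpha> = Some u" "wit \<beta> = Some u'" "w = u @ u'"
    by (auto split: option.splits)
  then show ?case
    using Cat.IH(1)[of u] Cat.IH(2)[of u'] nodes_enc_ops_append[of u u'] by auto
next
  case (Capture x \<alpha>)
  then obtain u where "wit \<alpha> = Some u" "w = Open x # u @ [Close x]"
    by (auto split: option.splits)
  then show ?case
    using Capture.IH[of u] nodes_enc_ops_append[of u "[Close x]"] by auto
qed auto

lemma nodes_ops_of: "nodes (enc_ops (ops_of K)) \<le> 10 * nodes (enc_stack K)"
proof -
  have "nodes (enc_ops w) \<le> 10 * nodes (enc_stack K)" if "wits K = Some w" for w
    using that
  proof (induction K arbitrary: w)
    case (Cons i K)
    then obtain u u' where *: "wit_item i = Some u" "wits K = Some u'" "w = u @ u'"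
      by (auto split: option.splits)
    have "nodes (enc_ops u) \<le> 10 * nodes (enc_item i)"
      using *(1) nodes_wit by (cases i) auto
    then show ?case
      using Cons.IH[of u'] * nodes_enc_ops_append[of u u'] by auto
  qed auto
  then show ?thesis
    by (cases "wits K") (auto simp: ops_of_def)
qed

section \<open>Consistency of the statuses\<close>

text \<open>An entry \<open>(u, w)\<close> consists of a witness \<open>u\<close> of the atom, which tells the variables of the atom,
  and of a future \<open>w\<close>.\<close>

fun agree :: "var \<Rightarrow> ('a ref_word \<times> 'a ref_word) list \<Rightarrow> 'a tree option \<Rightarrow> bool" where
  "agree x [] c = True"
| "agree x ((u, w) # ws) c =
    (if status x u = Leaf then agree x ws c
     else (case c of None \<Rightarrow> agree x ws (Some (status x w)) | Some t \<Rightarrow> status x w = t \<and> agree x ws c))"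

text \<open>\<open>c\<close> is merely the candidate found so far for the common status. Without
  this bookkeeping the condition is symmetric in the atoms, as the correctness proof needs
  it.\<close>

lemma agree_iff:
  "agree x ws c \<longleftrightarrow>
    (\<exists>t. (\<forall>(u, w)\<in>set ws. status x u \<noteq> Leaf \<longrightarrow> status x w = t) \<and> (\<forall>t'. c = Some t' \<longrightarrow> t = t'))"
proof (induction x ws c rule: agree.induct)
  case (1 x c) show ?case by (cases c) auto
next
  case (2 x u w ws c)
  then show ?case by (cases c) auto
qed

fun op_vars :: "'a ref_word \<Rightarrow> var set" where
  "op_vars [] = {}"
| "op_vars (Letter a # w) = op_vars w"
| "op_vars (Open x # w) = insert x (op_vars w)"
| "op_vars (Close x # w) = insert x (op_vars w)"

definition consistent ::
    "'a ref_word \<Rightarrow> (var \<times> span) list \<Rightarrow> nat \<Rightarrow> ('a ref_word \<times> 'a ref_word) list \<Rightarrow> bool" where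
  "consistent ops asg p ws \<longleftrightarrow> (\<forall>x\<in>op_vars ops. agree x ws (asg_status x asg p))"

text \<open>Per atom: lookups for \<open>60 * (B * B)\<close> and
  \<open>60 * (B * (10 * B))\<close>, one witness for \<open>80 * B\<close>, and a comparison of two
  small trees within the constant.\<close>

definition agree_cost :: "nat \<Rightarrow> nat" where
  "agree_cost B = 700 * (B * B) + 80 * B + 1000"

lemma computes_agree:
  fixes Ks :: "'a item list list"
  assumes "nodes (enc_nat x :: 'a tree) \<le> B" "length us = length Ks"
    and "\<forall>u\<in>set us. nodes (enc_ops u) \<le> B" "\<forall>K\<in>set Ks. nodes (enc_stack K) \<le> B"
    and "\<And>t. c = Some t \<Longrightarrow> nodes t \<le> 5"
  shows "computes Agree [enc_nat x, enc_list (map enc_ops us), enc_list (map enc_stack Ks), enc_opt c]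
    (bool_tree (agree x (zip us (map ops_of Ks)) c)) ((length Ks + 1) * agree_cost B)"
  using assms(2-)
proof (induction us Ks arbitrary: c rule: list_induct2)
  case Nil then show ?case by (auto simp: body.simps agree_cost_def intro!: computesI)
next
  case (Cons u us K Ks)
  have u: "nodes (enc_ops u) \<le> B" and K: "nodes (enc_ops (ops_of K)) \<le> 10 * B"
    and KB: "nodes (enc_stack K) \<le> B"
    using Cons.prems nodes_ops_of[of K] by auto
  note find = computes_find_le[OF assms(1) u] computes_find_le[OF assms(1) K]
  note wits = computes_weaken[OF computes_wits, of K "80 * B"]
  have IH: "computes Agree [enc_nat x, enc_list (map enc_ops us), enc_list (map enc_stack Ks), t]
    (bool_tree (agree x (zip us (map ops_of Ks)) c)) ((length Ks + 1) * agree_cost B)"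
    if "t = enc_opt c" "\<And>t. c = Some t \<Longrightarrow> nodes t \<le> 5" for t c
    using Cons.IH[of c] Cons.prems that by auto
  have eq: "computes Eq [Cell Leaf (status x w), t] (bool_tree (Cell Leaf (status x w) = t)) 300" for w t
    using nodes_status[of x w] by (auto intro!: computes_weaken[OF computes_eq])
  note callsIs = callsI[OF find(1)] callsI[OF find(2)] callsI[OF wits] callsI[OF eq]
  show ?case
  proof (cases "status x u = Leaf")
    case True
    then show ?thesis
      using KB Cons.prems(3)
      by (auto simp: body.simps agree_cost_def[of B] algebra_simps
        intro!: computesI callsIs callsI[OF IH[OF refl]])
  next
    case False
    show ?thesis
    proof (cases c)
      case None
      with False show ?thesis
        using KB nodes_status[of x]
        by (auto simp: body.simps agree_cost_def[of B] algebra_simps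
          intro!: computesI callsIs callsI[OF IH[of _ "Some (status x (ops_of K))"]])
    next
      case (Some t)
      with False show ?thesis
        using KB Cons.prems(3)
        by (auto simp: body.simps agree_cost_def[of B] algebra_simps
          intro!: computesI callsIs callsI[OF IH[of _ "Some t"]])
    qed
  qed
qed


definition asg_cost :: "nat \<Rightarrow> nat" where
  "asg_cost B = (B + 1) * (60 * B + 100) + 40 * B"

definition ok_cost :: "nat \<Rightarrow> nat \<Rightarrow> nat" where
  "ok_cost n B = (n + 1) * agree_cost B + asg_cost B + 100"

lemma computes_asgstat_le:
  assumes "length suf \<le> length s" "snd ` set asg \<subseteq> spans s"
    and "nodes (enc_nat x :: 'a tree) \<le> B" "length asg \<le> B" "length s \<le> B"
  shows "computes AsgStat [enc_nat x, enc_asg s asg, enc_string (suf :: 'a list)]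
    (enc_opt (asg_status x asg (length s + 1 - length suf))) (asg_cost B)"
proof -
  have "(length asg + 1) * (60 * nodes (enc_nat x :: 'a tree) + 100) \<le> (B + 1) * (60 * B + 100)"
    using assms by (intro mult_le_mono) auto
  with assms(5) show ?thesis
    unfolding asg_cost_def by (intro computes_weaken[OF computes_asgstat[OF assms(1,2)]]) auto
qed

lemma nodes_asg_status: "asg_status x asg p = Some t \<Longrightarrow> nodes t \<le> 5"
  by (auto simp: asg_status_def)

lemma computes_ok:
  fixes Ks :: "'a item list list"
  assumes "length us = length Ks"
    and "\<forall>u\<in>set us. nodes (enc_ops u) \<le> B" "\<forall>K\<in>set Ks. nodes (enc_stack K) \<le> B"
    and asg: "length suf \<le> length s" "snd ` set asg \<subseteq> spans s" "length asg \<le> B" "length s \<le> B"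
    and "nodes (enc_ops ops) \<le> B"
  shows "computes Ok [enc_ops ops, enc_list (map enc_ops us), enc_list (map enc_stack Ks),
      enc_asg s asg, enc_string suf]
    (bool_tree (consistent ops asg (length s + 1 - length suf) (zip us (map ops_of Ks))))
    (nodes (enc_ops ops) * ok_cost (length Ks) B)"
  using assms(8)
proof (induction ops rule: enc_ops.induct)
  case 1 show ?case
    by (auto simp: body.simps consistent_def ok_cost_def intro!: computesI)
next
  case (2 a ops)
  then show ?case by (simp add: consistent_def)
next
  case (3 x ops)
  then have x: "nodes (enc_nat x :: 'a tree) \<le> B" by simp
  note agree = computes_agree[OF x assms(1-3), OF nodes_asg_status]
  note asgstat = computes_asgstat_le[OF asg(1,2) x asg(3,4)]
  show ?case
    using 3 by (auto simp: body.simps consistent_def ok_cost_def algebra_simps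
      intro!: computesI callsI[OF agree] callsI[OF asgstat] elim!: callsI)
next
  case (4 x ops)
  then have x: "nodes (enc_nat x :: 'a tree) \<le> B" by simp
  note agree = computes_agree[OF x assms(1-3), OF nodes_asg_status]
  note asgstat = computes_asgstat_le[OF asg(1,2) x asg(3,4)]
  show ?case
    using 4 by (auto simp: body.simps consistent_def ok_cost_def algebra_simps
      intro!: computesI callsI[OF agree] callsI[OF asgstat] elim!: callsI)
qed

section \<open>Successors of a joint state\<close>

fun istep :: "'a item list \<Rightarrow> 'a item list list" where
  "istep [] = []"
| "istep (Rx Empty # K) = []"
| "istep (Rx Eps # K) = [K]"
| "istep (Rx (Sym a) # K) = []"
| "istep (Rx (Or \<alpha> \<beta>) # K) = [Rx \<alpha> # K, Rx \<beta> # K]"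
| "istep (Rx (Cat \<alpha> \<beta>) # K) = [Rx \<alpha> # Rx \<beta> # K]"
| "istep (Rx (Star \<alpha>) # K) = [K, Rx \<alpha> # Rx (Star \<alpha>) # K]"
| "istep (Rx (Capture x \<alpha>) # K) = [Rx \<alpha> # Cl x # K]"
| "istep (Cl x # K) = [K]"

lemma computes_istep: "computes IStep [enc_stack K] (enc_list (map enc_stack (istep K))) 100"
  by (induction K rule: istep.induct) (auto simp: body.simps dispatch_def intro!: computesI)

lemma length_istep: "length (istep K) \<le> 2"
  by (induction K rule: istep.induct) auto

text \<open>Interleaving: one machine moves at a time, so a joint state has at most two silent
  successors per atom, whereas simultaneous moves would multiply.\<close>

fun isucc :: "'a item list list \<Rightarrow> 'a item list list list" where
  "isucc [] = []"
| "isucc (K # Ks) = map (\<lambda>K'. K' # Ks) (istep K) @ map (Cons K) (isucc Ks)"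

lemma length_isucc: "length (isucc Ks) \<le> 2 * length Ks"
proof (induction Ks)
  case (Cons K Ks)
  with length_istep[of K] show ?case by simp
qed simp

definition enc_stacks :: "'a item list list \<Rightarrow> 'a tree" where
  "enc_stacks Ks = enc_list (map enc_stack Ks)"

lemma enc_stacks_simps [simp]:
  "enc_stacks [] = Leaf" "enc_stacks (K # Ks) = Cell (enc_stack K) (enc_stacks Ks)"
  by (auto simp: enc_stacks_def)

lemma computes_isucc:
  "computes ISucc [enc_stacks Ks] (enc_list (map enc_stacks (isucc Ks))) (500 * ((length Ks + 1) * (length Ks + 1)))"
proof (induction Ks)
  case Nil show ?case by (auto simp: body.simps intro!: computesI)
next
  case (Cons K Ks)
  have 1: "computes ConsR [enc_list (map enc_stack (istep K)), enc_stacks Ks]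
    (enc_list (map (\<lambda>K'. enc_stacks (K' # Ks)) (istep K))) 50"
    using length_istep[of K] computes_consR[of "enc_list (map enc_stack (istep K))" "enc_stacks Ks"]
    by (auto simp: comp_def elim!: computes_weaken)
  have 2: "computes ConsL [enc_stack K, enc_list (map enc_stacks (isucc Ks))]
    (enc_list (map (\<lambda>Ks'. enc_stacks (K # Ks')) (isucc Ks))) (40 * length Ks + 10)"
    using length_isucc[of Ks] computes_consL[of "enc_stack K" "enc_list (map enc_stacks (isucc Ks))"]
    by (auto simp: comp_def elim!: computes_weaken)
  have 3: "computes App [enc_list (map (\<lambda>K'. enc_stacks (K' # Ks)) (istep K)), u]
    (append_tree (enc_list (map (\<lambda>K'. enc_stacks (K' # Ks)) (istep K))) u) 50" for u
    using length_istep[of K] by (intro computes_weaken[OF computes_app]) auto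
  show ?case
    by (rule computesI)
      (auto simp: body.simps comp_def algebra_simps
        intro!: callsI[OF computes_istep] callsI[OF Cons.IH] callsI[OF 1[simplified]]
          callsI[OF 2[simplified]] callsI[OF 3[simplified]])
qed

fun lstep :: "'a \<Rightarrow> 'a item list list \<Rightarrow> 'a item list list option" where
  "lstep a [] = Some []"
| "lstep a ((Rx (Sym b) # K) # Ks) = (if a = b then map_option (Cons K) (lstep a Ks) else None)"
| "lstep a (K # Ks) = None"

definition enc_opt_stacks :: "'a item list list option \<Rightarrow> 'a tree" where
  "enc_opt_stacks c = (case c of None \<Rightarrow> Leaf | Some Ks \<Rightarrow> Cell Leaf (enc_stacks Ks))"

lemma enc_opt_stacks_simps [simp]:
  "enc_opt_stacks None = Leaf" "enc_opt_stacks (Some Ks) = Cell Leaf (enc_stacks Ks)"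
  by (auto simp: enc_opt_stacks_def)

text \<open>\<open>LStep\<close> does not look at the tag of the topmost item. The component it
  compares is a letter only for \<open>Sym\<close>, and these facts exclude every other
  item.\<close>

lemma not_same_letter [simp]: "\<not> same_letter Leaf u" "\<not> same_letter (Cell t t') u"
  "\<not> same_letter (enc_nat x) u" "\<not> same_letter (enc_regex \<alpha>) u" "same_letter (Atom a) (Atom b) \<longleftrightarrow> a = b"
proof -
  show "\<not> same_letter (enc_nat x) u"
    by (cases "bits x") (auto simp: enc_nat_def same_letter_def)
  show "\<not> same_letter (enc_regex \<alpha>) u"
    by (cases \<alpha>) (auto simp: same_letter_def)
qed (auto simp: same_letter_def)

lemma computes_lstep:
  "computes LStep [enc_stacks Ks, Atom a] (enc_opt_stacks (lstep a Ks)) (60 * (length Ks + 1))"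
proof (induction a Ks rule: lstep.induct)
  case (2 a b K Ks)
  then show ?case
    by (cases "lstep a Ks") (auto simp: body.simps intro!: computesI elim!: callsI)
qed (auto simp: body.simps intro!: computesI)

lemma enc_stack_Leaf [simp]: "enc_stack K = Leaf \<longleftrightarrow> K = []"
  by (cases K) auto

lemma computes_allempty:
  "computes AllEmpty [enc_stacks Ks] (bool_tree (\<forall>K\<in>set Ks. K = [])) (20 * (length Ks + 1))"
  by (induction Ks) (auto simp: body.simps intro!: computesI elim!: callsI)

definition enc_state :: "'a list \<times> 'a item list list \<Rightarrow> 'a tree" where
  "enc_state = (\<lambda>(suf, Ks). Cell (enc_string suf) (enc_stacks Ks))"

lemma enc_state_simp [simp]: "enc_state (suf, Ks) = Cell (enc_string suf) (enc_stacks Ks)"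
  by (simp add: enc_state_def)

lemma enc_string_simps [simp]: "enc_string [] = Leaf" "enc_string (a # s) = Cell (Atom a) (enc_string s)"
  by (auto simp: enc_string_def)

text \<open>The parameter \<open>n\<close> is the length of the whole input string, so that \<open>n + 1 - length suf\<close> is
  the position of the state.\<close>

fun letter_succ :: "nat \<Rightarrow> 'a ref_word list \<Rightarrow> 'a ref_word \<Rightarrow> (var \<times> span) list \<Rightarrow>
    'a list \<times> 'a item list list \<Rightarrow> ('a list \<times> 'a item list list) list" where
  "letter_succ n us ops asg ([], Ks) = []"
| "letter_succ n us ops asg (a # suf, Ks) =
    (case lstep a Ks of
      None \<Rightarrow> []
    | Some Ks' \<Rightarrow>
        if consistent ops asg (n + 1 - length (a # suf)) (zip us (map ops_of Ks)) then [(suf, Ks')] else [])"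

definition succs :: "nat \<Rightarrow> 'a ref_word list \<Rightarrow> 'a ref_word \<Rightarrow> (var \<times> span) list \<Rightarrow>
    'a list \<times> 'a item list list \<Rightarrow> ('a list \<times> 'a item list list) list" where
  "succs n us ops asg q = map (Pair (fst q)) (isucc (snd q)) @ letter_succ n us ops asg q"

definition succ_cost :: "nat \<Rightarrow> nat \<Rightarrow> nat" where
  "succ_cost n B = 1000 * ((n + 1) * (n + 1)) + B * ok_cost n B + 200"

lemma computes_succ:
  fixes Ks :: "'a item list list"
  assumes len: "length us = length Ks"
    and us: "\<forall>u\<in>set us. nodes (enc_ops u) \<le> B" and Ks: "\<forall>K\<in>set Ks. nodes (enc_stack K) \<le> B"
    and asg: "length suf \<le> length s" "snd ` set asg \<subseteq> spans s" "length asg \<le> B" "length s \<le> B"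
    and ops: "nodes (enc_ops ops) \<le> B"
  shows "computes Succ [enc_state (suf, Ks), enc_list (map enc_ops us), enc_ops ops, enc_asg s asg]
    (enc_list (map enc_state (succs (length s) us ops asg (suf, Ks)))) (succ_cost (length Ks) B)"
proof -
  let ?n = "length Ks"
  have 1: "computes ConsL [enc_string suf, enc_list (map enc_stacks (isucc Ks))]
    (enc_list (map (\<lambda>Ks'. enc_state (suf, Ks')) (isucc Ks))) (40 * ?n + 10)"
    using length_isucc[of Ks] computes_consL[of "enc_string suf" "enc_list (map enc_stacks (isucc Ks))"]
    by (auto simp: comp_def elim!: computes_weaken)
  have 2: "computes App [enc_list (map (\<lambda>Ks'. enc_state (suf, Ks')) (isucc Ks)), u]
    (append_tree (enc_list (map (\<lambda>Ks'. enc_state (suf, Ks')) (isucc Ks))) u) (40 * ?n + 10)" for u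
    using length_isucc[of Ks] by (intro computes_weaken[OF computes_app]) auto
  have ok: "computes Ok [enc_ops ops, enc_list (map enc_ops us), enc_stacks Ks, enc_asg s asg, enc_string suf]
    (bool_tree (consistent ops asg (length s + 1 - length suf) (zip us (map ops_of Ks)))) (B * ok_cost ?n B)"
    unfolding enc_stacks_def
    by (intro computes_weaken[OF computes_ok[OF len us Ks asg ops]] mult_le_mono1 ops)
  have app: "append_tree (enc_list xs) Leaf = enc_list xs" "append_tree (enc_list xs) (Cell t Leaf) = enc_list (xs @ [t])"
    for xs and t :: "'a tree"
    using append_tree_enc_list[of xs "[]"] append_tree_enc_list[of xs "[t]"] by auto
  note callsIs = callsI[OF computes_isucc] callsI[OF 1[simplified]] callsI[OF 2[simplified]]
  show ?thesis
  proof (cases suf)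
    case Nil
    then show ?thesis
      by (intro computesI) (auto simp: body.simps succs_def succ_cost_def app comp_def algebra_simps Nil
        intro!: callsIs[unfolded Nil enc_string_simps])
  next
    case (Cons a suf')
    show ?thesis
      using ok
      by (cases "lstep a Ks"; intro computesI)
        (auto simp: body.simps succs_def succ_cost_def app comp_def algebra_simps Cons
          intro!: callsIs[unfolded Cons enc_string_simps] callsI[OF computes_lstep] elim!: callsI)
  qed
qed


section \<open>Initial data\<close>

lemma computes_als:
  "computes Als [enc_list (map enc_regex \<alpha>s)] (enc_list (map enc_ops (map (\<lambda>\<alpha>. ops_of [Rx \<alpha>]) \<alpha>s)))
    (80 * nodes (enc_list (map enc_regex \<alpha>s)))"
proof (induction \<alpha>s)
  case Nil show ?case by (auto simp: body.simps intro!: computesI)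
next
  case (Cons \<alpha> \<alpha>s)
  have wit: "computes Wit [enc_regex \<alpha>, Leaf] (enc_wit (wit \<alpha>) []) (60 * nodes (enc_regex \<alpha>))"
    using computes_wit_regex[of \<alpha> "[]"] by simp
  have snd: "snd_tree (enc_wit (wit \<alpha>) []) = enc_ops (ops_of [Rx \<alpha>])"
    by (cases "wit \<alpha>") (auto simp: ops_of_def)
  show ?case
    by (auto simp: body.simps snd intro!: computesI callsI[OF wit] callsI[OF Cons.IH])
qed

lemma length_bits: "length (bits n) \<le> n"
proof (induction n rule: bits.induct)
  case (1 n)
  show ?case
  proof (cases "n = 0")
    case True
    then show ?thesis by (simp add: bits.simps[of 0])
  next
    case False
    then show ?thesis using "1.IH" by (auto simp: bits.simps[of n])
  qed
qed

lemma computes_inc: "computes Inc [enc_nat n] (enc_nat (Suc n)) (20 * n + 30)"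
proof -
  have "computes Inc [enc_nat n] (enc_nat (Suc n)) (20 * length (bits n) + 20)"
  proof (induction n rule: bits.induct)
    case (1 n)
    show ?case
    proof (cases "n = 0")
      case True
      then show ?thesis by (auto simp: body.simps bool_tree_def intro!: computesI)
    next
      case False
      note IH = "1.IH"[OF False]
      have n: "bits n = odd n # bits (n div 2)" using False by (simp add: bits.simps[of n])
      have Sn: "bits (Suc n) = even n # bits (Suc n div 2)" by (simp add: bits.simps[of "Suc n"])
      show ?thesis
      proof (cases "even n")
        case True
        with n Sn show ?thesis by (auto simp: enc_nat_def body.simps intro!: computesI)
      next
        case odd: False
        have div: "Suc n div 2 = Suc (n div 2)" using odd by presburger
        have 1: "enc_nat n = Cell (bool_tree True) (enc_nat (n div 2))"
          "enc_nat (Suc n) = Cell Leaf (enc_nat (Suc (n div 2)))"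
          using n Sn odd unfolding enc_nat_def by (simp_all add: div)
        show ?thesis
          unfolding 1 using n by (auto simp: body.simps intro!: computesI callsI[OF IH])
      qed
    qed
  qed
  then show ?thesis using length_bits[of n] by (auto elim: computes_weaken)
qed

text \<open>Generalised over the prefix already passed, since an encoded position refers to a suffix
  of the whole string.\<close>

lemma computes_posl:
  assumes "length pre + length u \<le> n"
  shows "computes Posl [enc_string u, enc_nat (Suc (length pre))]
    (enc_list (map (enc_pos (pre @ u)) [Suc (length pre)..<length (pre @ u) + 2]))
    ((length u + 1) * (20 * n + 100))"
  using assms
proof (induction u arbitrary: pre)
  case Nil
  show ?case by (auto simp: body.simps enc_pos_def intro!: computesI)
next
  case (Cons a u)
  have IH: "computes Posl [enc_string u, enc_nat (Suc (Suc (length pre)))]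
    (enc_list (map (enc_pos (pre @ a # u)) [Suc (Suc (length pre))..<length pre + length u + 3]))
    ((length u + 1) * (20 * n + 100))"
    using Cons.IH[of "pre @ [a]"] Cons.prems by (simp add: numeral_3_eq_3)
  have inc: "computes Inc [enc_nat (Suc (length pre))] (enc_nat (Suc (Suc (length pre)))) (20 * n + 30)"
    using Cons.prems by (intro computes_weaken[OF computes_inc]) auto
  have upt: "[Suc (length pre)..<length pre + length u + 3] =
    Suc (length pre) # [Suc (Suc (length pre))..<length pre + length u + 3]"
    by (simp add: upt_conv_Cons)
  have pos: "enc_pos (pre @ a # u) (Suc (length pre)) = Cell (enc_nat (Suc (length pre))) (enc_string (a # u))"
    by (simp add: enc_pos_def)
  have "computes Posl [enc_string (a # u), enc_nat (Suc (length pre))]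
    (enc_list (map (enc_pos (pre @ a # u)) [Suc (length pre)..<length pre + length u + 3]))
    ((length u + 2) * (20 * n + 100))"
    unfolding upt list.map enc_list.simps pos
    by (auto simp: body.simps algebra_simps simp del: upt_Suc
      intro!: computesI callsI[OF inc] callsI[OF IH])
  then show ?case by (simp add: numeral_3_eq_3)
qed

fun span_list :: "nat list \<Rightarrow> span list" where
  "span_list [] = []"
| "span_list (i # is) = map (Pair i) (i # is) @ span_list is"

definition enc_span :: "'a list \<Rightarrow> span \<Rightarrow> 'a tree" where
  "enc_span s = (\<lambda>(i, j). Cell (enc_pos s i) (enc_pos s j))"

lemma enc_span_simp [simp]: "enc_span s (i, j) = Cell (enc_pos s i) (enc_pos s j)"
  by (simp add: enc_span_def)

lemma computes_spl:
  "computes Spl [enc_list (map (enc_pos s) is)] (enc_list (map (enc_span s) (span_list is)))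
    ((length is + 1) * (40 * length is + 100))"
proof (induction "is")
  case Nil show ?case by (auto simp: body.simps intro!: computesI)
next
  case (Cons i "is")
  have 1: "computes ConsL [enc_pos s i, enc_list (map (enc_pos s) (i # is))]
    (enc_list (map (\<lambda>j. enc_span s (i, j)) (i # is))) (20 * length is + 30)"
    using computes_consL[of "enc_pos s i" "enc_list (map (enc_pos s) (i # is))"]
    by (auto simp: comp_def elim!: computes_weaken)
  have 2: "computes App [enc_list (map (\<lambda>j. enc_span s (i, j)) (i # is)), u]
    (append_tree (enc_list (map (\<lambda>j. enc_span s (i, j)) (i # is))) u) (20 * length is + 30)" for u
    by (intro computes_weaken[OF computes_app]) auto
  show ?case
    by (rule computesI)
      (auto simp: body.simps comp_def algebra_simps
        intro!: callsI[OF Cons.IH] callsI[OF 1[simplified]] callsI[OF 2[simplified]])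
qed

lemma set_span_list: "sorted is \<Longrightarrow> set (span_list is) = {(i, j). i \<in> set is \<and> j \<in> set is \<and> i \<le> j}"
  if "distinct is"
  using that by (induction "is") (auto simp: less_le)

lemma distinct_span_list: "distinct is \<Longrightarrow> distinct (span_list is)"
proof (induction "is")
  case (Cons i "is")
  have "fst ` set (span_list is) \<subseteq> set is" by (induction "is") auto
  with Cons show ?case by (auto simp: distinct_map inj_on_def)
qed simp

lemma length_span_list: "length (span_list is) \<le> length is * length is"
  by (induction "is") auto

definition all_spans :: "nat \<Rightarrow> span list" where
  "all_spans n = span_list [1..<n + 2]"

lemma all_spans:
  "set (all_spans (length s)) = spans s" "distinct (all_spans n)" "length (all_spans n) \<le> (n + 1) * (n + 1)"
proof -
  show "set (all_spans (length s)) = spans s"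
    unfolding all_spans_def by (subst set_span_list) (auto simp: spans_def simp del: upt_Suc)
  show "distinct (all_spans n)"
    unfolding all_spans_def by (rule distinct_span_list) simp
  show "length (all_spans n) \<le> (n + 1) * (n + 1)"
    using length_span_list[of "[1..<n + 2]"] by (simp add: all_spans_def del: upt_Suc)
qed

section \<open>Reachability\<close>

lemma enc_regex_inj [simp]: "enc_regex \<alpha> = enc_regex \<beta> \<longleftrightarrow> \<alpha> = \<beta>"
proof (induction \<alpha> arbitrary: \<beta>)
  case Empty then show ?case by (cases \<beta>) auto
next
  case Eps then show ?case by (cases \<beta>) auto
next
  case (Sym a) then show ?case by (cases \<beta>) auto
next
  case (Or \<alpha>1 \<alpha>2) then show ?case by (cases \<beta>) auto
next
  case (Cat \<alpha>1 \<alpha>2) then show ?case by (cases \<beta>) auto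
next
  case (Star \<alpha>) then show ?case by (cases \<beta>) auto
next
  case (Capture x \<alpha>) then show ?case by (cases \<beta>) auto
qed

lemma enc_item_inj: "enc_item i = enc_item i' \<longleftrightarrow> i = i'"
proof -
  have "enc_regex \<alpha> \<noteq> enc_item (Cl x)" for \<alpha> :: "'a regex" and x
    by (cases \<alpha>) auto
  from this this[symmetric] show ?thesis by (cases i; cases i') auto
qed

text \<open>\<open>Mem\<close> recognises visited states by their encodings; without injectivity the
  search could discard a new state.\<close>

lemma enc_state_inj [simp]: "enc_state q = enc_state q' \<longleftrightarrow> q = q'"
proof -
  have inj: "inj (Atom :: 'a \<Rightarrow> 'a tree)" "inj (enc_item :: 'a item \<Rightarrow> 'a tree)" "inj (enc_stack :: 'a item list \<Rightarrow> 'a tree)"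
    by (auto simp: inj_def enc_stack_def enc_item_inj inj_map_eq_map)
  show ?thesis
    by (cases q; cases q') (auto simp: enc_string_def enc_stacks_def inj_map_eq_map[OF inj(1)] inj_map_eq_map[OF inj(3)])
qed

definition accepting :: "'a list \<times> 'a item list list \<Rightarrow> bool" where
  "accepting q \<longleftrightarrow> fst q = [] \<and> (\<forall>K\<in>set (snd q). K = [])"

lemma length_letter_succ: "length (letter_succ n us ops asg q) \<le> 1"
  by (induction n us ops asg q rule: letter_succ.induct) (auto split: option.splits)

lemma length_succs: "length (succs n us ops asg q) \<le> 2 * length (snd q) + 1"
  using length_isucc[of "snd q"] length_letter_succ[of n us ops asg q] by (simp add: succs_def)

definition reachable where
  "reachable n us ops asg q0 = {q. (q0, q) \<in> {(q, q'). q' \<in> set (succs n us ops asg q)}\<^sup>*}"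

text \<open>One membership test among \<open>c\<close> states of size \<open>M\<close>, one call of
  \<open>Succ\<close>, and, within the last two summands, the acceptance test and the
  concatenation.\<close>

definition iteration_cost :: "nat \<Rightarrow> nat \<Rightarrow> nat \<Rightarrow> nat \<Rightarrow> nat" where
  "iteration_cost k B M c = (c + 1) * (40 * M + 30) + succ_cost k B + 100 * (k + 1) + 100"

text \<open>\<open>R\<close> is a finite set closed under successors on which all sizes are bounded;
  its cardinality limits the number of expansions. Silent cycles, as caused by a star over a formula
  matching the empty word, end because visited states are not expanded again.\<close>

lemma computes_search:
  fixes s :: "'a list"
  assumes fin: "finite R"
    and closed: "\<And>q. q \<in> R \<Longrightarrow> set (succs (length s) us ops asg q) \<subseteq> R"
    and len: "\<And>q. q \<in> R \<Longrightarrow> length (snd q) = k" "\<And>q. q \<in> R \<Longrightarrow> length (fst q) \<le> length s"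
    and B: "\<And>q K. q \<in> R \<Longrightarrow> K \<in> set (snd q) \<Longrightarrow> nodes (enc_stack K) \<le> B"
    and M: "\<And>q. q \<in> R \<Longrightarrow> nodes (enc_state q) \<le> M"
    and us: "length us = k" "\<forall>u\<in>set us. nodes (enc_ops u) \<le> B"
    and asg: "snd ` set asg \<subseteq> spans s" "length asg \<le> B" "length s \<le> B"
    and ops: "nodes (enc_ops ops) \<le> B"
    and q0: "q0 \<in> R"
  shows "computes Search [Cell (enc_state q0) Leaf, Leaf,
      enc_list (map enc_ops us), enc_ops ops, enc_asg s asg]
    (bool_tree (\<exists>q\<in>reachable (length s) us ops asg q0. accepting q))
    ((2 + (2 * k + 1) * card R) * iteration_cost k B M (card R))"
proof -
  let ?S = "succs (length s) us ops asg" and ?X = "reachable (length s) us ops asg q0"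
  let ?D = "2 * k + 1" and ?C = "iteration_cost k B M (card R)"
  have X_step: "q' \<in> ?X" if "q \<in> ?X" "q' \<in> set (?S q)" for q q'
    using that unfolding reachable_def by (auto intro: rtrancl_into_rtrancl)
  \<comment> \<open>Termination measure: a popped state either was seen, and \<open>work\<close>
    shrinks, or joins \<open>seen\<close>, and one unit of \<open>card R - length seen\<close> pays
    for its at most \<open>2 * k + 1\<close> successors. The initial measure is
    \<open>1 + (2 * k + 1) * card R\<close>.\<close>
  have main: "computes Search [enc_list (map enc_state work), enc_list (map enc_state seen),
      enc_list (map enc_ops us), enc_ops ops, enc_asg s asg]
    (bool_tree (\<exists>q\<in>?X. accepting q)) (m * ?C)"
    if "length work + ?D * (card R - length seen) < m"
      and "set work \<subseteq> R" "set seen \<subseteq> R" "distinct seen" "set work \<subseteq> ?X" "q0 \<in> set work \<union> set seen"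
      and "\<forall>q\<in>set seen. \<not> accepting q \<and> set (?S q) \<subseteq> set work \<union> set seen"
    for m work seen
    using that
  proof (induction m arbitrary: work seen)
    case 0 then show ?case by simp
  next
    case (Suc m)
    show ?case
    proof (cases work)
      case Nil
      \<comment> \<open>With \<open>work\<close> empty, the invariant says that \<open>seen\<close>
        contains the start and is closed under successors.\<close>
      have "q \<in> set seen" if "q \<in> ?X" for q
        using that unfolding reachable_def mem_Collect_eq
        by (induction rule: rtrancl_induct) (use Suc.prems Nil in auto)
      then have "\<not> (\<exists>q\<in>?X. accepting q)" using Suc.prems by blast
      then show ?thesis
        using Nil by (auto simp: body.simps iteration_cost_def intro!: computesI)
    next
      case (Cons q ws)
      have q: "q \<in> R" "q \<in> ?X" using Suc.prems Cons by auto
      obtain suf Ks where qs: "q = (suf, Ks)" by (cases q)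
      have card: "length seen \<le> card R"
        using Suc.prems(3,4) fin by (metis card_mono distinct_card)
      have nq: "nodes (enc_state q) \<le> M" using M q by auto
      have "(length seen + 1) * (40 * nodes (enc_state q) + 30) \<le> (card R + 1) * (40 * M + 30)"
        using card nq by (intro mult_le_mono) auto
      then have mem: "computes Mem [enc_state q, enc_list (map enc_state seen)]
        (bool_tree (q \<in> set seen)) ((card R + 1) * (40 * M + 30))"
        using computes_mem[of "enc_state q" "map enc_state seen"]
        by (auto simp: image_iff elim: computes_weaken)
      show ?thesis
      proof (cases "q \<in> set seen")
        case True
        have IH: "computes Search [enc_list (map enc_state ws), enc_list (map enc_state seen),
            enc_list (map enc_ops us), enc_ops ops, enc_asg s asg]
          (bool_tree (\<exists>q\<in>?X. accepting q)) (m * ?C)"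
          by (rule Suc.IH) (use Suc.prems Cons True in auto)
        show ?thesis
          unfolding Cons using True
          by (auto simp: body.simps iteration_cost_def intro!: computesI callsI[OF mem]
            callsI[OF IH[unfolded iteration_cost_def]])
      next
        case new: False
        have acc: "computes AllEmpty [enc_stacks Ks] (bool_tree (\<forall>K\<in>set Ks. K = [])) (20 * (k + 1))"
          using computes_allempty[of Ks] len(1)[OF q(1)] qs by simp
        note callsIs = callsI[OF mem[unfolded qs enc_state_simp]] callsI[OF acc]
        show ?thesis
        proof (cases "accepting q")
          case True
          then have res: "(\<exists>q\<in>?X. accepting q) = True" using q by blast
          have suf: "suf = []" and emp: "(\<forall>K\<in>set Ks. K = []) = True"
            using True qs by (auto simp: accepting_def)
          show ?thesis
            using new unfolding Cons qs res
            by (auto simp: body.simps iteration_cost_def suf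
                intro!: computesI callsIs[unfolded suf emp enc_string_simps])
        next
          case False
          have succ: "computes Succ [enc_state q, enc_list (map enc_ops us), enc_ops ops, enc_asg s asg]
            (enc_list (map enc_state (?S q))) (succ_cost k B)"
            using computes_succ[of us Ks B suf s asg ops] us asg ops len[OF q(1)] B[OF q(1)] qs by auto
          have lenS: "length (?S q) \<le> 2 * k + 1"
            using length_succs[of "length s" us ops asg q] len(1)[OF q(1)] by simp
          have app: "computes App [enc_list (map enc_state (?S q)), enc_list (map enc_state ws)]
            (enc_list (map enc_state (?S q @ ws))) (40 * k + 30)"
            using computes_app[of "enc_list (map enc_state (?S q))" "enc_list (map enc_state ws)"] lenS
            by (auto elim: computes_weaken)
          have "length seen < card R"
            using Suc.prems(3,4) fin q(1) new
            by (metis card_mono card_seteq distinct_card leI)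
          then have D: "?D + ?D * (card R - Suc (length seen)) = ?D * (card R - length seen)"
            by (metis Suc_diff_Suc mult_Suc_right)
          have IH: "computes Search [enc_list (map enc_state (?S q @ ws)), enc_list (map enc_state (q # seen)),
              enc_list (map enc_ops us), enc_ops ops, enc_asg s asg]
            (bool_tree (\<exists>q\<in>?X. accepting q)) (m * ?C)"
          proof (rule Suc.IH)
            have "length (?S q @ ws) + ?D * (card R - length (q # seen)) \<le> 
               length ws + (?D + ?D * (card R - Suc (length seen)))"
              using lenS by simp
            also have "\<dots> < m" unfolding D using Suc.prems(1) Cons by simp
            finally show "length (?S q @ ws) + ?D * (card R - length (q # seen)) < m" .
            show "set (?S q @ ws) \<subseteq> R" using closed[OF q(1)] Suc.prems Cons by auto
            show "set (?S q @ ws) \<subseteq> ?X" using X_step[OF q(2)] Suc.prems Cons by auto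
          qed (use Suc.prems Cons new False q in auto)
          note callsIs = callsIs callsI[OF succ[unfolded qs enc_state_simp]] callsI[OF app[unfolded qs]]
            callsI[OF IH[unfolded iteration_cost_def qs list.map enc_list.simps enc_state_simp]]
          show ?thesis
          proof (cases suf)
            case Nil
            then have emp: "(\<forall>K\<in>set Ks. K = []) = False"
              using False qs by (auto simp: accepting_def)
            show ?thesis
              using new unfolding Cons qs Nil
              by (rule_tac computesI, simp add: body.simps iteration_cost_def)
                (auto intro!: callsIs[unfolded Nil emp enc_string_simps])
          next
            case (Cons a suf')
            show ?thesis
              using new unfolding \<open>work = q # ws\<close> qs Cons
              by (rule_tac computesI, simp add: body.simps iteration_cost_def)
                (auto intro!: callsIs[unfolded Cons enc_string_simps])
          qed
        qed
      qed
    qed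
  qed
  have "computes Search [enc_list (map enc_state [q0]), enc_list (map enc_state []),
      enc_list (map enc_ops us), enc_ops ops, enc_asg s asg]
    (bool_tree (\<exists>q\<in>?X. accepting q)) ((2 + ?D * card R) * ?C)"
    by (rule main) (use q0 in \<open>auto simp: reachable_def\<close>)
  then show ?thesis by simp
qed

section \<open>Ref-words, walks of the machines and extendability\<close>

section \<open>The language of a stack\<close>

fun item_lang :: "'a item \<Rightarrow> 'a ref_word set" where
  "item_lang (Rx \<alpha>) = ref_lang \<alpha>"
| "item_lang (Cl x) = {[Close x]}"

fun stack_lang :: "'a item list \<Rightarrow> 'a ref_word set" where
  "stack_lang [] = {[]}"
| "stack_lang (i # K) = {u @ w | u w. u \<in> item_lang i \<and> w \<in> stack_lang K}"

lemma wit_correct: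
  "case wit \<alpha> of None \<Rightarrow> ref_lang \<alpha> = {} | Some w \<Rightarrow> w \<in> ref_lang \<alpha>"
proof (induction \<alpha>)
  case (Star \<alpha>)
  show ?case by (auto intro: exI[of _ "[]"])
qed (auto split: option.splits)

lemma wits_correct:
  "case wits K of None \<Rightarrow> stack_lang K = {} | Some w \<Rightarrow> w \<in> stack_lang K"
proof (induction K)
  case (Cons i K)
  have "case wit_item i of None \<Rightarrow> item_lang i = {} | Some w \<Rightarrow> w \<in> item_lang i"
  proof (cases i)
    case (Rx \<alpha>)
    with wit_correct[of \<alpha>] show ?thesis by (auto split: option.splits)
  qed simp
  with Cons show ?case by (auto split: option.splits)
qed auto

lemma ops_of_in_stack_lang: "r \<in> stack_lang K \<Longrightarrow> ops_of K \<in> stack_lang K"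
  using wits_correct[of K] by (auto simp: ops_of_def split: option.splits)

definition silent :: "'a ref_word \<Rightarrow> bool" where
  "silent l \<longleftrightarrow> (\<forall>a. Letter a \<notin> set l)"

lemma silent_Nil [simp]: "silent []"
  by (simp add: silent_def)

lemma silent_append [simp]: "silent (l @ l') \<longleftrightarrow> silent l \<and> silent l'"
  by (auto simp: silent_def)

lemma silent_op [simp]: "silent (Open x # l) \<longleftrightarrow> silent l" "silent (Close x # l) \<longleftrightarrow> silent l"
  "\<not> silent (Letter a # l)"
  by (auto simp: silent_def)

lemma clr_append [simp]: "clr (u @ w) = clr u @ clr w"
  by (induction u rule: clr.induct) auto

lemma clr_silent [simp]: "silent l \<Longrightarrow> clr l = []"
  by (induction l rule: clr.induct) auto

text \<open>The same silent prefix serves all words of \<open>K'\<close>. This uniformity is what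
  lets a common past of \<open>K\<close> be prolonged to a common past of \<open>K'\<close>.\<close>

definition weak_step :: "'a item list \<Rightarrow> 'a item list \<Rightarrow> bool" where
  "weak_step K K' \<longleftrightarrow> (\<exists>l. silent l \<and> (\<forall>r\<in>stack_lang K'. l @ r \<in> stack_lang K))"

lemma weak_step_refl: "weak_step K K"
  unfolding weak_step_def by (intro exI[of _ "[]"]) auto

lemma stack_lang_star:
  assumes "r \<in> stack_lang K \<or> r \<in> stack_lang (Rx \<alpha> # Rx (Star \<alpha>) # K)"
  shows "r \<in> stack_lang (Rx (Star \<alpha>) # K)"
proof -
  have "\<exists>u w. r = u @ w \<and> u \<in> ref_lang (Star \<alpha>) \<and> w \<in> stack_lang K"
    using assms
  proof
    assume "r \<in> stack_lang K"
    moreover have "[] \<in> ref_lang (Star \<alpha>)" by (auto intro: exI[of _ "[]"])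
    ultimately show ?thesis by (metis append_Nil)
  next
    assume "r \<in> stack_lang (Rx \<alpha> # Rx (Star \<alpha>) # K)"
    then obtain u ws w where *: "u \<in> ref_lang \<alpha>" "set ws \<subseteq> ref_lang \<alpha>" "w \<in> stack_lang K"
      "r = concat (u # ws) @ w" by auto
    then have "concat (u # ws) \<in> ref_lang (Star \<alpha>)" by (auto intro!: exI[of _ "u # ws"])
    with *(3,4) show ?thesis by blast
  qed
  then show ?thesis by (simp only: stack_lang.simps item_lang.simps mem_Collect_eq)
qed

lemma stack_lang_or:
  "r \<in> stack_lang (Rx \<alpha> # K) \<or> r \<in> stack_lang (Rx \<beta> # K) \<Longrightarrow> r \<in> stack_lang (Rx (Or \<alpha> \<beta>) # K)"
  unfolding stack_lang.simps item_lang.simps ref_lang.simps by blast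

lemma stack_lang_cat:
  assumes "r \<in> stack_lang (Rx \<alpha> # Rx \<beta> # K)"
  shows "r \<in> stack_lang (Rx (Cat \<alpha> \<beta>) # K)"
proof -
  obtain u w t where "r = (u @ w) @ t" "u \<in> ref_lang \<alpha>" "w \<in> ref_lang \<beta>" "t \<in> stack_lang K"
    using assms by auto
  then show ?thesis unfolding stack_lang.simps item_lang.simps ref_lang.simps by blast
qed

lemma stack_lang_capture:
  assumes "r \<in> stack_lang (Rx \<alpha> # Cl x # K)"
  shows "Open x # r \<in> stack_lang (Rx (Capture x \<alpha>) # K)"
proof -
  obtain u t where "Open x # r = (Open x # u @ [Close x]) @ t" "u \<in> ref_lang \<alpha>" "t \<in> stack_lang K"
    using assms by auto
  then show ?thesis unfolding stack_lang.simps item_lang.simps ref_lang.simps by blast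
qed

lemma weak_stepI: "silent l \<Longrightarrow> (\<And>r. r \<in> stack_lang K' \<Longrightarrow> l @ r \<in> stack_lang K) \<Longrightarrow> weak_step K K'"
  by (auto simp: weak_step_def)

lemma weak_step_istep: "K' \<in> set (istep K) \<Longrightarrow> weak_step K K'"
proof (induction K rule: istep.induct)
  case (3 K)
  then show ?case by (intro weak_stepI[of "[]"]) auto
next
  case (5 \<alpha> \<beta> K)
  then show ?case by (intro weak_stepI[of "[]"]) (auto intro!: stack_lang_or simp del: stack_lang.simps)
next
  case (6 \<alpha> \<beta> K)
  then show ?case by (intro weak_stepI[of "[]"]) (auto intro!: stack_lang_cat simp del: stack_lang.simps)
next
  case (7 \<alpha> K)
  then show ?case by (intro weak_stepI[of "[]"]) (auto intro!: stack_lang_star simp del: stack_lang.simps)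
next
  case (8 x \<alpha> K)
  then show ?case
    by (intro weak_stepI[of "[Open x]"]) (auto intro!: stack_lang_capture simp del: stack_lang.simps)
next
  case (9 x K)
  then show ?case by (intro weak_stepI[of "[Close x]"]) auto
qed auto

text \<open>What functionality of a formula means in the middle of a match: \<open>u\<close> is a
  past of the stack that every completion turns into a valid word. Different walks may supply
  different pasts; one suffices.\<close>

definition functional_stack :: "var set \<Rightarrow> 'a item list \<Rightarrow> bool" where
  "functional_stack V K \<longleftrightarrow> (\<exists>u. \<forall>r\<in>stack_lang K. valid V (u @ r))"

lemma functional_stack_weak_step:
  assumes "functional_stack V K" "weak_step K K'"
  shows "functional_stack V K'"
proof -
  obtain u l where "\<forall>r\<in>stack_lang K. valid V (u @ r)" "\<forall>r\<in>stack_lang K'. l @ r \<in> stack_lang K"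
    using assms by (auto simp: functional_stack_def weak_step_def)
  then show ?thesis
    unfolding functional_stack_def by (intro exI[of _ "u @ l"]) auto
qed

lemma functional_stack_letter:
  assumes "functional_stack V (Rx (Sym a) # K)"
  shows "functional_stack V K"
proof -
  obtain u where "\<forall>r\<in>stack_lang (Rx (Sym a) # K). valid V (u @ r)"
    using assms by (auto simp: functional_stack_def)
  then show ?thesis
    unfolding functional_stack_def by (intro exI[of _ "u @ [Letter a]"]) auto
qed

section \<open>Statuses in valid words\<close>

lemma status_append: "status x (u @ w) = (if status x u = Leaf then status x w else status x u)"
  by (induction x u rule: status.induct) auto

lemma status_eq_Leaf_iff: "status x w = Leaf \<longleftrightarrow> Open x \<notin> set w \<and> Close x \<notin> set w"
  by (induction x w rule: status.induct) auto

lemma valid_decomp: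
  assumes "valid V r" "x \<in> V"
  obtains p m t where "r = p @ Open x # m @ Close x # t"
    "status x p = Leaf" "status x m = Leaf" "status x t = Leaf"
proof -
  obtain p m t where r: "r = p @ Open x # m @ Close x # t"
    using assms by (auto simp: valid_def)
  have "count_list r (Open x) = 1" "count_list r (Close x) = 1"
    using assms by (auto simp: valid_def)
  with r have "status x p = Leaf" "status x m = Leaf" "status x t = Leaf"
    by (auto simp: status_eq_Leaf_iff count_list_0_iff)
  with r that show ?thesis by blast
qed

lemma status_outside: "valid V r \<Longrightarrow> x \<notin> V \<Longrightarrow> status x r = Leaf"
  by (auto simp: valid_def status_eq_Leaf_iff)

lemma status_valid: "valid V r \<Longrightarrow> status x r = Leaf \<longleftrightarrow> x \<notin> V"
  by (metis status_outside valid_decomp status_eq_Leaf_iff in_set_conv_decomp)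

text \<open>Each operation occurs exactly once in a valid word, so the operations on
  \<open>x\<close> still to come are those not yet performed in \<open>u\<close>. The cases say
  whether \<open>u\<close> stops before, inside or behind the part captured by
  \<open>x\<close>.\<close>

lemma status_suffix:
  assumes "valid V (u @ r)"
  shows "status x r =
    (if x \<notin> V then Leaf else if Open x \<notin> set u then stW else if Close x \<notin> set u then stO else Leaf)"
proof (cases "x \<in> V")
  case False
  then show ?thesis
    using status_outside[OF assms False] by (auto simp: status_append split: if_splits)
next
  case True
  obtain p m t where *: "u @ r = p @ Open x # m @ Close x # t"
    "status x p = Leaf" "status x m = Leaf" "status x t = Leaf"
    using valid_decomp[OF assms True] .
  from *(1) consider
      (1) p' where "p = u @ p'" "r = p' @ Open x # m @ Close x # t"
    | (2) m' m'' where "u = p @ Open x # m'" "m = m' @ m''" "r = m'' @ Close x # t"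
    | (3) t' where "u = p @ Open x # m @ Close x # t'" "t = t' @ r"
    by (auto simp: append_eq_append_conv2 append_eq_Cons_conv)
  then show ?thesis
  proof cases
    case 1
    with *(2-) True show ?thesis by (auto simp: status_append status_eq_Leaf_iff split: if_splits)
  next
    case 2
    with *(2-) True show ?thesis by (auto simp: status_append status_eq_Leaf_iff split: if_splits)
  next
    case 3
    with *(2-) True show ?thesis by (auto simp: status_append status_eq_Leaf_iff split: if_splits)
  qed
qed

text \<open>By \<open>status_suffix\<close> the status depends on the past alone, and one past fits
  all completions. Hence a witness can speak for the word that the walk will eventually
  spell.\<close>

lemma status_functional_stack:
  assumes "functional_stack V K" "r \<in> stack_lang K" "r' \<in> stack_lang K"
  shows "status x r = status x r'"
proof -
  obtain u where "\<forall>r\<in>stack_lang K. valid V (u @ r)"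
    using assms(1) by (auto simp: functional_stack_def)
  then show ?thesis
    using assms(2,3) status_suffix[of V u r x] status_suffix[of V u r' x] by simp
qed

text \<open>The suffix of a ref-word that starts with the \<open>m\<close>-th letter from the right.\<close>

fun letter_suffix :: "nat \<Rightarrow> 'a ref_word \<Rightarrow> 'a ref_word" where
  "letter_suffix m [] = []"
| "letter_suffix m (Letter a # r) = (if m = Suc (length (clr r)) then Letter a # r else letter_suffix m r)"
| "letter_suffix m (Open x # r) = letter_suffix m r"
| "letter_suffix m (Close x # r) = letter_suffix m r"

lemma letter_suffix_silent [simp]: "silent l \<Longrightarrow> letter_suffix m (l @ r) = letter_suffix m r"
  by (induction m l rule: letter_suffix.induct) auto

lemma letter_suffix_append_right:
  "m \<le> length (clr w) \<Longrightarrow> letter_suffix m (u @ w) = letter_suffix m w"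
  by (induction u rule: clr.induct) auto

lemma letter_suffix_append_left:
  "length (clr w) < m \<Longrightarrow> m \<le> length (clr (u @ w)) \<Longrightarrow>
    letter_suffix m (u @ w) = letter_suffix (m - length (clr w)) u @ w"
  by (induction u rule: clr.induct) auto

lemma status_letter_suffix: "status x w = Leaf \<Longrightarrow> status x (letter_suffix m w) = Leaf"
  by (induction m w rule: letter_suffix.induct) (auto split: if_splits)

lemma span_of_decomp:
  assumes "r = p @ Open x # m @ Close x # t" "status x p = Leaf" "status x m = Leaf"
  shows "span_of r x = (length (clr p) + 1, length (clr p) + 1 + length (clr m))"
proof -
  have "takeWhile (\<lambda>c. c \<noteq> Open x) r = p" "dropWhile (\<lambda>c. c \<noteq> Open x) r = Open x # m @ Close x # t"
    "takeWhile (\<lambda>c. c \<noteq> Close x) (m @ Close x # t) = m"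
    using assms(2,3) unfolding assms(1) status_eq_Leaf_iff
    by (subst takeWhile_append2 dropWhile_append2; auto)+
  then have "before_open x r = p" "captured x r = m"
    by (simp_all add: before_open_def captured_def)
  then show ?thesis by (simp add: span_of_def)
qed

text \<open>A suffix starting with a letter has all operations at its boundary behind it, so their
  order is invisible and only the span remains. The letter lies behind, inside or before the
  captured part.\<close>

lemma status_boundary:
  assumes "valid V r" "x \<in> V" "1 \<le> n" "n \<le> length (clr r)"
  shows "status x (letter_suffix n r) = span_status (length (clr r) + 1 - n) (span_of r x)"
proof -
  obtain p m t where r: "r = p @ Open x # m @ Close x # t"
    and st: "status x p = Leaf" "status x m = Leaf" "status x t = Leaf"
    using valid_decomp[OF assms(1,2)] .
  note span = span_of_decomp[OF r st(1,2)]
  consider "n \<le> length (clr t)" | "length (clr t) < n" "n \<le> length (clr m) + length (clr t)"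
    | "length (clr m) + length (clr t) < n" by linarith
  then show ?thesis
  proof cases
    case 1
    have "letter_suffix n r = letter_suffix n t"
      using letter_suffix_append_right[of n t "p @ Open x # m @ [Close x]"] 1 r by simp
    with 1 st show ?thesis by (auto simp: span[unfolded r] status_letter_suffix r)
  next
    case 2
    have "letter_suffix n r = letter_suffix n (m @ Close x # t)"
      using letter_suffix_append_right[of n "m @ Close x # t" "p @ [Open x]"] 2 r by simp
    also have "\<dots> = letter_suffix (n - length (clr t)) m @ Close x # t"
      using letter_suffix_append_left[of "Close x # t" n m] 2 by simp
    finally show ?thesis
      using 2 st by (auto simp: span[unfolded r] status_letter_suffix status_append r)
  next
    case 3
    have "letter_suffix n r = letter_suffix (n - length (clr (m @ t))) p @ Open x # m @ Close x # t"
      using letter_suffix_append_left[of "Open x # m @ Close x # t" n p] 3 r assms(4) by simp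
    then show ?thesis
      using 3 st assms(4) by (auto simp: span[unfolded r] status_letter_suffix status_append r)
  qed
qed

lemma span_of_in_spans:
  assumes "valid V r" "x \<in> V"
  shows "span_of r x \<in> spans (clr r)"
proof -
  obtain p m t where r: "r = p @ Open x # m @ Close x # t"
    and st: "status x p = Leaf" "status x m = Leaf" "status x t = Leaf"
    using valid_decomp[OF assms(1,2)] .
  show ?thesis using span_of_decomp[OF r st(1,2)] r by (auto simp: spans_def)
qed

text \<open>If two starts or two ends differ, the smaller one is at most \<open>length s\<close>,
  and at that position exactly one of the spans has begun, or ended. So the boundaries before
  letters suffice, although spans may end at \<open>length s + 1\<close>.\<close>

lemma span_eqI:
  assumes "sp \<in> spans s" "sp' \<in> spans s"
    and eq: "\<And>p. 1 \<le> p \<Longrightarrow> p \<le> length s \<Longrightarrow> (span_status p sp :: 'a tree) = span_status p sp'"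
  shows "sp = sp'"
proof -
  obtain i j i' j' where sp: "sp = (i, j)" "sp' = (i', j')" by (cases sp; cases sp')
  have *: "1 \<le> i" "i \<le> j" "j \<le> length s + 1" "1 \<le> i'" "i' \<le> j'" "j' \<le> length s + 1"
    using assms(1,2) sp by (auto simp: spans_def)
  have "\<not> i < i'" using eq[of i] sp * by (auto split: if_splits)
  moreover have "\<not> i' < i" using eq[of i'] sp * by (auto split: if_splits)
  moreover have "\<not> j < j'" using eq[of j] sp * by (auto split: if_splits)
  moreover have "\<not> j' < j" using eq[of j'] sp * by (auto split: if_splits)
  ultimately show ?thesis using sp by auto
qed

section \<open>Soundness of reachability\<close>

definition state_step where
  "state_step n us ops asg = {(q, q'). q' \<in> set (succs n us ops asg q)}"

lemma weak_step_isucc: "Ks' \<in> set (isucc Ks) \<Longrightarrow> list_all2 weak_step Ks Ks'"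
proof (induction Ks arbitrary: Ks')
  case (Cons K Ks)
  then show ?case
    using weak_step_istep weak_step_refl by (fastforce intro: list_all2_refl)
qed simp

lemma weak_step_words:
  assumes "list_all2 weak_step Ks Ks'" "list_all2 (\<lambda>K r. r \<in> stack_lang K) Ks' rs'"
  shows "\<exists>rs. list_all2 (\<lambda>K r. r \<in> stack_lang K) Ks rs \<and> map clr rs = map clr rs' \<and>
    (\<forall>m. map (letter_suffix m) rs = map (letter_suffix m) rs')"
  using assms
proof (induction arbitrary: rs' rule: list_all2_induct)
  case (Cons K Ks K' Ks')
  then obtain r' rs'' where rs': "rs' = r' # rs''" "r' \<in> stack_lang K'"
    "list_all2 (\<lambda>K r. r \<in> stack_lang K) Ks' rs''" by (auto simp: list_all2_Cons1)
  from Cons.IH[OF rs'(3)] obtain rs where rs: "list_all2 (\<lambda>K r. r \<in> stack_lang K) Ks rs"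
    "map clr rs = map clr rs''" "\<forall>m. map (letter_suffix m) rs = map (letter_suffix m) rs''" by blast
  from Cons.hyps rs' obtain l where "silent l" "l @ r' \<in> stack_lang K"
    by (auto simp: weak_step_def)
  with rs rs' show ?case by (intro exI[of _ "(l @ r') # rs"]) auto
qed simp

lemma functional_stacks_weak_step:
  assumes "list_all2 weak_step Ks Ks'" "list_all2 functional_stack Vs Ks"
  shows "list_all2 functional_stack Vs Ks'"
  using assms
  by (induction arbitrary: Vs rule: list_all2_induct)
    (auto simp: list_all2_Cons2 intro: functional_stack_weak_step)

lemma lstep_eq_Some_iff: "lstep a Ks = Some Ks' \<longleftrightarrow> Ks = map (Cons (Rx (Sym a))) Ks'"
proof (induction a Ks arbitrary: Ks' rule: lstep.induct)
  case (2 a b K Ks)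
  then show ?case by (cases Ks') auto
qed auto

lemma agree_cong:
  assumes "list_all2 (\<lambda>w w'. \<forall>x. status x w = status x w') ws ws'"
  shows "agree x (zip us ws) c \<longleftrightarrow> agree x (zip us ws') c"
  using assms
proof (induction us arbitrary: ws ws' c)
  case (Cons u us)
  then show ?case
    by (cases ws; cases ws') (auto split: option.splits)
qed simp

text \<open>Futures matter only through their statuses, which permits trading the witnesses used by
  the program for the actual words.\<close>

lemma consistent_cong:
  assumes "list_all2 (\<lambda>w w'. \<forall>x. status x w = status x w') ws ws'"
  shows "consistent ops asg p (zip us ws) \<longleftrightarrow> consistent ops asg p (zip us ws')"
  using agree_cong[OF assms] by (simp add: consistent_def)

lemma status_ops_of:
  assumes "list_all2 functional_stack Vs Ks" "list_all2 (\<lambda>K r. r \<in> stack_lang K) Ks rs"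
  shows "list_all2 (\<lambda>w w'. \<forall>x. status x w = status x w') (map ops_of Ks) rs"
  using assms
proof (induction arbitrary: rs rule: list_all2_induct)
  case (Cons V Vs K Ks)
  then show ?case
    by (auto simp: list_all2_Cons1 intro: status_functional_stack ops_of_in_stack_lang)
qed simp

text \<open>Induction backwards from the accepting state, because words grow to the left: a silent
  move prepends operations, a letter move its letter. Functionality is meanwhile handed forward, to
  the state for which the induction hypothesis is used.\<close>

lemma reach_sound:
  assumes "(q, qf) \<in> (state_step n us ops asg)\<^sup>*" "accepting qf" "list_all2 functional_stack Vs (snd q)"
  shows "\<exists>rs. list_all2 (\<lambda>K r. r \<in> stack_lang K) (snd q) rs \<and> (\<forall>r\<in>set rs. clr r = fst q) \<and>
    (\<forall>m. 1 \<le> m \<longrightarrow> m \<le> length (fst q) \<longrightarrow>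
      consistent ops asg (n + 1 - m) (zip us (map (letter_suffix m) rs)))"
  using assms(1,3)
proof (induction rule: converse_rtrancl_induct)
  case base
  have "list_all2 (\<lambda>K r. r \<in> stack_lang K) (snd qf) (map (\<lambda>_. []) (snd qf))"
    using assms(2) by (auto simp: accepting_def list.rel_map intro!: list.rel_refl_strong)
  then show ?case
    using assms(2) by (intro exI[of _ "map (\<lambda>_. []) (snd qf)"]) (auto simp: accepting_def)
next
  case (step q q')
  obtain suf Ks where q: "q = (suf, Ks)" by (cases q)
  from step.hyps(1) consider
      (silent) Ks' where "q' = (suf, Ks')" "Ks' \<in> set (isucc Ks)"
    | (letter) "q' \<in> set (letter_succ n us ops asg q)"
    by (auto simp: state_step_def succs_def q)
  then show ?case
  proof cases
    case silent
    note weak = weak_step_isucc[OF silent(2)]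
    have "list_all2 functional_stack Vs (snd q')"
      using functional_stacks_weak_step[OF weak] step.prems q silent by simp
    from step.IH[OF this] obtain rs' where rs': "list_all2 (\<lambda>K r. r \<in> stack_lang K) Ks' rs'"
      "\<forall>r\<in>set rs'. clr r = suf"
      "\<forall>m. 1 \<le> m \<longrightarrow> m \<le> length suf \<longrightarrow> consistent ops asg (n + 1 - m) (zip us (map (letter_suffix m) rs'))"
      using silent by auto
    from weak_step_words[OF weak rs'(1)] obtain rs where rs: "list_all2 (\<lambda>K r. r \<in> stack_lang K) Ks rs"
      "map clr rs = map clr rs'" "\<forall>m. map (letter_suffix m) rs = map (letter_suffix m) rs'" by blast
    have "clr ` set rs = clr ` set rs'" using rs(2) by (metis list.set_map)
    then have "\<forall>r\<in>set rs. clr r = suf" using rs'(2) by fastforce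
    with rs rs'(3) q show ?thesis by (intro exI[of _ rs]) auto
  next
    case letter
    then obtain a suf' where suf: "suf = a # suf'" by (cases suf) (auto simp: q)
    with letter obtain Ks' where "lstep a Ks = Some Ks'"
      and con: "consistent ops asg (n + 1 - length suf) (zip us (map ops_of Ks))" and q': "q' = (suf', Ks')"
      by (cases "lstep a Ks") (auto simp: q split: if_splits)
    then have Ks: "Ks = map (Cons (Rx (Sym a))) Ks'" by (simp add: lstep_eq_Some_iff)
    have fK: "list_all2 functional_stack Vs Ks" using step.prems q by simp
    then have "list_all2 functional_stack Vs (snd q')"
      unfolding Ks q' by (auto simp: list.rel_map intro: functional_stack_letter elim!: list.rel_mono_strong)
    from step.IH[OF this] obtain rs' where rs': "list_all2 (\<lambda>K r. r \<in> stack_lang K) Ks' rs'"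
      "\<forall>r\<in>set rs'. clr r = suf'"
      "\<forall>m. 1 \<le> m \<longrightarrow> m \<le> length suf' \<longrightarrow> consistent ops asg (n + 1 - m) (zip us (map (letter_suffix m) rs'))"
      using q' by auto
    let ?rs = "map (Cons (Letter a)) rs'"
    have lang: "list_all2 (\<lambda>K r. r \<in> stack_lang K) Ks ?rs"
      unfolding Ks using rs'(1) by (auto simp: list.rel_map)
    \<comment> \<open>The program made its check on witnesses; by functionality the words have the
      same statuses.\<close>
    have con': "consistent ops asg (n + 1 - length suf) (zip us ?rs)"
      using con consistent_cong[OF status_ops_of[OF fK lang]] by blast
    \<comment> \<open>A word that begins with a letter is its own suffix at its full letter
      count.\<close>
    have top: "map (letter_suffix (length suf)) ?rs = ?rs"
      using rs'(2) suf by auto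
    have below: "map (letter_suffix m) ?rs = map (letter_suffix m) rs'" if "m \<le> length suf'" for m
      using rs'(2) that by auto
    have "consistent ops asg (n + 1 - m) (zip us (map (letter_suffix m) ?rs))"
      if "1 \<le> m" "m \<le> length suf" for m
    proof (cases "m = length suf")
      case True
      show ?thesis unfolding True top by (rule con')
    next
      case False
      with that have "m \<le> length suf'" using suf by simp
      then show ?thesis unfolding below[OF \<open>m \<le> length suf'\<close>] using rs'(3) that by blast
    qed
    with lang rs'(2) show ?thesis unfolding q suf by (intro exI[of _ ?rs]) auto
  qed
qed

section \<open>Completeness of reachability\<close>

text \<open>Membership in a stack language does not say by which moves a word arises; a run records
  them, so that the joint machine can replay them. The inclusion premise of
  \<open>runs_silent\<close> is that of \<open>weak_step\<close> for the given prefix and keeps the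
  word inside the language.\<close>

inductive runs :: "'a item list \<Rightarrow> 'a ref_word \<Rightarrow> bool" where
  runs_Nil: "runs [] []"
| runs_Sym: "runs K r \<Longrightarrow> runs (Rx (Sym a) # K) (Letter a # r)"
| runs_silent: "K' \<in> set (istep K) \<Longrightarrow> silent l \<Longrightarrow> (\<And>r. r \<in> stack_lang K' \<Longrightarrow> l @ r \<in> stack_lang K) \<Longrightarrow>
    runs K' r \<Longrightarrow> runs K (l @ r)"

lemma runs_in_stack_lang: "runs K r \<Longrightarrow> r \<in> stack_lang K"
  by (induction rule: runs.induct) auto

text \<open>The continuation is arbitrary, so that \<open>Cat\<close> can run its left factor on top
  of the right one, and \<open>Star\<close> can be unrolled factor by factor, each on top of the
  star itself.\<close>

lemma runs_append:
  "r \<in> ref_lang \<alpha> \<Longrightarrow> runs K r' \<Longrightarrow> runs (Rx \<alpha> # K) (r @ r')"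
proof (induction \<alpha> arbitrary: r r' K)
  case Eps
  then show ?case using runs_silent[of K "Rx Eps # K" "[]" r'] by auto
next
  case (Sym a)
  then show ?case by (auto intro: runs_Sym)
next
  case (Or \<alpha> \<beta>)
  have "runs (Rx (Or \<alpha> \<beta>) # K) ([] @ t)"
    if "runs (Rx \<alpha> # K) t \<or> runs (Rx \<beta> # K) t" for t
    using that
  proof
    assume *: "runs (Rx \<alpha> # K) t"
    show ?thesis by (rule runs_silent[OF _ _ _ *]) (auto intro: stack_lang_or simp del: stack_lang.simps)
  next
    assume *: "runs (Rx \<beta> # K) t"
    show ?thesis by (rule runs_silent[OF _ _ _ *]) (auto intro: stack_lang_or simp del: stack_lang.simps)
  qed
  then show ?case using Or by fastforce
next
  case (Cat \<alpha> \<beta>)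
  then obtain u w where r: "r = u @ w" "u \<in> ref_lang \<alpha>" "w \<in> ref_lang \<beta>" by auto
  have "runs (Rx \<alpha> # Rx \<beta> # K) (u @ w @ r')"
    using Cat.IH r Cat.prems by blast
  then have "runs (Rx (Cat \<alpha> \<beta>) # K) ([] @ u @ w @ r')"
    by (rule runs_silent[rotated 3]) (auto intro: stack_lang_cat simp del: stack_lang.simps)
  then show ?case using r(1) by simp
next
  case (Star \<alpha>)
  then obtain ws where ws: "r = concat ws" "set ws \<subseteq> ref_lang \<alpha>" by auto
  have star: "runs (Rx (Star \<alpha>) # K) ([] @ t)"
    if "runs K t \<or> runs (Rx \<alpha> # Rx (Star \<alpha>) # K) t" for t
    using that
  proof
    assume *: "runs K t"
    show ?thesis by (rule runs_silent[OF _ _ _ *]) (auto intro: stack_lang_star simp del: stack_lang.simps)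
  next
    assume *: "runs (Rx \<alpha> # Rx (Star \<alpha>) # K) t"
    show ?thesis by (rule runs_silent[OF _ _ _ *]) (auto intro: stack_lang_star simp del: stack_lang.simps)
  qed
  from ws(2) have "runs (Rx (Star \<alpha>) # K) (concat ws @ r')"
  proof (induction ws)
    case Nil
    from star Star.prems(2) show ?case by simp
  next
    case (Cons w ws)
    then have "runs (Rx \<alpha> # Rx (Star \<alpha>) # K) (w @ concat ws @ r')"
      using Star.IH by simp
    with star show ?case by fastforce
  qed
  then show ?case using ws by simp
next
  case (Capture x \<alpha>)
  then obtain u where r: "r = Open x # u @ [Close x]" "u \<in> ref_lang \<alpha>" by auto
  have "runs (Cl x # K) ([Close x] @ r')"
    by (rule runs_silent[OF _ _ _ Capture.prems(2)]) auto
  then have "runs (Rx \<alpha> # Cl x # K) (u @ [Close x] @ r')"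
    using Capture.IH r by blast
  then have "runs (Rx (Capture x \<alpha>) # K) ([Open x] @ u @ [Close x] @ r')"
    by (rule runs_silent[rotated 3]) (auto intro: stack_lang_capture simp del: stack_lang.simps)
  then show ?case using r(1) by simp
qed simp

abbreviation "isteps \<equiv> {(K, K'). K' \<in> set (istep K)}\<^sup>*"

lemma runs_until_letter:
  "runs K r \<Longrightarrow> (clr r = [] \<longrightarrow> (K, []) \<in> isteps) \<and>
    (\<forall>a t. clr r = a # t \<longrightarrow> (\<exists>K' r' l. (K, Rx (Sym a) # K') \<in> isteps \<and> runs K' r' \<and> silent l \<and>
      r = l @ Letter a # r'))"
proof (induction rule: runs.induct)
  case (runs_Sym K r a)
  then show ?case
    by (intro conjI allI impI exI[of _ K] exI[of _ r] exI[of _ "[]"]) auto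
next
  case (runs_silent K' K l r)
  show ?case
  proof (intro conjI allI impI)
    assume "clr (l @ r) = []"
    with runs_silent show "(K, []) \<in> isteps" by (auto intro: converse_rtrancl_into_rtrancl)
  next
    fix a t assume "clr (l @ r) = a # t"
    with runs_silent obtain K'' r' l' where *: "(K', Rx (Sym a) # K'') \<in> isteps" "runs K'' r'"
      "silent l'" "r = l' @ Letter a # r'" by auto
    with runs_silent show "\<exists>K' r' l'. (K, Rx (Sym a) # K') \<in> isteps \<and> runs K' r' \<and> silent l' \<and>
      l @ r = l' @ Letter a # r'"
      by (intro exI[of _ K''] exI[of _ r'] exI[of _ "l @ l'"]) (auto intro: converse_rtrancl_into_rtrancl)
  qed
qed auto

text \<open>The machines may move one after the other, since silent moves are subject to no
  check.\<close>

lemma isucc_lift: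
  assumes "list_all2 (\<lambda>K K'. (K, K') \<in> isteps) Ks Ks'"
  shows "(Ks, Ks') \<in> {(Ks, Ks'). Ks' \<in> set (isucc Ks)}\<^sup>*"
  using assms
proof (induction rule: list_all2_induct)
  case (Cons K Ks K' Ks')
  let ?R = "{(Ks, Ks'). Ks' \<in> set (isucc Ks)}"
  from Cons.hyps have "(K # Ks, K' # Ks) \<in> ?R\<^sup>*"
    by (induction rule: rtrancl_induct) (auto intro: rtrancl_into_rtrancl)
  moreover from Cons.IH have "(K' # Ks, K' # Ks') \<in> ?R\<^sup>*"
    by (induction rule: rtrancl_induct) (auto intro: rtrancl_into_rtrancl)
  ultimately show ?case by (rule rtrancl_trans)
qed simp

lemma state_step_lift:
  assumes "list_all2 (\<lambda>K K'. (K, K') \<in> isteps) Ks Ks'"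
  shows "((suf, Ks), (suf, Ks')) \<in> (state_step n us ops asg)\<^sup>*"
  using isucc_lift[OF assms]
  by (induction rule: rtrancl_induct) (auto simp: state_step_def succs_def intro: rtrancl_into_rtrancl)

lemma runs_until_letter_list:
  assumes "list_all2 runs Ks rs" "\<forall>r\<in>set rs. clr r = a # t"
  shows "\<exists>Ks' rs'. list_all2 (\<lambda>K K'. (K, K') \<in> isteps) Ks (map (Cons (Rx (Sym a))) Ks') \<and>
    list_all2 runs Ks' rs' \<and> (\<forall>r\<in>set rs'. clr r = t) \<and>
    (\<forall>m. map (letter_suffix m) rs = map (letter_suffix m) (map (Cons (Letter a)) rs'))"
  using assms
proof (induction rule: list_all2_induct)
  case (Cons K Ks r rs)
  then obtain Ks' rs' where *: "list_all2 (\<lambda>K K'. (K, K') \<in> isteps) Ks (map (Cons (Rx (Sym a))) Ks')"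
    "list_all2 runs Ks' rs'" "\<forall>r\<in>set rs'. clr r = t"
    "\<forall>m. map (letter_suffix m) rs = map (letter_suffix m) (map (Cons (Letter a)) rs')" by auto
  from runs_until_letter[OF Cons.hyps(1)] Cons.prems obtain K' r' l where
    **: "(K, Rx (Sym a) # K') \<in> isteps" "runs K' r'" "silent l" "r = l @ Letter a # r'" by auto
  then have "clr r' = t" using Cons.prems by simp
  with * ** show ?case by (intro exI[of _ "K' # Ks'"] exI[of _ "r' # rs'"]) auto
qed auto

lemma functional_stacks_isteps:
  assumes "list_all2 (\<lambda>K K'. (K, K') \<in> isteps) Ks Ks'" "list_all2 functional_stack Vs Ks"
  shows "list_all2 functional_stack Vs Ks'"
proof -
  have "functional_stack V K'" if "(K, K') \<in> isteps" "functional_stack V K" for V and K K' :: "'a item list"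
    using that by (induction rule: rtrancl_induct) (auto intro: functional_stack_weak_step weak_step_istep)
  with assms show ?thesis
    by (induction arbitrary: Vs rule: list_all2_induct) (auto simp: list_all2_Cons2)
qed

text \<open>Induction on the remaining string: all machines advance silently to the next letter,
  pass the check there and read it together.\<close>

lemma reach_complete:
  assumes "list_all2 runs Ks rs" "\<forall>r\<in>set rs. clr r = suf" "list_all2 functional_stack Vs Ks"
    and "\<forall>m. 1 \<le> m \<longrightarrow> m \<le> length suf \<longrightarrow> consistent ops asg (n + 1 - m) (zip us (map (letter_suffix m) rs))"
  shows "\<exists>qf. accepting qf \<and> ((suf, Ks), qf) \<in> (state_step n us ops asg)\<^sup>*"
  using assms
proof (induction suf arbitrary: Ks rs)
  case Nil
  have "list_all2 (\<lambda>K K'. (K, K') \<in> isteps) Ks (map (\<lambda>_. []) Ks)"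
    using Nil(1,2) runs_until_letter by (induction rule: list_all2_induct) auto
  from state_step_lift[OF this] show ?case
    by (intro exI[of _ "([], map (\<lambda>_. []) Ks)"]) (auto simp: accepting_def)
next
  case (Cons a suf)
  from runs_until_letter_list[OF Cons.prems(1,2)] obtain Ks' rs' where
    steps: "list_all2 (\<lambda>K K'. (K, K') \<in> isteps) Ks (map (Cons (Rx (Sym a))) Ks')"
    and rs': "list_all2 runs Ks' rs'" "\<forall>r\<in>set rs'. clr r = suf"
    "\<And>m. map (letter_suffix m) rs = map (letter_suffix m) (map (Cons (Letter a)) rs')" by blast
  let ?Ks = "map (Cons (Rx (Sym a))) Ks'" and ?rs = "map (Cons (Letter a)) rs'"
  have fK: "list_all2 functional_stack Vs ?Ks"
    by (rule functional_stacks_isteps[OF steps Cons.prems(3)])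
  then have fK': "list_all2 functional_stack Vs Ks'"
    by (auto simp: list.rel_map intro: functional_stack_letter elim!: list.rel_mono_strong)
  have lang: "list_all2 (\<lambda>K r. r \<in> stack_lang K) ?Ks ?rs"
    using rs'(1) by (auto simp: list.rel_map dest: runs_in_stack_lang elim!: list.rel_mono_strong)
  have "map (letter_suffix (length (a # suf))) rs = ?rs"
    using rs'(2,3) by auto
  then have "consistent ops asg (n + 1 - length (a # suf)) (zip us ?rs)"
    using Cons.prems(4)[rule_format, of "length (a # suf)"] by simp
  then have "consistent ops asg (n + 1 - length (a # suf)) (zip us (map ops_of ?Ks))"
    using consistent_cong[OF status_ops_of[OF fK lang]] by blast
  then have letter: "((a # suf, ?Ks), (suf, Ks')) \<in> state_step n us ops asg"
    using lstep_eq_Some_iff[of a ?Ks Ks'] by (auto simp: state_step_def succs_def)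
  have "\<exists>qf. accepting qf \<and> ((suf, Ks'), qf) \<in> (state_step n us ops asg)\<^sup>*"
  proof (rule Cons.IH[OF rs'(1,2) fK'], intro allI impI)
    fix m assume m: "1 \<le> m" "m \<le> length suf"
    then have "map (letter_suffix m) rs = map (letter_suffix m) rs'"
      using rs'(2,3) by auto
    with m Cons.prems(4)[rule_format, of m]
    show "consistent ops asg (n + 1 - m) (zip us (map (letter_suffix m) rs'))" by simp
  qed
  with letter state_step_lift[OF steps] show ?case
    by (meson converse_rtrancl_into_rtrancl rtrancl_trans)
qed


section \<open>Extendable partial assignments\<close>

definition init_state :: "'a list \<Rightarrow> 'a regex list \<Rightarrow> 'a list \<times> 'a item list list" where
  "init_state s \<alpha>s = (s, map (\<lambda>\<alpha>. [Rx \<alpha>]) \<alpha>s)"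

definition extendable :: "'a regex_cq \<Rightarrow> 'a list \<Rightarrow> (var \<times> span) list \<Rightarrow> bool" where
  "extendable q s asg \<longleftrightarrow> (\<exists>\<mu>. is_tuple (cq_vars q) s \<mu> \<and>
     (\<forall>\<alpha>\<in>set (atoms q). \<mu> |` vars \<alpha> \<in> regex_sem \<alpha> s) \<and> map_of asg \<subseteq>\<^sub>m \<mu>)"

lemma ops_of_atom:
  assumes "functional \<alpha>" "r \<in> ref_lang \<alpha>"
  shows "ops_of [Rx \<alpha>] \<in> ref_lang \<alpha>" "status x (ops_of [Rx \<alpha>]) = Leaf \<longleftrightarrow> x \<notin> vars \<alpha>"
proof -
  show lang: "ops_of [Rx \<alpha>] \<in> ref_lang \<alpha>"
    using ops_of_in_stack_lang[of r "[Rx \<alpha>]"] assms(2) by simp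
  then show "status x (ops_of [Rx \<alpha>]) = Leaf \<longleftrightarrow> x \<notin> vars \<alpha>"
    using assms(1) by (auto simp: functional_def status_valid)
qed

lemma op_vars_eq: "op_vars w = {x. status x w \<noteq> Leaf}"
  by (induction w rule: op_vars.induct) auto

text \<open>The atoms are regarded as one stack merely to collect the variables of the query. The
  concatenated witnesses form no valid word if atoms share variables, but a nonblank status still
  signals occurrence.\<close>

lemma status_ops_of_atoms:
  assumes "\<forall>\<alpha>\<in>set \<alpha>s. functional \<alpha> \<and> ref_lang \<alpha> \<noteq> {}"
  shows "status x (ops_of (map Rx \<alpha>s)) \<noteq> Leaf \<longleftrightarrow> (\<exists>\<alpha>\<in>set \<alpha>s. x \<in> vars \<alpha>)"
proof -
  have "\<exists>w. wits (map Rx \<alpha>s) = Some w \<and> (status x w \<noteq> Leaf \<longleftrightarrow> (\<exists>\<alpha>\<in>set \<alpha>s. x \<in> vars \<alpha>))"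
    using assms
  proof (induction \<alpha>s)
    case (Cons \<alpha> \<alpha>s)
    then obtain w where w: "wits (map Rx \<alpha>s) = Some w"
      "status x w \<noteq> Leaf \<longleftrightarrow> (\<exists>\<alpha>\<in>set \<alpha>s. x \<in> vars \<alpha>)" by auto
    obtain u where u: "wit \<alpha> = Some u" "u \<in> ref_lang \<alpha>"
      using wit_correct[of \<alpha>] Cons.prems by (auto split: option.splits)
    then have "status x u = Leaf \<longleftrightarrow> x \<notin> vars \<alpha>"
      using Cons.prems by (auto simp: functional_def status_valid)
    with w u show ?case by (auto simp: status_append)
  qed simp
  then show ?thesis by (auto simp: ops_of_def)
qed

text \<open>Soundness assembles a tuple from the words of the walk: \<open>span_eqI\<close> turns
  agreement of statuses at all boundaries into equality of spans, among the atoms and with the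
  assignment. For completeness each atom gets a ref-word of the tuple, and the tuple itself supplies
  the common status.\<close>

lemma extendable_iff_reachable:
  fixes s :: "'a list"
  assumes q: "is_regex_cq q"
    and asg: "snd ` set asg \<subseteq> spans s" "fst ` set asg \<subseteq> cq_vars q"
  defines "\<alpha>s \<equiv> atoms q"
  shows "(\<exists>c\<in>reachable (length s) (map (\<lambda>\<alpha>. ops_of [Rx \<alpha>]) \<alpha>s) (ops_of (map Rx \<alpha>s)) asg (init_state s \<alpha>s).
      accepting c) \<longleftrightarrow> extendable q s asg"
proof -
  let ?us = "map (\<lambda>\<alpha>. ops_of [Rx \<alpha>]) \<alpha>s" and ?ops = "ops_of (map Rx \<alpha>s)"
  let ?R = "state_step (length s) ?us ?ops asg"
  have func: "functional \<alpha>" if "\<alpha> \<in> set \<alpha>s" for \<alpha>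
    using q that by (auto simp: is_regex_cq_def \<alpha>s_def)
  have V: "cq_vars q = (\<Union>\<alpha>\<in>set \<alpha>s. vars \<alpha>)" by (simp add: cq_vars_def \<alpha>s_def)
  have reach: "reachable (length s) ?us ?ops asg (init_state s \<alpha>s) = {c. (init_state s \<alpha>s, c) \<in> ?R\<^sup>*}"
    by (simp add: reachable_def state_step_def)
  have fstack: "list_all2 functional_stack (map vars \<alpha>s) (map (\<lambda>\<alpha>. [Rx \<alpha>]) \<alpha>s)"
    using func by (auto simp: list.rel_map functional_stack_def functional_def intro!: list.rel_refl_strong
        exI[of _ "[]"])
  have zip: "zip ?us (map (letter_suffix m) rs) = map (\<lambda>(\<alpha>, r). (ops_of [Rx \<alpha>], letter_suffix m r)) (zip \<alpha>s rs)"
    for m rs by (simp add: zip_map_map)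
  show ?thesis
  proof
    assume "\<exists>c\<in>reachable (length s) ?us ?ops asg (init_state s \<alpha>s). accepting c"
    then obtain c where "(init_state s \<alpha>s, c) \<in> ?R\<^sup>*" "accepting c" using reach by auto
    from reach_sound[OF this, of "map vars \<alpha>s"] fstack obtain rs where
      rs: "list_all2 (\<lambda>K r. r \<in> stack_lang K) (map (\<lambda>\<alpha>. [Rx \<alpha>]) \<alpha>s) rs" "\<forall>r\<in>set rs. clr r = s"
      and con: "\<And>m. 1 \<le> m \<Longrightarrow> m \<le> length s \<Longrightarrow>
        consistent ?ops asg (length s + 1 - m) (zip ?us (map (letter_suffix m) rs))"
      by (auto simp: init_state_def)
    have len: "length rs = length \<alpha>s" using rs(1) by (auto dest: list_all2_lengthD)
    have lang: "r \<in> ref_lang \<alpha>" "valid (vars \<alpha>) r" "clr r = s" if "(\<alpha>, r) \<in> set (zip \<alpha>s rs)" for \<alpha> r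
    proof -
      have "list_all2 (\<lambda>\<alpha> r. r \<in> ref_lang \<alpha>) \<alpha>s rs" using rs(1) by (simp add: list_all2_map1)
      with that show "r \<in> ref_lang \<alpha>" by (auto simp: list_all2_iff)
      then show "valid (vars \<alpha>) r" using func[of \<alpha>] that by (auto simp: functional_def dest: set_zip_leftD)
      show "clr r = s" using rs(2) that by (auto dest: set_zip_rightD)
    qed
    have ex: "\<exists>r. (\<alpha>, r) \<in> set (zip \<alpha>s rs)" if "\<alpha> \<in> set \<alpha>s" for \<alpha>
      using that len by (metis in_set_impl_in_set_zip1)
    have agree: "\<exists>t. (\<forall>(\<alpha>, r)\<in>set (zip \<alpha>s rs). x \<in> vars \<alpha> \<longrightarrow> span_status p (span_of r x) = (t :: 'a tree)) \<and>
        (\<forall>sp. map_of asg x = Some sp \<longrightarrow> span_status p sp = t)"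
      if "x \<in> cq_vars q" "1 \<le> p" "p \<le> length s" for x p
    proof -
      \<comment> \<open>Suffixes are counted from the right, positions from the left.\<close>
      define m where "m = length s + 1 - p"
      have m: "1 \<le> m" "m \<le> length s" "length s + 1 - m = p" using that by (auto simp: m_def)
      \<comment> \<open>The walk gives every atom a word, so no atom has an empty language and the
        query's witness mentions all variables.\<close>
      have "x \<in> op_vars ?ops"
        unfolding op_vars_eq mem_Collect_eq
        by (subst status_ops_of_atoms) (use that(1) V func ex lang(1) in blast)+
      with con[OF m(1,2)] m(3) obtain t :: "'a tree" where
        t: "\<forall>(u, w)\<in>set (zip ?us (map (letter_suffix m) rs)). status x u \<noteq> Leaf \<longrightarrow> status x w = t"
        "\<forall>t'. asg_status x asg p = Some t' \<longrightarrow> t = t'"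
        by (auto simp: consistent_def agree_iff)
      have "span_status p (span_of r x) = t" if r: "(\<alpha>, r) \<in> set (zip \<alpha>s rs)" "x \<in> vars \<alpha>" for \<alpha> r
      proof -
        have "status x (ops_of [Rx \<alpha>]) \<noteq> Leaf"
          using ops_of_atom(2)[OF func lang(1)[OF r(1)]] r by (auto dest: set_zip_leftD)
        then have "status x (letter_suffix m r) = t" using t(1) r unfolding zip by fastforce
        moreover have "status x (letter_suffix m r) = span_status p (span_of r x)"
          using status_boundary[OF lang(2)[OF r(1)] r(2) m(1)] lang(3)[OF r(1)] m by simp
        ultimately show ?thesis by simp
      qed
      with t(2) show ?thesis by (intro exI[of _ t]) (auto simp: asg_status_def)
    qed
    have span: "span_of r x \<in> spans s" if "(\<alpha>, r) \<in> set (zip \<alpha>s rs)" "x \<in> vars \<alpha>" for \<alpha> r x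
      using span_of_in_spans[OF lang(2)[OF that(1)] that(2)] lang(3)[OF that(1)] by simp
    \<comment> \<open>Any word of an atom containing \<open>x\<close> may supply the span of
      \<open>x\<close>; \<open>eq\<close> below shows that all of them supply the same one.\<close>
    define sel where "sel x = (SOME r. \<exists>\<alpha>. (\<alpha>, r) \<in> set (zip \<alpha>s rs) \<and> x \<in> vars \<alpha>)" for x
    have sel: "\<exists>\<alpha>. (\<alpha>, sel x) \<in> set (zip \<alpha>s rs) \<and> x \<in> vars \<alpha>" if "x \<in> cq_vars q" for x
      unfolding sel_def by (rule someI_ex) (use that V ex in blast)
    define \<mu> where "\<mu> x = (if x \<in> cq_vars q then Some (span_of (sel x) x) else None)" for x
    have eq: "span_of r x = span_of (sel x) x" if r: "(\<alpha>, r) \<in> set (zip \<alpha>s rs)" "x \<in> vars \<alpha>" for \<alpha> r x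
    proof -
      have x: "x \<in> cq_vars q" using r V by (auto dest: set_zip_leftD)
      from sel[OF x] obtain \<beta> where \<beta>: "(\<beta>, sel x) \<in> set (zip \<alpha>s rs)" "x \<in> vars \<beta>" by blast
      show ?thesis
      proof (rule span_eqI[OF span[OF r] span[OF \<beta>]])
        fix p assume p: "1 \<le> p" "p \<le> length s"
        show "(span_status p (span_of r x) :: 'a tree) = span_status p (span_of (sel x) x)"
        proof -
          from agree[OF x p] obtain t :: "'a tree" where
            "\<forall>(\<alpha>, r)\<in>set (zip \<alpha>s rs). x \<in> vars \<alpha> \<longrightarrow> span_status p (span_of r x) = t" by auto
          from bspec[OF this r(1)] bspec[OF this \<beta>(1)] r \<beta> show ?thesis by simp
        qed
      qed
    qed
    have "is_tuple (cq_vars q) s \<mu>"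
      using sel span by (fastforce simp: is_tuple_def \<mu>_def ran_def dom_def split: if_splits)
    moreover have "\<mu> |` vars \<alpha> \<in> regex_sem \<alpha> s" if \<alpha>: "\<alpha> \<in> set (atoms q)" for \<alpha>
    proof -
      obtain r where r: "(\<alpha>, r) \<in> set (zip \<alpha>s rs)" using ex \<alpha> \<alpha>s_def by blast
      have "\<mu> |` vars \<alpha> = tuple_of (vars \<alpha>) r"
        using eq[OF r] V \<alpha> \<alpha>s_def by (auto simp: restrict_map_def tuple_of_def \<mu>_def fun_eq_iff)
      with lang[OF r] show ?thesis by (auto simp: regex_sem_def)
    qed
    moreover have "map_of asg \<subseteq>\<^sub>m \<mu>"
      unfolding map_le_def
    proof
      fix x assume "x \<in> dom (map_of asg)"
      then obtain sp where sp: "map_of asg x = Some sp" by auto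
      then have "(x, sp) \<in> set asg" by (rule map_of_SomeD)
      then have x: "x \<in> cq_vars q" and sps: "sp \<in> spans s" using asg by force+
      from sel[OF x] obtain \<beta> where \<beta>: "(\<beta>, sel x) \<in> set (zip \<alpha>s rs)" "x \<in> vars \<beta>" by blast
      have "sp = span_of (sel x) x"
      proof (rule span_eqI[OF sps span[OF \<beta>]])
        fix p assume p: "1 \<le> p" "p \<le> length s"
        show "(span_status p sp :: 'a tree) = span_status p (span_of (sel x) x)"
        proof -
          from agree[OF x p] obtain t :: "'a tree" where
            t: "\<forall>(\<alpha>, r)\<in>set (zip \<alpha>s rs). x \<in> vars \<alpha> \<longrightarrow> span_status p (span_of r x) = t"
            "\<forall>sp. map_of asg x = Some sp \<longrightarrow> span_status p sp = t" by auto
          from bspec[OF t(1) \<beta>(1)] t(2) sp \<beta> show ?thesis by simp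
        qed
      qed
      then show "map_of asg x = \<mu> x" using sp x by (simp add: \<mu>_def)
    qed
    ultimately show "extendable q s asg" by (auto simp: extendable_def)
  next
    assume "extendable q s asg"
    then obtain \<mu> where \<mu>: "is_tuple (cq_vars q) s \<mu>" "\<And>\<alpha>. \<alpha> \<in> set \<alpha>s \<Longrightarrow> \<mu> |` vars \<alpha> \<in> regex_sem \<alpha> s"
      "map_of asg \<subseteq>\<^sub>m \<mu>" by (auto simp: extendable_def \<alpha>s_def)
    have "\<exists>r. r \<in> ref_lang \<alpha> \<and> valid (vars \<alpha>) r \<and> clr r = s \<and> \<mu> |` vars \<alpha> = tuple_of (vars \<alpha>) r"
      if "\<alpha> \<in> set \<alpha>s" for \<alpha> using \<mu>(2)[OF that] by (auto simp: regex_sem_def)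
    then obtain f where f: "\<And>\<alpha>. \<alpha> \<in> set \<alpha>s \<Longrightarrow> f \<alpha> \<in> ref_lang \<alpha> \<and> valid (vars \<alpha>) (f \<alpha>) \<and> clr (f \<alpha>) = s \<and>
      \<mu> |` vars \<alpha> = tuple_of (vars \<alpha>) (f \<alpha>)" by metis
    have \<mu>f: "\<mu> x = Some (span_of (f \<alpha>) x)" if "\<alpha> \<in> set \<alpha>s" "x \<in> vars \<alpha>" for \<alpha> x
      using f[OF that(1)] that(2) by (auto simp: restrict_map_def tuple_of_def dest!: fun_cong[of _ _ x])
    have "runs [Rx \<alpha>] (f \<alpha>)" if "\<alpha> \<in> set \<alpha>s" for \<alpha>
      using runs_append[OF _ runs_Nil, of "f \<alpha>" \<alpha>] f[OF that] by simp
    then have 1: "list_all2 runs (map (\<lambda>\<alpha>. [Rx \<alpha>]) \<alpha>s) (map f \<alpha>s)"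
      by (auto simp: list.rel_map intro!: list.rel_refl_strong)
    have "\<exists>c. accepting c \<and> ((s, map (\<lambda>\<alpha>. [Rx \<alpha>]) \<alpha>s), c) \<in> ?R\<^sup>*"
    proof (rule reach_complete[OF 1 _ fstack], intro ballI)
      show "clr r = s" if "r \<in> set (map f \<alpha>s)" for r using that f by auto
      show "\<forall>m. 1 \<le> m \<longrightarrow> m \<le> length s \<longrightarrow>
        consistent ?ops asg (length s + 1 - m) (zip ?us (map (letter_suffix m) (map f \<alpha>s)))"
        unfolding consistent_def agree_iff
      proof (intro allI impI ballI)
        fix m x assume m: "1 \<le> m" "m \<le> length s"
        let ?t = "span_status (length s + 1 - m) (the (\<mu> x)) :: 'a tree"
        have "status x (letter_suffix m (f \<alpha>)) = ?t"
          if \<alpha>: "\<alpha> \<in> set \<alpha>s" "status x (ops_of [Rx \<alpha>]) \<noteq> Leaf" for \<alpha>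
        proof -
          have x: "x \<in> vars \<alpha>" using ops_of_atom(2)[OF func[OF \<alpha>(1)]] f[OF \<alpha>(1)] \<alpha>(2) by blast
          show ?thesis
            using status_boundary[of "vars \<alpha>" "f \<alpha>" x m] f[OF \<alpha>(1)] \<mu>f[OF \<alpha>(1) x] m x by simp
        qed
        moreover have "?t = t'" if "asg_status x asg (length s + 1 - m) = Some t'" for t'
          using that \<mu>(3) by (force simp: asg_status_def map_le_def dom_def)
        ultimately show "\<exists>t. (\<forall>(u, w)\<in>set (zip ?us (map (letter_suffix m) (map f \<alpha>s))).
            status x u \<noteq> Leaf \<longrightarrow> status x w = t) \<and>
          (\<forall>t'. asg_status x asg (length s + 1 - m) = Some t' \<longrightarrow> t = t')"
          by (intro exI[of _ ?t]) (auto simp: zip_map_map zip_same_conv_map)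
      qed
    qed
    then show "\<exists>c\<in>reachable (length s) ?us ?ops asg (init_state s \<alpha>s). accepting c"
      by (auto simp: reachable_def init_state_def state_step_def)
  qed
qed

section \<open>Polynomial bounds for one extendability test\<close>

section \<open>The number of joint states\<close>

text \<open>The stacks that can occur while \<open>\<alpha>\<close> is matched on top of \<open>K\<close>: there are linearly many, since
  each occurrence of a subformula determines what remains to be matched after it.\<close>

fun conts :: "'a regex \<Rightarrow> 'a item list \<Rightarrow> 'a item list set" where
  "conts (Or \<alpha> \<beta>) K = {Rx (Or \<alpha> \<beta>) # K, K} \<union> conts \<alpha> K \<union> conts \<beta> K"
| "conts (Cat \<alpha> \<beta>) K = {Rx (Cat \<alpha> \<beta>) # K, K} \<union> conts \<alpha> (Rx \<beta> # K) \<union> conts \<beta> K"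
| "conts (Star \<alpha>) K = {Rx (Star \<alpha>) # K, K} \<union> conts \<alpha> (Rx (Star \<alpha>) # K)"
| "conts (Capture x \<alpha>) K = {Rx (Capture x \<alpha>) # K, K} \<union> conts \<alpha> (Cl x # K)"
| "conts \<alpha> K = {Rx \<alpha> # K, K}"

lemma conts_self: "Rx \<alpha> # K \<in> conts \<alpha> K" "K \<in> conts \<alpha> K"
  by (cases \<alpha>; simp)+

lemma finite_conts: "finite (conts \<alpha> K)"
  by (induction \<alpha> K rule: conts.induct) auto

definition moves :: "'a item list \<Rightarrow> 'a item list set" where
  "moves S = set (istep S) \<union> {S'. \<exists>a. S = Rx (Sym a) # S'}"

lemma moves_simps [simp]:
  "moves [] = {}" "moves (Rx Empty # K) = {}" "moves (Rx Eps # K) = {K}" "moves (Rx (Sym a) # K) = {K}"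
  "moves (Rx (Or \<alpha> \<beta>) # K) = {Rx \<alpha> # K, Rx \<beta> # K}" "moves (Rx (Cat \<alpha> \<beta>) # K) = {Rx \<alpha> # Rx \<beta> # K}"
  "moves (Rx (Star \<alpha>) # K) = {K, Rx \<alpha> # Rx (Star \<alpha>) # K}"
  "moves (Rx (Capture x \<alpha>) # K) = {Rx \<alpha> # Cl x # K}" "moves (Cl x # K) = {K}"
  by (auto simp: moves_def)

text \<open>\<open>K\<close> itself is exempt because its moves belong to the surroundings. For
  \<open>Cat\<close>, \<open>Star\<close> and \<open>Capture\<close>, the exempt stack of the inner
  formula is one whose moves stay in the outer set by \<open>conts_self\<close> or by the outer
  clause.\<close>

lemma conts_moves: "S \<in> conts \<alpha> K \<Longrightarrow> S \<noteq> K \<Longrightarrow> moves S \<subseteq> conts \<alpha> K"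
proof (induction \<alpha> arbitrary: S K)
  case (Or \<alpha> \<beta>)
  have "moves S \<subseteq> conts (Or \<alpha> \<beta>) K" if "S \<in> conts \<alpha> K"
    using Or.IH(1)[OF that Or.prems(2)] by auto
  moreover have "moves S \<subseteq> conts (Or \<alpha> \<beta>) K" if "S \<in> conts \<beta> K"
    using Or.IH(2)[OF that Or.prems(2)] by auto
  ultimately show ?case using Or.prems conts_self[where \<alpha> = \<alpha> and K = K] conts_self[where \<alpha> = \<beta> and K = K] by auto
next
  case (Cat \<alpha> \<beta>)
  have "moves S \<subseteq> conts (Cat \<alpha> \<beta>) K" if "S \<in> conts \<alpha> (Rx \<beta> # K)" "S \<noteq> Rx \<beta> # K"
    using Cat.IH(1)[OF that] by auto
  moreover have "moves S \<subseteq> conts (Cat \<alpha> \<beta>) K" if "S \<in> conts \<beta> K"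
    using Cat.IH(2)[OF that Cat.prems(2)] by auto
  ultimately show ?case using Cat.prems conts_self[where \<alpha> = \<beta> and K = K] conts_self[where \<alpha> = \<alpha> and K = "Rx \<beta> # K"] by auto
next
  case (Star \<alpha>)
  have "moves S \<subseteq> conts (Star \<alpha>) K" if "S \<in> conts \<alpha> (Rx (Star \<alpha>) # K)" "S \<noteq> Rx (Star \<alpha>) # K"
    using Star.IH[OF that] by auto
  then show ?case
    using Star.prems by (cases "S = Rx (Star \<alpha>) # K") (auto simp: conts_self)
next
  case (Capture x \<alpha>)
  have "moves S \<subseteq> conts (Capture x \<alpha>) K" if "S \<in> conts \<alpha> (Cl x # K)" "S \<noteq> Cl x # K"
    using Capture.IH[OF that] by auto
  then show ?case
    using Capture.prems by (cases "S = Cl x # K") (auto simp: conts_self)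
qed auto

lemma conts_Nil_moves: "S \<in> conts \<alpha> [] \<Longrightarrow> S' \<in> moves S \<Longrightarrow> S' \<in> conts \<alpha> []"
  using conts_moves[of S \<alpha> "[]"] by (cases S) auto

lemma card_insert2_le: "card (insert a (insert b A)) \<le> card A + 2"
  by (cases "finite A") (auto simp: card_insert_if)

lemma card_conts: "card (conts \<alpha> K) \<le> 2 * nodes (enc_regex \<alpha>)"
proof (induction \<alpha> K rule: conts.induct)
  case (1 \<alpha> \<beta> K)
  have "card (conts (Or \<alpha> \<beta>) K) \<le> card (conts \<alpha> K \<union> conts \<beta> K) + 2"
    using card_insert2_le[of _ _ "conts \<alpha> K \<union> conts \<beta> K"] by simp
  also have "\<dots> \<le> card (conts \<alpha> K) + card (conts \<beta> K) + 2" using card_Un_le by simp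
  finally show ?case using 1 by simp
next
  case (2 \<alpha> \<beta> K)
  have "card (conts (Cat \<alpha> \<beta>) K) \<le> card (conts \<alpha> (Rx \<beta> # K) \<union> conts \<beta> K) + 2"
    using card_insert2_le[of _ _ "conts \<alpha> (Rx \<beta> # K) \<union> conts \<beta> K"] by simp
  also have "\<dots> \<le> card (conts \<alpha> (Rx \<beta> # K)) + card (conts \<beta> K) + 2" using card_Un_le by simp
  finally show ?case using 2 by simp
next
  case (3 \<alpha> K)
  have "card (conts (Star \<alpha>) K) \<le> card (conts \<alpha> (Rx (Star \<alpha>) # K)) + 2"
    using card_insert2_le[of _ _ "conts \<alpha> (Rx (Star \<alpha>) # K)"] by simp
  then show ?case using 3 by simp
next
  case (4 x \<alpha> K)
  have "card (conts (Capture x \<alpha>) K) \<le> card (conts \<alpha> (Cl x # K)) + 2"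
    using card_insert2_le[of _ _ "conts \<alpha> (Cl x # K)"] by simp
  then show ?case using 4 by simp
qed (auto intro: order_trans[OF card_insert2_le[of _ _ "{}", simplified]])

text \<open>Each level of nesting pushes at most one item, whose size is bounded by that of the
  formula. Nested stars do reach quadratic size.\<close>

lemma nodes_conts:
  "S \<in> conts \<alpha> K \<Longrightarrow>
    nodes (enc_stack S) \<le> nodes (enc_stack K) + (nodes (enc_regex \<alpha>) + 1) * (nodes (enc_regex \<alpha>) + 1)"
proof (induction \<alpha> K rule: conts.induct)
  case (1 \<alpha> \<beta> K)
  then show ?case by (auto simp: algebra_simps)
next
  case (2 \<alpha> \<beta> K)
  then show ?case by (auto simp: algebra_simps)
next
  case (3 \<alpha> K)
  then show ?case by (auto simp: algebra_simps)
next
  case (4 x \<alpha> K)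
  then show ?case by (auto simp: algebra_simps)
qed (auto simp: algebra_simps)

lemma finite_card_list_all2:
  assumes "\<And>\<alpha>. \<alpha> \<in> set \<alpha>s \<Longrightarrow> finite (F \<alpha>)" "\<And>\<alpha>. \<alpha> \<in> set \<alpha>s \<Longrightarrow> card (F \<alpha>) \<le> b"
  shows "finite {Ks. list_all2 (\<lambda>\<alpha> K. K \<in> F \<alpha>) \<alpha>s Ks} \<and>
    card {Ks. list_all2 (\<lambda>\<alpha> K. K \<in> F \<alpha>) \<alpha>s Ks} \<le> b ^ length \<alpha>s"
  using assms
proof (induction \<alpha>s)
  case (Cons \<alpha> \<alpha>s)
  let ?L = "{Ks. list_all2 (\<lambda>\<alpha> K. K \<in> F \<alpha>) \<alpha>s Ks}"
  have eq: "{Ks. list_all2 (\<lambda>\<alpha> K. K \<in> F \<alpha>) (\<alpha> # \<alpha>s) Ks} = (\<lambda>(K, Ks). K # Ks) ` (F \<alpha> \<times> ?L)"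
    by (auto simp: list_all2_Cons1 image_iff)
  have fin: "finite (F \<alpha> \<times> ?L)" using Cons by auto
  have "card ((\<lambda>(K, Ks). K # Ks) ` (F \<alpha> \<times> ?L)) \<le> card (F \<alpha>) * card ?L"
    using card_image_le[OF fin] by (metis card_cartesian_product)
  also have "\<dots> \<le> b * b ^ length \<alpha>s" using Cons by (intro mult_le_mono) auto
  finally show ?case unfolding eq using fin by auto
next
  case Nil
  have "{Ks. list_all2 (\<lambda>\<alpha> K. K \<in> F \<alpha>) [] Ks} = {[]}" by auto
  then show ?case by simp
qed

text \<open>Ignores the consistency checks, so that one set, independent of the assignment, bounds
  every search for the same query and string.\<close>

definition state_space :: "'a list \<Rightarrow> 'a regex list \<Rightarrow> ('a list \<times> 'a item list list) set" where
  "state_space s \<alpha>s = (\<lambda>i. drop i s) ` {..length s} \<times> {Ks. list_all2 (\<lambda>\<alpha> K. K \<in> conts \<alpha> []) \<alpha>s Ks}"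

lemma state_space_card:
  assumes "\<And>\<alpha>. \<alpha> \<in> set \<alpha>s \<Longrightarrow> nodes (enc_regex \<alpha>) \<le> b"
  shows "finite (state_space s \<alpha>s)" "card (state_space s \<alpha>s) \<le> (length s + 1) * (2 * b) ^ length \<alpha>s"
proof -
  have 1: "finite {Ks. list_all2 (\<lambda>\<alpha> K. K \<in> conts \<alpha> []) \<alpha>s Ks} \<and>
    card {Ks. list_all2 (\<lambda>\<alpha> K. K \<in> conts \<alpha> []) \<alpha>s Ks} \<le> (2 * b) ^ length \<alpha>s"
    using assms by (intro finite_card_list_all2) (auto intro: finite_conts order_trans[OF card_conts])
  then show "finite (state_space s \<alpha>s)" by (auto simp: state_space_def)
  have "card ((\<lambda>i. drop i s) ` {..length s}) \<le> length s + 1"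
    using card_image_le[of "{..length s}" "\<lambda>i. drop i s"] by simp
  with 1 show "card (state_space s \<alpha>s) \<le> (length s + 1) * (2 * b) ^ length \<alpha>s"
    unfolding state_space_def card_cartesian_product by (intro mult_le_mono) auto
qed

lemma isucc_moves:
  "list_all2 (\<lambda>\<alpha> K. K \<in> conts \<alpha> []) \<alpha>s Ks \<Longrightarrow> Ks' \<in> set (isucc Ks) \<Longrightarrow>
    list_all2 (\<lambda>\<alpha> K. K \<in> conts \<alpha> []) \<alpha>s Ks'"
proof (induction arbitrary: Ks' rule: list_all2_induct)
  case (Cons \<alpha> \<alpha>s K Ks)
  then show ?case
    using conts_Nil_moves[of K \<alpha>] by (auto simp: moves_def)
qed simp

lemma state_space_closed:
  assumes "q \<in> state_space s \<alpha>s"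
  shows "set (succs n us ops asg q) \<subseteq> state_space s \<alpha>s"
proof
  fix q' assume q': "q' \<in> set (succs n us ops asg q)"
  obtain suf Ks where q: "q = (suf, Ks)" by (cases q)
  obtain i where i: "i \<le> length s" "suf = drop i s" and Ks: "list_all2 (\<lambda>\<alpha> K. K \<in> conts \<alpha> []) \<alpha>s Ks"
    using assms q by (auto simp: state_space_def)
  from q' consider Ks' where "q' = (suf, Ks')" "Ks' \<in> set (isucc Ks)"
    | "q' \<in> set (letter_succ n us ops asg (suf, Ks))"
    by (auto simp: succs_def q)
  then show "q' \<in> state_space s \<alpha>s"
  proof cases
    case 1
    with isucc_moves[OF Ks] i show ?thesis by (auto simp: state_space_def)
  next
    case 2
    then obtain a suf' where suf: "suf = a # suf'" by (cases suf) auto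
    with 2 obtain Ks' where "lstep a Ks = Some Ks'" and q': "q' = (suf', Ks')"
      by (cases "lstep a Ks") (auto split: if_splits)
    then have "Ks = map (Cons (Rx (Sym a))) Ks'" by (simp add: lstep_eq_Some_iff)
    with Ks have "list_all2 (\<lambda>\<alpha> K. K \<in> conts \<alpha> []) \<alpha>s Ks'"
      by (auto simp: list.rel_map elim!: list.rel_mono_strong dest: conts_Nil_moves)
    moreover have "suf' = drop (Suc i) s" using suf i by (auto simp: drop_Suc tl_drop[symmetric])
    moreover have "Suc i \<le> length s" using suf i by (metis drop_all list.distinct(1) not_less_eq_eq)
    ultimately show ?thesis using q' by (auto simp: state_space_def)
  qed
qed


section \<open>Deciding extendability\<close>

text \<open>Large enough for witnesses, at most \<open>10 * N\<close>, and for stacks, at most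
  \<open>1 + (N + 1) * (N + 1)\<close>.\<close>

definition size_bound :: "nat \<Rightarrow> nat" where
  "size_bound N = 10 * ((N + 1) * (N + 1)) + 10"

definition state_bound :: "nat \<Rightarrow> nat \<Rightarrow> nat" where
  "state_bound k N = 2 * N + 10 + k * (size_bound N + 1)"

text \<open>At most \<open>N + 1\<close> suffixes, and for each of at most \<open>k\<close> atoms at
  most \<open>2 * N\<close> stacks by \<open>card_conts\<close>. Only here is \<open>k\<close> an
  exponent.\<close>

definition count_bound :: "nat \<Rightarrow> nat \<Rightarrow> nat" where
  "count_bound k N = (N + 1) * (2 * N) ^ k"

definition search_cost :: "nat \<Rightarrow> nat \<Rightarrow> nat" where
  "search_cost k N = (2 + (2 * k + 1) * count_bound k N) *
     iteration_cost k (size_bound N) (state_bound k N) (count_bound k N)"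

lemma iteration_cost_mono:
  assumes "k \<le> k'" "M \<le> M'" "c \<le> c'"
  shows "iteration_cost k B M c \<le> iteration_cost k' B M' c'"
  using assms unfolding iteration_cost_def succ_cost_def ok_cost_def
  by (intro add_mono mult_le_mono) auto

lemma length_le_nodes: "length ts < nodes (enc_list ts)"
  by (induction ts) auto

lemma nodes_elem: "t \<in> set ts \<Longrightarrow> nodes t < nodes (enc_list ts)"
  by (induction ts) auto

lemma nodes_enc_string: "nodes (enc_string s) = 2 * length s + 1"
  by (induction s) auto

lemma nodes_enc_stacks: "(\<And>K. K \<in> set Ks \<Longrightarrow> nodes (enc_stack K) \<le> b) \<Longrightarrow>
    nodes (enc_stacks Ks) \<le> 1 + length Ks * (b + 1)"
proof (induction Ks)
  case (Cons K Ks)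
  then have "nodes (enc_stack K) \<le> b" "nodes (enc_stacks Ks) \<le> 1 + length Ks * (b + 1)" by auto
  then show ?case by simp
qed simp

lemma computes_search_cq:
  fixes s :: "'a list"
  assumes q: "is_regex_k_cq k q" "nodes (enc_cq q) \<le> N" and s: "nodes (enc_string s) \<le> N"
    and asg: "snd ` set asg \<subseteq> spans s" "fst ` set asg \<subseteq> cq_vars q" "length asg \<le> N"
  defines "\<alpha>s \<equiv> atoms q"
  shows "computes Search [Cell (enc_state (init_state s \<alpha>s)) Leaf, Leaf,
      enc_list (map enc_ops (map (\<lambda>\<alpha>. ops_of [Rx \<alpha>]) \<alpha>s)), enc_ops (ops_of (map Rx \<alpha>s)), enc_asg s asg]
    (bool_tree (extendable q s asg)) (search_cost k N)"
proof -
  let ?us = "map (\<lambda>\<alpha>. ops_of [Rx \<alpha>]) \<alpha>s" and ?ops = "ops_of (map Rx \<alpha>s)"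
  let ?B = "size_bound N" and ?R = "state_space s \<alpha>s"
  have k: "length \<alpha>s \<le> k" and q': "is_regex_cq q" using q by (auto simp: is_regex_k_cq_def \<alpha>s_def)
  have N: "nodes (enc_list (map enc_regex \<alpha>s)) \<le> N" using q(2) by (simp add: enc_cq_def \<alpha>s_def)
  have \<alpha>N: "nodes (enc_regex \<alpha>) \<le> N" if "\<alpha> \<in> set \<alpha>s" for \<alpha>
    using nodes_elem[of "enc_regex \<alpha>" "map enc_regex \<alpha>s"] that N by auto
  have sN: "length s \<le> N" using s by (simp add: nodes_enc_string)
  have NB: "10 * N + 10 \<le> ?B" "1 + (N + 1) * (N + 1) \<le> ?B" by (auto simp: size_bound_def algebra_simps)
  have len: "length (snd c) = length \<alpha>s" "length (fst c) \<le> length s" if "c \<in> ?R" for c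
    using that by (auto simp: state_space_def dest: list_all2_lengthD)
  have B: "nodes (enc_stack K) \<le> ?B" if c: "c \<in> ?R" "K \<in> set (snd c)" for c K
  proof -
    have "list_all2 (\<lambda>\<alpha> K. K \<in> conts \<alpha> []) \<alpha>s (snd c)" using c by (auto simp: state_space_def)
    moreover obtain i where "i < length (snd c)" "K = snd c ! i"
      using c(2) by (auto simp: in_set_conv_nth)
    ultimately have "\<alpha>s ! i \<in> set \<alpha>s" "K \<in> conts (\<alpha>s ! i) []"
      using list_all2_nthD2 list_all2_lengthD by fastforce+
    then obtain \<alpha> where \<alpha>: "\<alpha> \<in> set \<alpha>s" "K \<in> conts \<alpha> []" by blast
    have "(nodes (enc_regex \<alpha>) + 1) * (nodes (enc_regex \<alpha>) + 1) \<le> (N + 1) * (N + 1)"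
      using \<alpha>N[OF \<alpha>(1)] by (intro mult_le_mono) auto
    with nodes_conts[OF \<alpha>(2)] NB(2) show ?thesis by simp
  qed
  have M: "nodes (enc_state c) \<le> state_bound k N" if c: "c \<in> ?R" for c
  proof -
    have "nodes (enc_stacks (snd c)) \<le> 1 + length (snd c) * (?B + 1)"
      by (rule nodes_enc_stacks) (use B[OF c] in auto)
    also have "length (snd c) * (?B + 1) \<le> k * (?B + 1)" using len[OF c] k by (intro mult_le_mono) auto
    finally show ?thesis
      using len(2)[OF c] sN by (cases c) (auto simp: state_bound_def nodes_enc_string)
  qed
  have us: "\<forall>u\<in>set ?us. nodes (enc_ops u) \<le> ?B"
  proof
    fix u assume "u \<in> set ?us"
    then obtain \<alpha> where \<alpha>: "\<alpha> \<in> set \<alpha>s" "u = ops_of [Rx \<alpha>]" by auto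
    show "nodes (enc_ops u) \<le> ?B"
    proof (cases "wit \<alpha>")
      case None
      then show ?thesis using \<alpha> NB by (simp add: ops_of_def)
    next
      case (Some w)
      with \<alpha> nodes_wit[OF Some] \<alpha>N[OF \<alpha>(1)] NB show ?thesis by (simp add: ops_of_def)
    qed
  qed
  have ops: "nodes (enc_ops ?ops) \<le> ?B"
    using nodes_ops_of[of "map Rx \<alpha>s"] N NB by (simp add: enc_stack_def comp_def)
  have card: "finite ?R" "card ?R \<le> count_bound k N"
  proof -
    show "finite ?R" by (rule state_space_card(1)[OF \<alpha>N])
    have 1: "card ?R \<le> (length s + 1) * (2 * N) ^ length \<alpha>s" by (rule state_space_card(2)[OF \<alpha>N])
    \<comment> \<open>A query may have fewer than \<open>k\<close> atoms; raising the exponent to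
      \<open>k\<close> requires a positive base.\<close>
    have "1 \<le> N" using N nodes_pos(1)[of "enc_list (map enc_regex \<alpha>s)"] by linarith
    then have "(2 * N) ^ length \<alpha>s \<le> (2 * N) ^ k" using k by (intro power_increasing) auto
    then have "(length s + 1) * (2 * N) ^ length \<alpha>s \<le> (N + 1) * (2 * N) ^ k"
      using sN by (intro mult_le_mono) auto
    with 1 show "card ?R \<le> count_bound k N" unfolding count_bound_def by linarith
  qed
  have "list_all2 (\<lambda>\<alpha> K. K \<in> conts \<alpha> []) \<alpha>s (map (\<lambda>\<alpha>. [Rx \<alpha>]) \<alpha>s)"
    by (auto simp: list.rel_map conts_self intro!: list.rel_refl_strong)
  moreover have "s \<in> (\<lambda>i. drop i s) ` {..length s}" by (rule image_eqI[of _ _ 0]) auto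
  ultimately have q0: "init_state s \<alpha>s \<in> ?R" unfolding init_state_def state_space_def by blast
  have 1: "computes Search [Cell (enc_state (init_state s \<alpha>s)) Leaf, Leaf,
      enc_list (map enc_ops ?us), enc_ops ?ops, enc_asg s asg]
    (bool_tree (\<exists>c\<in>reachable (length s) ?us ?ops asg (init_state s \<alpha>s). accepting c))
    ((2 + (2 * length \<alpha>s + 1) * card ?R) * iteration_cost (length \<alpha>s) ?B (state_bound k N) (card ?R))"
  proof (rule computes_search[where R = ?R])
    show "finite ?R" by (rule card(1))
    show "set (succs (length s) ?us ?ops asg c) \<subseteq> ?R" if "c \<in> ?R" for c
      by (rule state_space_closed[OF that])
    show "length (snd c) = length \<alpha>s" if "c \<in> ?R" for c by (rule len(1)[OF that])
    show "length (fst c) \<le> length s" if "c \<in> ?R" for c by (rule len(2)[OF that])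
    show "nodes (enc_stack K) \<le> ?B" if "c \<in> ?R" "K \<in> set (snd c)" for c K by (rule B[OF that])
    show "nodes (enc_state c) \<le> state_bound k N" if "c \<in> ?R" for c by (rule M[OF that])
    show "length ?us = length \<alpha>s" by (rule length_map)
    show "\<forall>u\<in>set ?us. nodes (enc_ops u) \<le> ?B" by (rule us)
    show "snd ` set asg \<subseteq> spans s" by (rule asg(1))
    show "length asg \<le> ?B" using asg(3) NB(1) by linarith
    show "length s \<le> ?B" using sN NB(1) by linarith
    show "nodes (enc_ops ?ops) \<le> ?B" by (rule ops)
    show "init_state s \<alpha>s \<in> ?R" by (rule q0)
  qed
  have 2: "(\<exists>c\<in>reachable (length s) ?us ?ops asg (init_state s \<alpha>s). accepting c) = extendable q s asg"
    unfolding \<alpha>s_def by (rule extendable_iff_reachable[OF q' asg(1,2)])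
  have 3: "(2 + (2 * length \<alpha>s + 1) * card ?R) *
      iteration_cost (length \<alpha>s) ?B (state_bound k N) (card ?R) \<le> search_cost k N"
    unfolding search_cost_def using k card(2)
    by (intro mult_le_mono add_mono iteration_cost_mono order_refl)
  show ?thesis using computes_weaken[OF 1 3] unfolding 2 .
qed

definition ext_cost :: "nat \<Rightarrow> nat \<Rightarrow> nat" where
  "ext_cost k N = (N + 1) * (search_cost k N + 20 * k + 160 * N + 200)"

lemma computes_ext:
  fixes s :: "'a list"
  assumes "\<And>q. q \<in> set Q \<Longrightarrow> is_regex_k_cq k q \<and> nodes (enc_cq q) \<le> N \<and> fst ` set asg \<subseteq> cq_vars q"
    and "nodes (enc_string s) \<le> N" "snd ` set asg \<subseteq> spans s" "length asg \<le> N" "length Q \<le> N"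
  shows "computes Ext [enc_ucq Q, enc_string s, enc_asg s asg]
    (bool_tree (\<exists>q\<in>set Q. extendable q s asg)) (ext_cost k N)"
proof -
  let ?C = "search_cost k N + 20 * k + 160 * N + 200"
  have "computes Ext [enc_list (map enc_cq Q), enc_string s, enc_asg s asg]
    (bool_tree (\<exists>q\<in>set Q. extendable q s asg)) ((length Q + 1) * ?C)"
    using assms(1)
  proof (induction Q)
    case Nil show ?case by (auto simp: body.simps intro!: computesI)
  next
    case (Cons q Q)
    let ?\<alpha>s = "atoms q"
    have q: "is_regex_k_cq k q" "nodes (enc_cq q) \<le> N" "fst ` set asg \<subseteq> cq_vars q"
      using Cons.prems by auto
    then have N: "nodes (enc_list (map enc_regex ?\<alpha>s)) \<le> N" and k: "length ?\<alpha>s \<le> k"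
      by (auto simp: enc_cq_def is_regex_k_cq_def)
    have "computes ConsR [enc_list (map enc_regex ?\<alpha>s), Leaf]
      (enc_stacks (map (\<lambda>\<alpha>. [Rx \<alpha>]) ?\<alpha>s)) (20 * length ?\<alpha>s + 10)"
      using computes_consR[of "enc_list (map enc_regex ?\<alpha>s)" Leaf] by (simp add: enc_stacks_def comp_def)
    then have 1: "computes ConsR [enc_list (map enc_regex ?\<alpha>s), Leaf]
      (enc_stacks (map (\<lambda>\<alpha>. [Rx \<alpha>]) ?\<alpha>s)) (20 * k + 10)"
      by (rule computes_weaken) (use k in auto)
    have 2: "computes Als [enc_list (map enc_regex ?\<alpha>s)]
      (enc_list (map enc_ops (map (\<lambda>\<alpha>. ops_of [Rx \<alpha>]) ?\<alpha>s))) (80 * N)"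
      by (rule computes_weaken[OF computes_als]) (use N in auto)
    have "enc_stack (map Rx ?\<alpha>s) = enc_list (map enc_regex ?\<alpha>s)" by (simp add: enc_stack_def comp_def)
    then have 3: "computes Wits [enc_list (map enc_regex ?\<alpha>s)] (enc_wit (wits (map Rx ?\<alpha>s)) []) (80 * N)"
      using computes_wits[of "map Rx ?\<alpha>s"] N by (auto elim!: computes_weaken)
    note 4 = computes_search_cq[OF q(1,2) assms(2,3) q(3) assms(4), unfolded init_state_def enc_state_simp map_map comp_def]
    note 2 = 2[unfolded map_map comp_def]
    have IH: "computes Ext [enc_list (map enc_cq Q), enc_string s, enc_asg s asg]
      (bool_tree (\<exists>q\<in>set Q. extendable q s asg)) ((length Q + 1) * ?C)"
      using Cons by auto
    have cq: "enc_cq q = Cell (enc_list (map enc_nat (out_list q))) (enc_list (map enc_regex ?\<alpha>s))"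
      by (simp add: enc_cq_def)
    show ?case
    proof (cases "extendable q s asg")
      case True
      then show ?thesis
        by (intro computesI) (auto simp: body.simps cq comp_def
          intro!: callsI[OF 1] callsI[OF 2] callsI[OF 3] callsI[OF 4[unfolded True]])
    next
      case False
      then have "(\<exists>q\<in>set (q # Q). extendable q s asg) = (\<exists>q\<in>set Q. extendable q s asg)" by simp
      then show ?thesis
        using False
        by (intro computesI) (auto simp: body.simps cq comp_def algebra_simps simp del: bex_simps
          intro!: callsI[OF 1] callsI[OF 2] callsI[OF 3] callsI[OF 4] callsI[OF IH])
    qed
  qed
  then show ?thesis
    unfolding enc_ucq_def ext_cost_def using assms(5)
    by (elim computes_weaken) (intro mult_le_mono; simp)
qed

section \<open>The search tree and the gaps between outputs\<close>

section \<open>The answers\<close>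

definition can_extend :: "'a regex_ucq \<Rightarrow> 'a list \<Rightarrow> (var \<times> span) list \<Rightarrow> bool" where
  "can_extend Q s asg \<longleftrightarrow> (\<exists>q\<in>set Q. extendable q s asg)"

text \<open>A model of \<open>Enum\<close> with the same pruning, in which the disjuncts appear only
  inside \<open>can_extend\<close>.\<close>

primrec answers :: "'a regex_ucq \<Rightarrow> 'a list \<Rightarrow> var list \<Rightarrow> (var \<times> span) list \<Rightarrow> (var \<times> span) list list" where
  "answers Q s [] asg = (if can_extend Q s asg then [asg] else [])"
| "answers Q s (x # xs) asg =
    (if can_extend Q s asg
     then if x \<in> fst ` set asg then answers Q s xs asg
       else concat (map (\<lambda>sp. answers Q s xs ((x, sp) # asg)) (all_spans (length s)))
     else [])"

lemma answers_sound:
  assumes "asg' \<in> set (answers Q s xs asg)" "distinct (map fst asg)"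
  shows "distinct (map fst asg') \<and> dom (map_of asg') = set xs \<union> fst ` set asg \<and> can_extend Q s asg' \<and>
    map_of asg \<subseteq>\<^sub>m map_of asg'"
  using assms
proof (induction xs arbitrary: asg)
  case Nil then show ?case by (auto simp: dom_map_of_conv_image_fst split: if_splits)
next
  case (Cons x xs)
  show ?case
  proof (cases "x \<in> fst ` set asg")
    case True
    with Cons.prems have "asg' \<in> set (answers Q s xs asg)" by (auto split: if_splits)
    from Cons.IH[OF this Cons.prems(2)] True show ?thesis by auto
  next
    case False
    with Cons.prems obtain sp where "asg' \<in> set (answers Q s xs ((x, sp) # asg))" by (auto split: if_splits)
    moreover have "distinct (map fst ((x, sp) # asg))" using False Cons.prems(2) by auto
    ultimately have *: "distinct (map fst asg')" "dom (map_of asg') = set xs \<union> fst ` set ((x, sp) # asg)"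
      "can_extend Q s asg'" "map_of ((x, sp) # asg) \<subseteq>\<^sub>m map_of asg'" using Cons.IH by blast+
    have "map_of asg \<subseteq>\<^sub>m map_of ((x, sp) # asg)"
      using False by (auto simp: map_le_def dom_map_of_conv_image_fst)
    with *(4) have "map_of asg \<subseteq>\<^sub>m map_of asg'" by (rule map_le_trans[rotated])
    with * show ?thesis by auto
  qed
qed

text \<open>Every part of \<mu> passes the test, so the branch that follows the values of \<mu> is
  never pruned.\<close>

lemma answers_complete:
  assumes "dom \<mu> = set xs \<union> fst ` set asg" "map_of asg \<subseteq>\<^sub>m \<mu>" "ran \<mu> \<subseteq> spans s"
    and "\<And>asg'. map_of asg' \<subseteq>\<^sub>m \<mu> \<Longrightarrow> can_extend Q s asg'"
  shows "\<mu> \<in> map_of ` set (answers Q s xs asg)"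
  using assms(1,2)
proof (induction xs arbitrary: asg)
  case Nil
  then have "map_of asg = \<mu>"
    by (metis Un_empty_left dom_map_of_conv_image_fst list.set(1) map_le_antisym map_le_def)
  with Nil assms(4) show ?case by auto
next
  case (Cons x xs)
  have ext: "can_extend Q s asg" using assms(4) Cons.prems by blast
  show ?case
  proof (cases "x \<in> fst ` set asg")
    case True
    then show ?thesis using Cons ext by (simp add: insert_absorb)
  next
    case False
    have "x \<in> dom \<mu>" using Cons.prems(1) by simp
    then obtain sp where sp: "\<mu> x = Some sp" by blast
    then have "sp \<in> set (all_spans (length s))"
      using assms(3) all_spans(1)[of s] by (auto intro: ranI)
    moreover have "\<mu> \<in> map_of ` set (answers Q s xs ((x, sp) # asg))"
      by (rule Cons.IH) (use Cons.prems sp in \<open>auto simp: map_le_def\<close>)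
    ultimately show ?thesis using ext False by fastforce
  qed
qed

text \<open>Sibling branches differ in the span of \<open>x\<close>, and later choices preserve it,
  so their answers differ as functions and not merely as lists.\<close>

lemma answers_distinct:
  assumes "distinct (map fst asg)"
  shows "distinct (map map_of (answers Q s xs asg))"
  using assms
proof (induction xs arbitrary: asg)
  case (Cons x xs)
  note IH = Cons.IH and dist = Cons.prems
  show ?case
  proof (cases "x \<in> fst ` set asg")
    case True
    with Cons show ?thesis by auto
  next
    case False
    have val: "\<mu> x = Some sp" if \<mu>: "\<mu> \<in> map_of ` set (answers Q s xs ((x, sp) # asg))" for \<mu> sp
    proof -
      obtain asg' where asg': "asg' \<in> set (answers Q s xs ((x, sp) # asg))" "\<mu> = map_of asg'" using \<mu> by blast
      have "map_of ((x, sp) # asg) \<subseteq>\<^sub>m map_of asg'"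
        using answers_sound[OF asg'(1)] False Cons.prems by auto
      then show ?thesis using asg'(2) by (auto simp: map_le_def dest!: bspec[of _ _ x])
    qed
    have "distinct (concat (map (\<lambda>sp. map map_of (answers Q s xs ((x, sp) # asg))) sps))"
      if "distinct sps" for sps
      using that
    proof (induction sps)
      case (Cons sp sps)
      have "distinct (map map_of (answers Q s xs ((x, sp) # asg)))"
        by (rule IH) (use dist False in auto)
      moreover have "map_of ` set (answers Q s xs ((x, sp) # asg)) \<inter>
          (\<Union>sp'\<in>set sps. map_of ` set (answers Q s xs ((x, sp') # asg))) = {}"
      proof -
        have False if "\<mu> \<in> map_of ` set (answers Q s xs ((x, sp) # asg))" "sp' \<in> set sps"
          "\<mu> \<in> map_of ` set (answers Q s xs ((x, sp') # asg))" for \<mu> sp'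
          using val[OF that(1)] val[OF that(3)] that(2) Cons.prems by simp
        then show ?thesis by blast
      qed
      ultimately show ?case using Cons by (simp add: Union_eq image_iff)
    qed simp
    from this[OF all_spans(2)] False show ?thesis by (simp add: map_concat comp_def)
  qed
qed simp

text \<open>The bound \<open>c\<close> for computations without output is separate from the bound \<open>h\<close> for the outer gaps:
  branches that are cut off all cost the same, whereas \<open>h\<close> grows with the depth of the branch, and
  only one such branch contributes to each gap.\<close>

definition lead :: "'a event list \<Rightarrow> nat" where
  "lead tr = length (takeWhile (\<lambda>e. e = Tick) tr)"

definition segment :: "nat \<Rightarrow> nat \<Rightarrow> nat \<Rightarrow> 'a event list \<Rightarrow> bool" where
  "segment c h b tr \<longleftrightarrow> delay_at_most b tr \<and> lead tr \<le> h \<and> lead (rev tr) \<le> h \<and>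
     (outputs tr = [] \<longrightarrow> length tr \<le> c)"

lemma outputs_append [simp]: "outputs (x @ y) = outputs x @ outputs y"
  by (induction x rule: outputs.induct) auto

lemma outputs_replicate [simp]: "outputs (replicate n Tick) = []"
  by (induction n) auto

lemma outputs_Nil_iff: "outputs tr = [] \<longleftrightarrow> set tr \<subseteq> {Tick}"
  by (induction tr rule: outputs.induct) auto

lemma lead_append: "lead (x @ y) = (if outputs x = [] then length x + lead y else lead x)"
  by (induction x rule: outputs.induct) (auto simp: lead_def)

lemma outputs_rev_Nil [simp]: "outputs (rev x) = [] \<longleftrightarrow> outputs x = []"
  by (auto simp: outputs_Nil_iff)

text \<open>A stretch of ticks across the seam splits into the end of \<open>x\<close> and the
  beginning of \<open>y\<close>, which the two leads bound.\<close>

lemma delay_append: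
  assumes "delay_at_most b x" "delay_at_most b y" "lead (rev x) + lead y \<le> b"
  shows "delay_at_most b (x @ y)"
  unfolding delay_at_most_def
proof (intro allI impI)
  fix u n w assume eq: "x @ y = u @ replicate n Tick @ w"
  consider u' where "u = x @ u'" "y = u' @ replicate n Tick @ w"
    | x' where "x = u @ x'" "x' @ y = replicate n Tick @ w"
    using eq by (auto simp: append_eq_append_conv2)
  then show "n \<le> b"
  proof cases
    case 1
    with assms(2) show ?thesis by (auto simp: delay_at_most_def)
  next
    case 2
    show ?thesis
    proof (cases "n \<le> length x'")
      case True
      then have "take n x' = replicate n Tick" using 2(2)
        by (metis append_eq_append_conv_if length_replicate)
      then have "x = u @ replicate n Tick @ drop n x'" using 2(1) by (metis append_take_drop_id)
      with assms(1) show ?thesis by (auto simp: delay_at_most_def)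
    next
      case False
      let ?m = "length x'"
      have rep: "replicate n (Tick :: 'a event) = replicate ?m Tick @ replicate (n - ?m) Tick"
        using False by (simp flip: replicate_add)
      have x': "x' = replicate ?m Tick" "y = replicate (n - ?m) Tick @ w"
        using 2(2) unfolding rep by (auto simp: append_eq_append_conv)
      have "rev x = replicate ?m Tick @ rev u" using 2(1) x'(1) by (metis rev_append rev_replicate)
      then have "?m \<le> lead (rev x)" by (simp add: lead_append)
      moreover have "n - ?m \<le> lead y" unfolding x'(2) by (simp add: lead_append)
      ultimately show ?thesis using assms(3) by linarith
    qed
  qed
qed

text \<open>An outer gap of the whole exceeds that of a part only if the other part is silent; hence
  sums of one \<open>c\<close> and one \<open>h\<close>, while \<open>h1 + h2\<close> concerns the
  inner gap at the seam.\<close>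

lemma segment_append:
  assumes "segment c1 h1 b x" "segment c2 h2 b y" "h1 + h2 \<le> b"
    and "c1 + c2 \<le> c" "c1 + h2 \<le> h" "h1 + c2 \<le> h" "h1 \<le> h" "h2 \<le> h"
  shows "segment c h b (x @ y)"
  using assms unfolding segment_def by (auto simp: lead_append intro: delay_append)

lemma delay_replicate: "delay_at_most n (replicate n Tick)"
  unfolding delay_at_most_def
proof (intro allI impI)
  fix u m w assume "replicate n (Tick :: 'a event) = u @ replicate m Tick @ w"
  then have "length (replicate n (Tick :: 'a event)) = length u + m + length w" by simp
  then show "m \<le> n" by simp
qed

lemma delay_mono: "delay_at_most b tr \<Longrightarrow> b \<le> b' \<Longrightarrow> delay_at_most b' tr"
  by (auto simp: delay_at_most_def intro: order_trans)

lemma lead_replicate: "lead (replicate n Tick) = n"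
  using lead_append[of "replicate n Tick" "[]"] by (simp add: lead_def)

lemma segment_replicate: "n \<le> c \<Longrightarrow> c \<le> h \<Longrightarrow> h \<le> b \<Longrightarrow> segment c h b (replicate n Tick)"
  unfolding segment_def by (auto simp: lead_replicate intro: delay_mono[OF delay_replicate])

lemma segment_Out: "segment c h b [Out t]"
proof -
  have "n = 0" if "[Out t] = u @ replicate n Tick @ w" for u n w
  proof (rule ccontr)
    assume "n \<noteq> 0"
    then have "Tick \<in> set (u @ replicate n Tick @ w)" by simp
    then show False unfolding that[symmetric] by simp
  qed
  then have "delay_at_most b [Out t]" unfolding delay_at_most_def by blast
  then show ?thesis by (simp add: segment_def lead_def)
qed

text \<open>One output makes the bound on silent traces vacuous, so it can be reset. This keeps the
  cost of a silent call from growing with the depth of the recursion.\<close>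

lemma segment_nonempty: "segment c h b tr \<Longrightarrow> outputs tr \<noteq> [] \<Longrightarrow> segment c' h b tr"
  by (simp add: segment_def)

lemma segment_mono: "segment c h b tr \<Longrightarrow> c \<le> c' \<Longrightarrow> h \<le> h' \<Longrightarrow> segment c' h' b tr"
  by (auto simp: segment_def)

section \<open>Evaluation with outputs\<close>

text \<open>The counterpart of \<open>wp\<close> for \<open>Main\<close>, \<open>Enum\<close> and
  \<open>Loop\<close>, whose traces may contain outputs.\<close>

definition xp :: "'a program \<Rightarrow> 'a tree list \<Rightarrow> 'a expr \<Rightarrow> ('a tree \<Rightarrow> 'a event list \<Rightarrow> bool) \<Rightarrow> bool" where
  "xp P env e Q \<longleftrightarrow> (\<exists>t tr. eval P env e t tr \<and> Q t tr)"

lemma xp_mono: "xp P env e Q \<Longrightarrow> (\<And>t tr. Q t tr \<Longrightarrow> Q' t tr) \<Longrightarrow> xp P env e Q'"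
  unfolding xp_def by blast

lemma ticks_eq_replicate: "set tr \<subseteq> {Tick} \<Longrightarrow> tr = replicate (length tr) Tick"
  by (induction tr) auto

lemma xp_silent:
  assumes "wp P env e (\<lambda>t n. Q t (replicate n Tick))"
  shows "xp P env e Q"
  using assms ticks_eq_replicate unfolding wp_def xp_def by metis

lemma xp_if:
  assumes "wp P env e (\<lambda>t n. xp P env (if t = Leaf then e2 else e1)
    (\<lambda>t' tr. Q t' (replicate (n + 1) Tick @ tr)))"
  shows "xp P env (EIf e e1 e2) Q"
proof -
  obtain t tr where 1: "eval P env e t tr" "set tr \<subseteq> {Tick}"
    "xp P env (if t = Leaf then e2 else e1) (\<lambda>t' tr'. Q t' (replicate (length tr + 1) Tick @ tr'))"
    using assms unfolding wp_def by blast
  then obtain t' tr' where 2: "eval P env (if t = Leaf then e2 else e1) t' tr'"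
    "Q t' (replicate (length tr + 1) Tick @ tr')"
    unfolding xp_def by blast
  have "replicate (length tr + 1) Tick = tr @ [Tick]"
    using ticks_eq_replicate[OF 1(2)] by (metis Suc_eq_plus1 replicate_append_same replicate_Suc)
  with 1 2 show ?thesis
    unfolding xp_def eval_if_iff by (metis append.assoc)
qed

lemma xp_let:
  assumes "xp P env e (\<lambda>t tr. xp P (t # env) e' (\<lambda>t' tr'. Q t' (tr @ [Tick] @ tr')))"
  shows "xp P env (ELet e e') Q"
  using assms unfolding xp_def eval_iffs by blast

lemma xp_call:
  assumes "wps prog env es (\<lambda>ts n. xp prog ts (body f) (\<lambda>t tr. Q t (replicate (n + 1) Tick @ tr)))"
  shows "xp prog env (call f es) Q"
proof -
  obtain ts tr where 1: "evals prog env es ts tr" "set tr \<subseteq> {Tick}"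
    "xp prog ts (body f) (\<lambda>t' tr'. Q t' (replicate (length tr + 1) Tick @ tr'))"
    using assms unfolding wps_def by blast
  then obtain t' tr' where 2: "eval prog ts (body f) t' tr'"
    "Q t' (replicate (length tr + 1) Tick @ tr')"
    unfolding xp_def by blast
  have "replicate (length tr + 1) Tick = tr @ [Tick]"
    using ticks_eq_replicate[OF 1(2)] by (metis Suc_eq_plus1 replicate_append_same replicate_Suc)
  with 1 2 show ?thesis
    unfolding xp_def eval_iffs using prog_idx by (metis append.assoc)
qed

lemma xp_emit:
  assumes "wp P env e (\<lambda>t n. wp P env e' (\<lambda>t' n'.
    Q t' (replicate (n + nodes t) Tick @ [Out t] @ replicate n' Tick)))"
  shows "xp P env (EEmit e e') Q"
proof -
  obtain t tr t' tr' where 1: "eval P env e t tr" "set tr \<subseteq> {Tick}" "eval P env e' t' tr'" "set tr' \<subseteq> {Tick}"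
    "Q t' (replicate (length tr + nodes t) Tick @ [Out t] @ replicate (length tr') Tick)"
    using assms unfolding wp_def by blast
  have "eval P env (EEmit e e') t' (tr @ replicate (nodes t) Tick @ [Out t] @ tr')"
    using 1 by (intro eval_emit)
  also have "tr @ replicate (nodes t) Tick @ [Out t] @ tr' =
      replicate (length tr + nodes t) Tick @ [Out t] @ replicate (length tr') Tick"
    using ticks_eq_replicate[OF 1(2)] ticks_eq_replicate[OF 1(4)] by (simp add: replicate_add)
  finally show ?thesis using 1(5) unfolding xp_def by blast
qed

section \<open>Enumeration with bounded gaps\<close>

text \<open>The test never admits a dead end: a complete match that extends \<open>asg\<close>,
  restricted to the variables concerned, is found by the search.\<close>

lemma answers_nonempty:
  assumes "can_extend Q s asg" "\<And>q. q \<in> set Q \<Longrightarrow> set xs \<union> fst ` set asg \<subseteq> cq_vars q"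
  shows "answers Q s xs asg \<noteq> []"
proof -
  obtain q \<nu> where q: "q \<in> set Q" "is_tuple (cq_vars q) s \<nu>"
    "\<forall>\<alpha>\<in>set (atoms q). \<nu> |` vars \<alpha> \<in> regex_sem \<alpha> s" "map_of asg \<subseteq>\<^sub>m \<nu>"
    using assms(1) by (auto simp: can_extend_def extendable_def)
  let ?\<mu> = "\<nu> |` (set xs \<union> fst ` set asg)"
  have "?\<mu> \<in> map_of ` set (answers Q s xs asg)"
  proof (rule answers_complete)
    show "dom ?\<mu> = set xs \<union> fst ` set asg"
      using assms(2)[OF q(1)] q(2) by (auto simp: is_tuple_def)
    show "map_of asg \<subseteq>\<^sub>m ?\<mu>"
      using q(4) by (auto simp: map_le_def dom_map_of_conv_image_fst)
    show "ran ?\<mu> \<subseteq> spans s"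
      using q(2) by (auto simp: is_tuple_def ran_def restrict_map_def split: if_splits)
    show "can_extend Q s asg'" if "map_of asg' \<subseteq>\<^sub>m ?\<mu>" for asg'
    proof -
      have "map_of asg' \<subseteq>\<^sub>m \<nu>"
        using that by (rule map_le_trans) (auto simp: map_le_def)
      with q show ?thesis by (auto simp: can_extend_def extendable_def)
    qed
  qed
  then show ?thesis by auto
qed

definition enc_answer :: "(var \<times> span) list \<Rightarrow> 'a tree" where
  "enc_answer asg = enc_list (map enc_binding asg)"

lemma enc_answer_simps [simp]:
  "enc_answer [] = Leaf"
  "enc_answer ((x, i, j) # asg) = Cell (Cell (enc_nat x) (Cell (enc_nat i) (enc_nat j))) (enc_answer asg)"
  by (simp_all add: enc_answer_def enc_binding_def)

lemma fst_enc_pos [simp]: "fst_tree (enc_pos s i) = enc_nat i"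
  by (simp add: enc_pos_def)

lemma nodes_enc_nat: "nodes (enc_nat n :: 'a tree) \<le> 4 * n + 1"
proof -
  have "nodes (enc_list (map bool_tree bs) :: 'a tree) \<le> 4 * length bs + 1" for bs
    by (induction bs) (auto simp: bool_tree_def)
  from this[of "bits n"] length_bits[of n] show ?thesis by (simp add: enc_nat_def)
qed

definition answer_bound :: "nat \<Rightarrow> nat" where
  "answer_bound N = N * (10 * N + 30) + 1"

lemma nodes_enc_answer:
  fixes s :: "'a list"
  assumes "\<And>x. x \<in> fst ` set asg \<Longrightarrow> nodes (enc_nat x :: 'a tree) \<le> N" "snd ` set asg \<subseteq> spans s"
    and "length s \<le> N"
  shows "nodes (enc_answer asg :: 'a tree) \<le> length asg * (10 * N + 30) + 1"
  using assms(1,2)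
proof (induction asg)
  case (Cons b asg)
  obtain x i j where b: "b = (x, i, j)" by (cases b) auto
  have "i \<le> N + 1" "j \<le> N + 1" using Cons.prems b assms(3) by (auto simp: spans_def)
  then have "nodes (enc_nat i :: 'a tree) \<le> 4 * N + 5" "nodes (enc_nat j :: 'a tree) \<le> 4 * N + 5"
    using nodes_enc_nat[where 'a = 'a, of i] nodes_enc_nat[where 'a = 'a, of j] by auto
  moreover have "nodes (enc_nat x :: 'a tree) \<le> N" using Cons.prems b by auto
  moreover have "nodes (enc_answer asg :: 'a tree) \<le> length asg * (10 * N + 30) + 1"
    using Cons by auto
  ultimately show ?case unfolding b by simp
qed simp

definition fits :: "nat \<Rightarrow> nat \<Rightarrow> 'a regex_ucq \<Rightarrow> 'a list \<Rightarrow> bool" where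
  "fits k N Q s \<longleftrightarrow> (\<forall>q\<in>set Q. is_regex_k_cq k q \<and> nodes (enc_cq q) \<le> N) \<and>
     nodes (enc_string s) \<le> N \<and> length Q \<le> N"

definition node_cost :: "nat \<Rightarrow> nat \<Rightarrow> nat" where
  "node_cost k N = ext_cost k N + asg_cost N + answer_bound N + 100"

text \<open>An outer gap crosses at most \<open>m + 1\<close> levels. On each it passes at most
  \<open>(N + 1) * (N + 1)\<close> rejected spans, and two further units cover the test and
  bookkeeping of the level itself.\<close>

definition gap_bound :: "nat \<Rightarrow> nat \<Rightarrow> nat \<Rightarrow> nat" where
  "gap_bound k N m = (m + 1) * (((N + 1) * (N + 1) + 2) * (node_cost k N + 200))"

abbreviation enum_args where
  "enum_args Q s xs asg \<equiv> [enc_list (map enc_nat xs), enc_asg s asg, enc_answer asg, enc_ucq Q,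
     enc_list (map (enc_span s) (all_spans (length s))), enc_string s]"

lemma segment_pad:
  assumes "segment c h b tr" "c \<le> h" "n + h \<le> b"
  shows "segment (n + c) (n + h) b (replicate n Tick @ tr)"
  using assms by (intro segment_append[OF segment_replicate[of n n n] assms(1)]) auto

lemma segment_two:
  assumes "segment c h b tr" "segment c' h' b tr'" "c \<le> h" "c' \<le> h'"
    and "n + m + h + Suc n' + h' \<le> b" "n + m + c + Suc n' + c' \<le> c''"
    and "n + m + h + Suc n' + c' \<le> h''" "n + m + c + Suc n' + h' \<le> h''"
  shows "segment c'' h'' b (replicate n Tick @ replicate m Tick @ tr @ Tick # replicate n' Tick @ tr')"
proof -
  have "segment (Suc n' + c') (Suc n' + h') b (replicate (Suc n') Tick @ tr')"
    using assms by (intro segment_pad) auto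
  then have 1: "segment (c + (Suc n' + c')) (max (h + (Suc n' + c')) (c + (Suc n' + h'))) b
      (tr @ replicate (Suc n') Tick @ tr')"
    using assms by (intro segment_append[OF assms(1)]) auto
  have "segment (n + m + (c + (Suc n' + c'))) (n + m + max (h + (Suc n' + c')) (c + (Suc n' + h'))) b
      (replicate (n + m) Tick @ tr @ replicate (Suc n') Tick @ tr')"
    using assms by (intro segment_pad[OF 1]) auto
  then have "segment c'' h'' b (replicate (n + m) Tick @ tr @ replicate (Suc n') Tick @ tr')"
    by (rule segment_mono) (use assms in auto)
  then show ?thesis by (simp add: replicate_add)
qed

text \<open>Between two outputs lie the end of one productive iteration, silent iterations, and the
  beginning of another productive one: at most \<open>2 * h\<close> plus \<open>c + 200\<close> per
  iteration. An outer gap reaches into one productive iteration, so \<open>h\<close> is added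
  once.\<close>

lemma loop_correct:
  fixes s :: "'a list"
  assumes "\<And>sp. sp \<in> set sps \<Longrightarrow> xp prog (enum_args Q s xs ((x, sp) # asg)) (body Enum)
      (\<lambda>t tr. outputs tr = map enc_answer (answers Q s xs ((x, sp) # asg)) \<and> segment c h b tr)"
    and "2 * h + (length sps + 1) * (c + 200) \<le> b" "c \<le> h"
  shows "xp prog (enc_list (map (enc_span s) sps) # enum_args Q s (x # xs) asg) (body Loop)
      (\<lambda>t tr. outputs tr = concat (map (\<lambda>sp. map enc_answer (answers Q s xs ((x, sp) # asg))) sps) \<and>
        segment (length sps * (c + 200) + 50) (length sps * (c + 200) + 50 + h) b tr)"
  using assms
proof (induction sps)
  case Nil
  then show ?case
    unfolding body.simps
    by (intro xp_if) (simp, intro xp_silent, simp add: segment_replicate flip: replicate_Suc)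
next
  case (Cons sp sps)
  obtain i j where sp: "sp = (i, j)" by (cases sp)
  have IH: "xp prog (enc_list (map (enc_span s) sps) # enum_args Q s (x # xs) asg) (body Loop)
      (\<lambda>t tr. outputs tr = concat (map (\<lambda>sp. map enc_answer (answers Q s xs ((x, sp) # asg))) sps) \<and>
        segment (length sps * (c + 200) + 50) (length sps * (c + 200) + 50 + h) b tr)"
    using Cons by (intro Cons.IH) auto
  note enum = Cons.prems(1)[of sp, simplified sp, simplified]
  show ?case
    unfolding body.simps sp
    apply (rule xp_if)
    apply (simp del: replicate.simps replicate_Suc)
    apply (rule xp_let)
    apply (rule xp_call)
    apply (simp del: replicate.simps replicate_Suc)
    apply (rule xp_mono[OF enum])
    apply (elim conjE)
    apply (rule xp_call)
    apply (simp del: replicate.simps replicate_Suc)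
    apply (rule xp_mono[OF IH[simplified]])
    apply (elim conjE)
    apply (intro conjI)
     apply simp
    apply (rule segment_two; assumption?)
    using Cons.prems(2,3) apply auto
    done
qed

lemma replicate_merge:
  "replicate a x @ replicate b x = replicate (a + b) x"
  "replicate a x @ replicate b x @ y = replicate (a + b) x @ y"
  by (simp_all add: replicate_add)

context
  fixes qt st asgt ot spt :: "'a tree" and c :: nat and b :: bool
  assumes ext: "computes Ext [qt, st, asgt] (bool_tree b) c"
begin

text \<open>This and the next three lemmas execute one branch of \<open>Enum\<close> each, for
  arbitrary trees, so that symbolic execution stays free of encodings.\<close>

lemma enum_rejected:
  assumes "\<not> b" "\<And>n. n \<le> c + 50 \<Longrightarrow> Q Leaf (replicate n Tick)"
  shows "xp prog [vt, asgt, ot, qt, spt, st] (body Enum) Q"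
  using assms unfolding body.simps
  by (auto simp: replicate_merge simp del: replicate.simps replicate_Suc
      intro!: xp_if callsI[OF ext] xp_silent)

lemma enum_leaf:
  assumes b "\<And>n m. n \<le> c + nodes ot + 50 \<Longrightarrow> m \<le> 10 \<Longrightarrow>
    Q Leaf (replicate n Tick @ [Out ot] @ replicate m Tick)"
  shows "xp prog [Leaf, asgt, ot, qt, spt, st] (body Enum) Q"
  using assms unfolding body.simps
  by (auto simp: replicate_merge simp del: replicate.simps replicate_Suc
      intro!: xp_if callsI[OF ext] xp_emit)

context
  fixes xt vt rt :: "'a tree" and c' :: nat
  assumes b: b and stat: "computes AsgStat [xt, asgt, st] rt c'"
begin

lemma enum_skip:
  assumes "rt \<noteq> Leaf"
    and "xp prog [vt, asgt, ot, qt, spt, st] (body Enum) (\<lambda>t tr. \<forall>n\<le>c + c' + 100. Q t (replicate n Tick @ tr))"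
  shows "xp prog [Cell xt vt, asgt, ot, qt, spt, st] (body Enum) Q"
  unfolding body.simps(25)
  using b assms(1)
  by (auto simp: replicate_merge simp del: replicate.simps replicate_Suc
      intro!: xp_if callsI[OF ext] callsI[OF stat] xp_call xp_mono[OF assms(2)])

lemma enum_loop:
  assumes "rt = Leaf"
    and "xp prog [spt, Cell xt vt, asgt, ot, qt, spt, st] (body Loop)
      (\<lambda>t tr. \<forall>n\<le>c + c' + 100. Q t (replicate n Tick @ tr))"
  shows "xp prog [Cell xt vt, asgt, ot, qt, spt, st] (body Enum) Q"
  unfolding body.simps(25)
  using b assms(1)
  by (auto simp: replicate_merge simp del: replicate.simps replicate_Suc
      intro!: xp_if callsI[OF ext] callsI[OF stat] xp_call xp_mono[OF assms(2)])

end

end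

lemma segment_output:
  assumes "n + m \<le> h" "h \<le> b"
  shows "segment c h b (replicate n Tick @ [Out t] @ replicate m Tick)"
proof -
  have "segment m m b (replicate m (Tick :: 'a event))"
    using assms by (intro segment_replicate) auto
  from segment_append[OF segment_Out[of 0 0] this] have "segment m m b ([Out t] @ replicate m Tick)"
    using assms by auto
  then have "segment (n + m) (n + m) b (replicate n Tick @ [Out t] @ replicate m Tick)"
    using assms by (intro segment_pad) auto
  then have "segment c (n + m) b (replicate n Tick @ [Out t] @ replicate m Tick)"
    by (rule segment_nonempty) simp
  then show ?thesis by (rule segment_mono) (use assms in auto)
qed

text \<open>\<open>b\<close> stays fixed during the recursion while the outer gap grows by one
  summand per level. Only rejected nodes are silent, which is why \<open>node_cost\<close> has no
  dependence on the number of remaining variables.\<close>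

lemma enum_correct:
  fixes s :: "'a list"
  assumes fits: "fits k N Q s"
    and vars: "\<And>q. q \<in> set Q \<Longrightarrow> set xs \<union> fst ` set asg \<subseteq> cq_vars q"
    and nodes: "\<And>x. x \<in> set xs \<union> fst ` set asg \<Longrightarrow> nodes (enc_nat x :: 'a tree) \<le> N"
    and spans: "snd ` set asg \<subseteq> spans s" and len: "length asg + length xs \<le> N"
    and b: "2 * gap_bound k N (length xs) \<le> b"
  shows "xp prog (enum_args Q s xs asg) (body Enum)
    (\<lambda>t tr. outputs tr = map enc_answer (answers Q s xs asg) \<and>
      segment (node_cost k N) (gap_bound k N (length xs)) b tr)"
  using vars nodes spans len b
proof (induction xs arbitrary: asg)
  have sN: "nodes (enc_string s) \<le> N" "length s \<le> N" "length Q \<le> N"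
    using fits by (auto simp: fits_def nodes_enc_string)
  have ext: "computes Ext [enc_ucq Q, enc_string s, enc_asg s asg]
      (bool_tree (can_extend Q s asg)) (ext_cost k N)"
    if "\<And>q. q \<in> set Q \<Longrightarrow> set xs \<union> fst ` set asg \<subseteq> cq_vars q" "snd ` set asg \<subseteq> spans s"
      "length asg + length xs \<le> N" for xs asg
    unfolding can_extend_def
    by (rule computes_ext) (use that fits sN in \<open>auto simp: fits_def\<close>)
  have H0: "node_cost k N + 200 \<le> gap_bound k N m" for m
    unfolding gap_bound_def by (simp add: algebra_simps)
  {
    case (Nil asg)
    note ext = ext[OF Nil(1) Nil(3,4)]
    have out: "nodes (enc_answer asg :: 'a tree) \<le> answer_bound N"
    proof -
      have "length asg * (10 * N + 30) \<le> N * (10 * N + 30)" using Nil(4) by (intro mult_le_mono1) simp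
      moreover have "nodes (enc_answer asg :: 'a tree) \<le> length asg * (10 * N + 30) + 1"
        using Nil sN(2) by (intro nodes_enc_answer) auto
      ultimately show ?thesis unfolding answer_bound_def by linarith
    qed
    show ?case
    proof (cases "can_extend Q s asg")
      case False
      show ?thesis
        by (rule enum_rejected[OF ext False])
          (use False H0[of 0] Nil(5) in \<open>auto simp: node_cost_def intro!: segment_replicate\<close>)
    next
      case True
      show ?thesis
        unfolding list.map enc_list.simps
        by (rule enum_leaf[OF ext True])
          (use True out H0[of 0] Nil(5) in
            \<open>auto simp: node_cost_def simp del: append_Cons intro!: segment_output\<close>)
    qed
  next
    case (Cons x xs asg)
    note ext = ext[OF Cons(2) Cons(4,5)]
    have stat: "computes AsgStat [enc_nat x, enc_asg s asg, enc_string s] (enc_opt (asg_status x asg 1)) (asg_cost N)"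
      using computes_asgstat_le[of s s asg x N] Cons sN by auto
    have None: "asg_status x asg 1 = None \<longleftrightarrow> x \<notin> fst ` set asg"
      by (simp add: asg_status_def map_of_eq_None_iff)
    let ?C = "node_cost k N" and ?h = "gap_bound k N (length xs)"
    have Suc: "gap_bound k N (length (x # xs)) = ?h + ((N + 1) * (N + 1) + 2) * (?C + 200)"
      by (simp add: gap_bound_def)
    have C: "2 * (?C + 200) \<le> ((N + 1) * (N + 1) + 2) * (?C + 200)" by (intro mult_le_mono) auto
    have pre: "ext_cost k N + asg_cost N + 100 \<le> ?C" by (simp add: node_cost_def)
    show ?case
    proof (cases "can_extend Q s asg")
      case False
      show ?thesis
        by (rule enum_rejected[OF ext False])
          (use False H0[of "length (x # xs)"] Cons(6) in \<open>auto simp: node_cost_def intro!: segment_replicate\<close>)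
    next
      case True
      have ne: "answers Q s (x # xs) asg \<noteq> []"
        by (rule answers_nonempty[OF True]) (use Cons(2) in blast)
      show ?thesis
      proof (cases "x \<in> fst ` set asg")
        case dom: True
        have IH: "xp prog (enum_args Q s xs asg) (body Enum)
          (\<lambda>t tr. outputs tr = map enc_answer (answers Q s xs asg) \<and> segment ?C ?h b tr)"
          by (rule Cons.IH) (use Cons.prems Suc in auto)
        have seg: "segment ?C (gap_bound k N (length (x # xs))) b (replicate n Tick @ tr)"
          if tr: "segment ?C ?h b tr" "outputs tr = map enc_answer (answers Q s xs asg)"
            and n: "n \<le> ext_cost k N + asg_cost N + 100" for n and tr :: "'a event list"
        proof -
          have n': "n + ?h \<le> gap_bound k N (length (x # xs))" "?C \<le> ?h"
            using n pre C H0[of "length xs"] unfolding Suc by simp_all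
          have "segment (n + ?C) (n + ?h) b (replicate n Tick @ tr)"
            by (rule segment_pad[OF tr(1)]) (use n' Cons(6) in linarith)+
          then have "segment ?C (n + ?h) b (replicate n Tick @ tr)"
            by (rule segment_nonempty) (use ne True dom tr(2) in auto)
          then show ?thesis by (rule segment_mono) (use n' in linarith)+
        qed
        show ?thesis
          unfolding list.map enc_list.simps
          by (rule enum_skip[OF ext True stat])
            (use None dom True seg in \<open>auto intro!: xp_mono[OF IH]\<close>)
      next
        case new: False
        have IH: "xp prog (enum_args Q s xs ((x, sp) # asg)) (body Enum)
          (\<lambda>t tr. outputs tr = map enc_answer (answers Q s xs ((x, sp) # asg)) \<and> segment ?C ?h b tr)"
          if "sp \<in> set (all_spans (length s))" for sp
          by (rule Cons.IH) (use Cons.prems Suc that all_spans(1)[of s] in auto)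
        let ?n = "length (all_spans (length s))"
        have "(length s + 1) * (length s + 1) \<le> (N + 1) * (N + 1)" using sN by (intro mult_le_mono) auto
        with all_spans(3)[of "length s"] have "?n \<le> (N + 1) * (N + 1)" by linarith
        then have n: "(?n + 2) * (?C + 200) \<le> ((N + 1) * (N + 1) + 2) * (?C + 200)"
          by (intro mult_le_mono1) simp
        have "2 * ?h + (?n + 1) * (?C + 200) \<le> b" "?C \<le> ?h"
          using n Suc Cons(6) H0[of "length xs"] by (simp_all add: algebra_simps)
        note loop = loop_correct[OF IH this]
        have seg: "segment ?C (gap_bound k N (length (x # xs))) b (replicate m Tick @ tr)"
          if tr: "segment (?n * (?C + 200) + 50) (?n * (?C + 200) + 50 + ?h) b tr"
            "outputs tr = map enc_answer (answers Q s (x # xs) asg)"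
            and m: "m \<le> ext_cost k N + asg_cost N + 100" for m and tr :: "'a event list"
        proof -
          have n': "m + (?n * (?C + 200) + 50 + ?h) \<le> gap_bound k N (length (x # xs))"
            using n m pre unfolding Suc by (simp add: algebra_simps)
          have "segment (m + (?n * (?C + 200) + 50)) (m + (?n * (?C + 200) + 50 + ?h)) b (replicate m Tick @ tr)"
            by (rule segment_pad[OF tr(1)]) (use n' Cons(6) in linarith)+
          then have "segment ?C (m + (?n * (?C + 200) + 50 + ?h)) b (replicate m Tick @ tr)"
            by (rule segment_nonempty) (use ne tr(2) in auto)
          then show ?thesis by (rule segment_mono) (use n' in linarith)+
        qed
        have ans: "(map enc_answer (answers Q s (x # xs) asg) :: 'a tree list) =
          concat (map (\<lambda>sp. map enc_answer (answers Q s xs ((x, sp) # asg))) (all_spans (length s)))"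
          using True new by (simp add: map_concat comp_def)
        show ?thesis
          unfolding list.map enc_list.simps
          by (rule enum_loop[OF ext True stat])
            (use None new seg ans in \<open>auto simp del: answers.simps intro!: xp_mono[OF loop[unfolded list.map enc_list.simps]]\<close>)
      qed
    qed
  }
qed

section \<open>The main function\<close>

text \<open>Computing the positions and the spans precedes the first gap. The factor
  \<open>2\<close> joins the end of one call with the beginning of the next.\<close>

definition total_bound :: "nat \<Rightarrow> nat \<Rightarrow> nat" where
  "total_bound k N = 2 * gap_bound k N N + (N + 1) * (20 * N + 100) + (N + 2) * (40 * (N + 1) + 100) + 200"

text \<open>A found assignment has exactly the output variables as its domain, so being contained in
  a match means being its projection.\<close>

lemma answers_eq_ucq_sem:
  assumes "\<And>q. q \<in> set Q \<Longrightarrow> cq_out q = set xs \<and> is_regex_cq q"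
  shows "map_of ` set (answers Q s xs []) = ucq_sem Q s"
proof (intro equalityI subsetI)
  fix \<mu> assume "\<mu> \<in> map_of ` set (answers Q s xs [])"
  then obtain asg where asg: "asg \<in> set (answers Q s xs [])" "\<mu> = map_of asg" by blast
  from answers_sound[OF asg(1)] have dom: "dom \<mu> = set xs" and "can_extend Q s asg"
    using asg(2) by auto
  then obtain q \<nu> where q: "q \<in> set Q" "is_tuple (cq_vars q) s \<nu>"
    "\<forall>\<alpha>\<in>set (atoms q). \<nu> |` vars \<alpha> \<in> regex_sem \<alpha> s" and le: "\<mu> \<subseteq>\<^sub>m \<nu>"
    using asg(2) by (auto simp: can_extend_def extendable_def)
  have "\<mu> = \<nu> |` cq_out q"
  proof
    fix x show "\<mu> x = (\<nu> |` cq_out q) x"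
      using le dom assms[OF q(1)] by (cases "x \<in> dom \<mu>") (auto simp: map_le_def restrict_map_def)
  qed
  with q show "\<mu> \<in> ucq_sem Q s" by (auto simp: ucq_sem_def cq_sem_def)
next
  fix \<mu> assume "\<mu> \<in> ucq_sem Q s"
  then obtain q \<nu> where q: "q \<in> set Q" "is_tuple (cq_vars q) s \<nu>"
    "\<forall>\<alpha>\<in>set (atoms q). \<nu> |` vars \<alpha> \<in> regex_sem \<alpha> s" and \<mu>: "\<mu> = \<nu> |` cq_out q"
    by (auto simp: ucq_sem_def cq_sem_def)
  show "\<mu> \<in> map_of ` set (answers Q s xs [])"
  proof (rule answers_complete)
    show "dom \<mu> = set xs \<union> fst ` set []"
      using q(2) assms[OF q(1)] \<mu> by (auto simp: is_tuple_def is_regex_cq_def)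
    show "ran \<mu> \<subseteq> spans s"
      using q(2) \<mu> by (auto simp: is_tuple_def ran_def restrict_map_def split: if_splits)
    show "can_extend Q s asg'" if "map_of asg' \<subseteq>\<^sub>m \<mu>" for asg'
    proof -
      have "map_of asg' \<subseteq>\<^sub>m \<nu>" using that unfolding \<mu> by (rule map_le_trans) (auto simp: map_le_def)
      with q show ?thesis by (auto simp: can_extend_def extendable_def)
    qed
  qed simp
qed

lemma gap_bound_mono: "m \<le> m' \<Longrightarrow> gap_bound k N m \<le> gap_bound k N m'"
  unfolding gap_bound_def by (intro mult_le_mono) auto

lemma delay_pad:
  assumes "segment c h b tr" "n + Suc m + h \<le> b"
  shows "delay_at_most b (replicate n Tick @ Tick # replicate m Tick @ tr)"
proof -
  have "delay_at_most b (replicate (n + Suc m) Tick @ tr)"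
  proof (rule delay_append)
    show "delay_at_most b (replicate (n + Suc m) Tick)"
      using assms(2) by (intro delay_mono[OF delay_replicate]) simp
    show "delay_at_most b tr" using assms(1) by (simp add: segment_def)
    show "lead (rev (replicate (n + Suc m) Tick)) + lead tr \<le> b"
      using assms unfolding rev_replicate lead_replicate segment_def by linarith
  qed
  then show ?thesis by (simp add: replicate_add replicate_app_Cons_same)
qed

lemma main_correct:
  fixes s :: "'a list"
  assumes Q: "is_regex_k_ucq k Q"
  defines "N \<equiv> nodes (enc_input (Q, s))"
  shows "\<exists>tr. run prog (enc_input (Q, s)) tr \<and>
    (\<exists>ys. list_all2 represents_tuple (outputs tr) ys \<and> distinct ys \<and> set ys = ucq_sem Q s) \<and>
    delay_at_most (total_bound k N) tr"
proof -
  \<comment> \<open>The disjuncts agree on their output variables, so the list of the first one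
    serves all. For an empty union it is empty, and the test at the root fails.\<close>
  define xs where "xs = (case Q of [] \<Rightarrow> [] | q # Q' \<Rightarrow> out_list q)"
  have N: "nodes (enc_ucq Q) < N" "nodes (enc_string s) < N"
    by (auto simp: N_def enc_input_def)
  have L: "length s \<le> N" using N(2) by (simp add: nodes_enc_string)
  have cq: "cq_out q = set xs" if "q \<in> set Q" for q
    using Q that unfolding is_regex_k_ucq_def xs_def by (cases Q) (auto simp: cq_out_def)
  have k: "is_regex_k_cq k q" if "q \<in> set Q" for q using Q that by (auto simp: is_regex_k_ucq_def)
  have cqN: "nodes (enc_cq q) \<le> N" if "q \<in> set Q" for q
    using nodes_elem[of "enc_cq q" "map enc_cq Q"] that N(1) by (auto simp: enc_ucq_def)
  have fits: "fits k N Q s"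
    using length_le_nodes[of "map enc_cq Q"] N k cqN by (auto simp: fits_def enc_ucq_def)
  have xs: "enc_list (map enc_nat xs) = fst_tree (fst_tree (enc_ucq Q))"
    by (cases Q) (auto simp: xs_def enc_ucq_def enc_cq_def)
  have xsN: "nodes (enc_list (map enc_nat xs) :: 'a tree) \<le> N"
  proof (cases Q)
    case (Cons q Q')
    with cqN[of q] show ?thesis by (simp add: xs_def enc_cq_def)
  qed (use N in \<open>simp add: xs_def\<close>)
  have "length xs \<le> N" using length_le_nodes[of "map enc_nat xs :: 'a tree list"] xsN by simp
  then have gap: "gap_bound k N (length xs) \<le> gap_bound k N N" by (rule gap_bound_mono)
  let ?spl = "enc_list (map (enc_span s) (all_spans (length s)))"
  have enum: "xp prog (enum_args Q s xs []) (body Enum)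
    (\<lambda>t tr. outputs tr = map enc_answer (answers Q s xs []) \<and>
      segment (node_cost k N) (gap_bound k N (length xs)) (total_bound k N) tr)"
  proof (rule enum_correct[OF fits])
    show "set xs \<union> fst ` set [] \<subseteq> cq_vars q" if "q \<in> set Q" for q
      using cq[OF that] k[OF that] by (auto simp: is_regex_k_cq_def is_regex_cq_def)
    show "nodes (enc_nat x :: 'a tree) \<le> N" if "x \<in> set xs \<union> fst ` set []" for x
      using nodes_elem[of "enc_nat x :: 'a tree" "map enc_nat xs"] that xsN by auto
    show "2 * gap_bound k N (length xs) \<le> total_bound k N" using gap by (simp add: total_bound_def)
  qed (use \<open>length xs \<le> N\<close> in auto)
  have posl: "computes Posl [enc_string s, enc_nat (Suc 0)] (enc_list (map (enc_pos s) [1..<length s + 2]))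
      ((N + 1) * (20 * N + 100))"
    using computes_posl[of "[]" s N] L by (auto elim!: computes_weaken intro!: mult_le_mono1 simp del: upt_Suc)
  have "(length s + 2) * (40 * (length s + 1) + 100) \<le> (N + 2) * (40 * (N + 1) + 100)"
    using L by (intro mult_le_mono) auto
  then have spl: "computes Spl [enc_list (map (enc_pos s) [1..<length s + 2])] ?spl ((N + 2) * (40 * (N + 1) + 100))"
    using computes_spl[of s "[1..<length s + 2]"] unfolding all_spans_def
    by (auto elim!: computes_weaken simp del: upt_Suc)
  have upt: "[1..<length s + 2] = [Suc 0..<Suc (Suc (length s))]" by (simp del: upt_Suc)
  have "xp prog [enc_input (Q, s)] (body Main) (\<lambda>t tr.
    outputs tr = map enc_answer (answers Q s xs []) \<and> delay_at_most (total_bound k N) tr)"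
    unfolding body.simps enc_input_def
    apply (rule xp_let)
    apply (rule xp_silent)
    apply (simp del: replicate.simps replicate_Suc upt_Suc)
    apply (rule callsI[OF posl[unfolded enc_nat_numerals]])
    apply (simp del: replicate.simps replicate_Suc upt_Suc)
    apply (rule callsI[OF spl[unfolded upt]])
    apply (rule xp_call)
    apply (simp del: replicate.simps replicate_Suc upt_Suc add: xs[symmetric])
    apply (rule xp_mono[OF enum[unfolded enc_asg_simps enc_answer_simps]])
    apply (elim conjE, intro conjI, simp)
    apply (erule delay_pad)
    using gap apply (simp add: total_bound_def algebra_simps)
    done
  then obtain t tr where tr: "eval prog [enc_input (Q, s)] (body Main) t tr"
    "outputs tr = map enc_answer (answers Q s xs [])" "delay_at_most (total_bound k N) tr"
    unfolding xp_def by blast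
  have "(prog :: 'a program) \<noteq> []" "(prog :: 'a program) ! 0 = body Main"
    by (simp_all add: prog_def)
  with tr(1) have "run prog (enc_input (Q, s)) tr" by (auto simp: run_def)
  moreover have "list_all2 represents_tuple (outputs tr) (map map_of (answers Q s xs []))"
    unfolding tr(2) using answers_sound
    by (fastforce simp: list.rel_map represents_tuple_def enc_answer_def intro!: list.rel_refl_strong)
  moreover have "distinct (map map_of (answers Q s xs []))" by (rule answers_distinct) simp
  moreover have "set (map map_of (answers Q s xs [])) = ucq_sem Q s"
    using answers_eq_ucq_sem[of Q xs s] cq k by (auto simp: is_regex_k_cq_def)
  ultimately show ?thesis using tr(3) by blast
qed

section \<open>The polynomial\<close>

definition polynomial :: "(nat \<Rightarrow> nat) \<Rightarrow> bool" where
  "polynomial f \<longleftrightarrow> (\<exists>p :: nat poly. \<forall>n. f n = poly p n)"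

lemma polynomial_intros:
  "polynomial (\<lambda>n. c)" "polynomial (\<lambda>n. n)"
  "polynomial f \<Longrightarrow> polynomial g \<Longrightarrow> polynomial (\<lambda>n. f n + g n)"
  "polynomial f \<Longrightarrow> polynomial g \<Longrightarrow> polynomial (\<lambda>n. f n * g n)"
  "polynomial f \<Longrightarrow> polynomial (\<lambda>n. f n ^ m)"
proof -
  show "polynomial (\<lambda>n. c)" unfolding polynomial_def by (rule exI[of _ "[:c:]"]) simp
  show "polynomial (\<lambda>n. n)" unfolding polynomial_def by (rule exI[of _ "[:0, 1:]"]) simp
  show "polynomial (\<lambda>n. f n + g n)" if "polynomial f" "polynomial g"
    using that unfolding polynomial_def by (metis poly_add)
  show "polynomial (\<lambda>n. f n * g n)" if "polynomial f" "polynomial g"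
    using that unfolding polynomial_def by (metis poly_mult)
  show "polynomial (\<lambda>n. f n ^ m)" if "polynomial f"
    using that unfolding polynomial_def by (metis poly_power)
qed

text \<open>\<open>k\<close> is a constant here, so the power in \<open>count_bound\<close> falls
  under the rule for fixed exponents.\<close>

lemma polynomial_total_bound: "polynomial (total_bound k)"
  unfolding total_bound_def gap_bound_def node_cost_def ext_cost_def answer_bound_def search_cost_def
    iteration_cost_def succ_cost_def ok_cost_def agree_cost_def asg_cost_def size_bound_def
    state_bound_def count_bound_def
  by (intro polynomial_intros)

theorem theorem3p11:
  fixes k :: nat
  assumes "CARD('a::finite) \<ge> 2"
  shows "\<exists>P :: 'a program.
    enumerates_with_polynomial_delay P
      {(q, s). is_regex_k_ucq k q} enc_input (\<lambda>(q, s). ucq_sem q s) represents_tuple"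
proof -
  obtain p where p: "\<And>n. total_bound k n = poly p n"
    using polynomial_total_bound[of k] unfolding polynomial_def by blast
  have "enumerates_with_polynomial_delay (prog :: 'a program)
      {(q, s). is_regex_k_ucq k q} enc_input (\<lambda>(q, s). ucq_sem q s) represents_tuple"
    unfolding enumerates_with_polynomial_delay_def
    by (rule exI[of _ p]) (use main_correct in \<open>auto simp: p[symmetric]\<close>)
  then show ?thesis by blast
qed

end
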